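(* Let $\mathsf{V}$ be a monoidal pseudovariety of semigroups such that $\mathsf{Sl}\subseteq\mathsf{V}\subseteq\mathsf{DS}\cap\mathsf{RS}$. If $\mathsf{V}$ is local, then $\overline{\mathsf{V}}$ is local.
   Context: A semigroup (monoid) pseudovariety is a class of finite semigroups (monoids) closed under subsemigroups (submonoids), homomorphic images and finite direct products. $\mathsf{Sl}$: finite semilattices; $\mathsf{DS}$: finite semigroups whose regular $\mathcal{J}$-classes are subsemigroups; $\mathsf{RS}$: the class of finite semigroups whose set of regular elements ($s$ with $s\in sSs$) is a subsemigroup ($\mathsf{DS}\cap\mathsf{RS}$ is a pseudovariety). A semigroup pseudovariety is monoidal if it is the least semigroup pseudovariety containing (the members, viewed as semigroups, of) some pseudovariety of monoids. Closure under bideterministic product (all alphabets finite). A language $L\subseteq A^*$ is a prefix code (resp. suffix code) if $uA^+\cap L=\emptyset$ (resp. $A^+u\cap L=\emptyset$) for all $u\in L$. A language $L\subseteq A^+$ is $\mathsf{V}$-recognizable if $L=\varphi^{-1}(\varphi(L))$ for some homomorphism $\varphi\colon A^+\to S$ with $S\in\mathsf{V}$. A semigroup pseudovariety $\mathsf{V}$ is closed under bideterministic product if, for every alphabet $A$ and letter $a\in A$, $LaK$ is $\mathsf{V}$-recognizable whenever each of $L,K$ is either a $\mathsf{V}$-recognizable subset of $A^+$ or equal to $\{1\}$, $La$ is a prefix code and $aK$ is a suffix code. $\overline{\mathsf{V}}$ is the least semigroup pseudovariety containing $\mathsf{V}$ that is closed under bideterministic product. Locality. A semigroupoid $S$ is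 a directed graph with vertex set $V(S)$ and edge set $E(S)$, maps $\alpha,\omega\colon E(S)\to V(S)$ (beginning and end), and a partial associative multiplication on edges, $st$ being defined iff $\omega(s)=\alpha(t)$, with $\alpha(st)=\alpha(s)$, $\omega(st)=\omega(t)$. A semigroup is viewed as a one-vertex semigroupoid. The local semigroup of $S$ at a vertex $v$ is the semigroup of loops at $v$ (if there are none, it imposes no condition). A homomorphism is faithful if it is injective on each set of coterminal edges. $S$ divides $T$ if there are a semigroupoid $U$, a faithful homomorphism $U\to T$, and a homomorphism $U\to S$ that is bijective on vertices and surjective on edges. A pseudovariety of semigroupoids is a class of finite semigroupoids closed under divisors and finite direct products. For a semigroup pseudovariety $\mathsf{V}$, $g\mathsf{V}$ is the pseudovariety of semigroupoids generated by $\mathsf{V}$, and $\ell\mathsf{V}$ is the class of finite semigroupoids whose local semigroups belong to $\mathsf{V}$. $\mathsf{V}$ is local if $g\mathsf{V}=\ell\mathsf{V}$. *)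

theory Defs
  imports "HOL-Algebra.Product_Groups"
begin

text \<open>
  Every finite semigroup, monoid, semigroupoid or alphabet has an isomorphic copy on natural
  numbers, and all classes considered are closed under isomorphism. A class of finite structures is
  therefore a set of structures with carrier in \<^typ>\<open>nat\<close>. Operations are only
  relevant on the carrier: two records agreeing there are isomorphic.
\<close>

section \<open>Semigroups\<close>

record 'a sgp = "'a partial_object" +
  sop :: "'a \<Rightarrow> 'a \<Rightarrow> 'a" (infixl \<open>\<cdot>\<index>\<close> 70)

definition is_semigroup :: "('a, 'm) sgp_scheme \<Rightarrow> bool" where
  "is_semigroup S \<longleftrightarrow>
     carrier S \<noteq> {} \<and>
     (\<forall>x\<in>carrier S. \<forall>y\<in>carrier S. x \<cdot>\<^bsub>S\<^esub> y \<in> carrier S) \<and>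
     (\<forall>x\<in>carrier S. \<forall>y\<in>carrier S. \<forall>z\<in>carrier S.
        (x \<cdot>\<^bsub>S\<^esub> y) \<cdot>\<^bsub>S\<^esub> z = x \<cdot>\<^bsub>S\<^esub> (y \<cdot>\<^bsub>S\<^esub> z))"

definition fin_sgps :: "nat sgp set" where
  "fin_sgps = {S. is_semigroup S \<and> finite (carrier S)}"

definition sgp_hom :: "('a, 'm) sgp_scheme \<Rightarrow> ('b, 'n) sgp_scheme \<Rightarrow> ('a \<Rightarrow> 'b) set" where
  "sgp_hom S T = {h. h \<in> carrier S \<rightarrow> carrier T \<and>
     (\<forall>x\<in>carrier S. \<forall>y\<in>carrier S. h (x \<cdot>\<^bsub>S\<^esub> y) = h x \<cdot>\<^bsub>T\<^esub> h y)}"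

definition sgp_epi :: "('a, 'm) sgp_scheme \<Rightarrow> ('b, 'n) sgp_scheme \<Rightarrow> ('a \<Rightarrow> 'b) set" where
  "sgp_epi S T = {h \<in> sgp_hom S T. h ` carrier S = carrier T}"

definition sgp_iso :: "('a, 'm) sgp_scheme \<Rightarrow> ('b, 'n) sgp_scheme \<Rightarrow> ('a \<Rightarrow> 'b) set" where
  "sgp_iso S T = {h \<in> sgp_hom S T. bij_betw h (carrier S) (carrier T)}"

definition subsemigroup :: "'a set \<Rightarrow> ('a, 'm) sgp_scheme \<Rightarrow> bool" where
  "subsemigroup H S \<longleftrightarrow>
     H \<noteq> {} \<and> H \<subseteq> carrier S \<and> (\<forall>x\<in>H. \<forall>y\<in>H. x \<cdot>\<^bsub>S\<^esub> y \<in> H)"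

definition product_sgp :: "'i set \<Rightarrow> ('i \<Rightarrow> 'a sgp) \<Rightarrow> ('i \<Rightarrow> 'a) sgp" where
  "product_sgp I S = \<lparr>carrier = (\<Pi>\<^sub>E i\<in>I. carrier (S i)),
                      sop = (\<lambda>x y. \<lambda>i\<in>I. x i \<cdot>\<^bsub>S i\<^esub> y i)\<rparr>"

text \<open>The empty index set is allowed, so the trivial semigroups belong to every pseudovariety.\<close>

definition sgp_pseudovariety :: "nat sgp set \<Rightarrow> bool" where
  "sgp_pseudovariety V \<longleftrightarrow>
     V \<subseteq> fin_sgps \<and>
     (\<forall>S\<in>V. \<forall>H. subsemigroup H S \<longrightarrow> S\<lparr>carrier := H\<rparr> \<in> V) \<and>
     (\<forall>S\<in>V. \<forall>T\<in>fin_sgps. sgp_epi S T \<noteq> {} \<longrightarrow> T \<in> V) \<and>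
     (\<forall>(I::nat set) S. \<forall>P\<in>fin_sgps. finite I \<longrightarrow> (\<forall>i\<in>I. S i \<in> V) \<longrightarrow>
        sgp_iso (product_sgp I S) P \<noteq> {} \<longrightarrow> P \<in> V)"

definition generated_sgp_pseudovariety :: "nat sgp set \<Rightarrow> nat sgp set" where
  "generated_sgp_pseudovariety X = \<Inter>{W. sgp_pseudovariety W \<and> X \<subseteq> W}"


section \<open>Monoids and monoidal pseudovarieties\<close>

definition fin_monoids :: "nat monoid set" where
  "fin_monoids = {M. monoid M \<and> finite (carrier M)}"

text \<open>
  Neither \<^const>\<open>epi\<close> nor \<^const>\<open>iso\<close> mentions the identity element, but a surjective
  multiplicative map between monoids preserves it.
\<close>

definition monoid_pseudovariety :: "nat monoid set \<Rightarrow> bool" where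
  "monoid_pseudovariety V \<longleftrightarrow>
     V \<subseteq> fin_monoids \<and>
     (\<forall>M\<in>V. \<forall>H. submonoid H M \<longrightarrow> M\<lparr>carrier := H\<rparr> \<in> V) \<and>
     (\<forall>M\<in>V. \<forall>N\<in>fin_monoids. epi M N \<noteq> {} \<longrightarrow> N \<in> V) \<and>
     (\<forall>(I::nat set) M. \<forall>P\<in>fin_monoids. finite I \<longrightarrow> (\<forall>i\<in>I. M i \<in> V) \<longrightarrow>
        product_group I M \<cong> P \<longrightarrow> P \<in> V)"

definition sgp_of_monoid :: "'a monoid \<Rightarrow> 'a sgp" where
  "sgp_of_monoid M = \<lparr>carrier = carrier M, sop = monoid.mult M\<rparr>"

definition monoidal :: "nat sgp set \<Rightarrow> bool" where
  "monoidal V \<longleftrightarrow>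
     (\<exists>M. monoid_pseudovariety M \<and> V = generated_sgp_pseudovariety (sgp_of_monoid ` M))"


section \<open>The classes Sl, DS and RS\<close>

definition Sl :: "nat sgp set" where
  "Sl = {S \<in> fin_sgps.
     (\<forall>x\<in>carrier S. \<forall>y\<in>carrier S. x \<cdot>\<^bsub>S\<^esub> y = y \<cdot>\<^bsub>S\<^esub> x) \<and>
     (\<forall>x\<in>carrier S. x \<cdot>\<^bsub>S\<^esub> x = x)}"

definition regular_elements :: "('a, 'm) sgp_scheme \<Rightarrow> 'a set" where
  "regular_elements S = {s \<in> carrier S. \<exists>x\<in>carrier S. s = s \<cdot>\<^bsub>S\<^esub> x \<cdot>\<^bsub>S\<^esub> s}"

definition principal_ideal :: "('a, 'm) sgp_scheme \<Rightarrow> 'a \<Rightarrow> 'a set" where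
  "principal_ideal S s =
     {s} \<union> {x \<cdot>\<^bsub>S\<^esub> s | x. x \<in> carrier S} \<union> {s \<cdot>\<^bsub>S\<^esub> y | y. y \<in> carrier S}
     \<union> {x \<cdot>\<^bsub>S\<^esub> s \<cdot>\<^bsub>S\<^esub> y | x y. x \<in> carrier S \<and> y \<in> carrier S}"

definition J_class :: "('a, 'm) sgp_scheme \<Rightarrow> 'a \<Rightarrow> 'a set" where
  "J_class S s = {t \<in> carrier S. principal_ideal S t = principal_ideal S s}"

text \<open>A \<open>\<J>\<close>-class is regular if it contains a regular element.\<close>

definition DS :: "nat sgp set" where
  "DS = {S \<in> fin_sgps. \<forall>s\<in>regular_elements S. subsemigroup (J_class S s) S}"

definition RS :: "nat sgp set" where
  "RS = {S \<in> fin_sgps. subsemigroup (regular_elements S) S}"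


section \<open>Languages and bideterministic product\<close>

text \<open>
  Words over the alphabet \<open>A\<close> are lists in \<^term>\<open>lists A\<close>, the empty word being \<^term>\<open>[]\<close>.
\<close>

definition free_sgp :: "'a set \<Rightarrow> 'a list sgp" where
  "free_sgp A = \<lparr>carrier = lists A - {[]}, sop = (@)\<rparr>"

definition prefix_code :: "'a set \<Rightarrow> 'a list set \<Rightarrow> bool" where
  "prefix_code A L \<longleftrightarrow>
     L \<subseteq> lists A \<and> (\<forall>u\<in>L. {u @ w | w. w \<in> lists A - {[]}} \<inter> L = {})"

definition suffix_code :: "'a set \<Rightarrow> 'a list set \<Rightarrow> bool" where
  "suffix_code A L \<longleftrightarrow>
     L \<subseteq> lists A \<and> (\<forall>u\<in>L. {w @ u | w. w \<in> lists A - {[]}} \<inter> L = {})"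

definition recognizable :: "nat sgp set \<Rightarrow> 'a set \<Rightarrow> 'a list set \<Rightarrow> bool" where
  "recognizable V A L \<longleftrightarrow>
     L \<subseteq> lists A - {[]} \<and>
     (\<exists>S\<in>V. \<exists>\<phi>\<in>sgp_hom (free_sgp A) S. L = {w \<in> lists A - {[]}. \<phi> w \<in> \<phi> ` L})"

definition closed_under_bideterministic_product :: "nat sgp set \<Rightarrow> bool" where
  "closed_under_bideterministic_product V \<longleftrightarrow>
     (\<forall>(A::nat set). finite A \<longrightarrow> (\<forall>a\<in>A. \<forall>L K.
        (recognizable V A L \<or> L = {[]}) \<longrightarrow>
        (recognizable V A K \<or> K = {[]}) \<longrightarrow>
        prefix_code A {u @ [a] | u. u \<in> L} \<longrightarrow>
        suffix_code A {[a] @ v | v. v \<in> K} \<longrightarrow>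
        recognizable V A {u @ [a] @ v | u v. u \<in> L \<and> v \<in> K}))"

text \<open>
  The intersection has the closure property itself, since the syntactic semigroup of a language
  lies in every pseudovariety recognizing it.
\<close>

definition bideterministic_closure :: "nat sgp set \<Rightarrow> nat sgp set" where
  "bideterministic_closure V =
     \<Inter>{W. sgp_pseudovariety W \<and> closed_under_bideterministic_product W \<and> V \<subseteq> W}"


section \<open>Semigroupoids and locality\<close>

record ('v, 'e) sgpoid =
  vertices :: "'v set"
  edges :: "'e set"
  source :: "'e \<Rightarrow> 'v"
  target :: "'e \<Rightarrow> 'v"
  ecomp :: "'e \<Rightarrow> 'e \<Rightarrow> 'e"

text \<open>
  The product \<^term>\<open>ecomp S s t\<close> (read: first \<open>s\<close>, then \<open>t\<close>) is meaningful only if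
  \<^term>\<open>target S s = source S t\<close>.
\<close>

definition is_semigroupoid :: "('v, 'e) sgpoid \<Rightarrow> bool" where
  "is_semigroupoid S \<longleftrightarrow>
     (\<forall>s\<in>edges S. source S s \<in> vertices S \<and> target S s \<in> vertices S) \<and>
     (\<forall>s\<in>edges S. \<forall>t\<in>edges S. target S s = source S t \<longrightarrow>
        ecomp S s t \<in> edges S \<and>
        source S (ecomp S s t) = source S s \<and> target S (ecomp S s t) = target S t) \<and>
     (\<forall>s\<in>edges S. \<forall>t\<in>edges S. \<forall>u\<in>edges S.
        target S s = source S t \<longrightarrow> target S t = source S u \<longrightarrow>
        ecomp S (ecomp S s t) u = ecomp S s (ecomp S t u))"

definition fin_sgpoids :: "(nat, nat) sgpoid set" where
  "fin_sgpoids = {S. is_semigroupoid S \<and> finite (vertices S) \<and> finite (edges S)}"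

definition sgpoid_hom ::
  "('v, 'e) sgpoid \<Rightarrow> ('w, 'f) sgpoid \<Rightarrow> (('v \<Rightarrow> 'w) \<times> ('e \<Rightarrow> 'f)) set" where
  "sgpoid_hom S T = {(f, g).
     f \<in> vertices S \<rightarrow> vertices T \<and> g \<in> edges S \<rightarrow> edges T \<and>
     (\<forall>s\<in>edges S. source T (g s) = f (source S s) \<and> target T (g s) = f (target S s)) \<and>
     (\<forall>s\<in>edges S. \<forall>t\<in>edges S. target S s = source S t \<longrightarrow>
        g (ecomp S s t) = ecomp T (g s) (g t))}"

definition faithful :: "('v, 'e) sgpoid \<Rightarrow> ('v \<Rightarrow> 'w) \<times> ('e \<Rightarrow> 'f) \<Rightarrow> bool" where
  "faithful S h \<longleftrightarrow>
     (\<forall>v\<in>vertices S. \<forall>w\<in>vertices S.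
        inj_on (snd h) {s \<in> edges S. source S s = v \<and> target S s = w})"

text \<open>
  If \<open>S\<close> and \<open>T\<close> are finite, then so is the intermediate semigroupoid \<open>U\<close>.
\<close>

definition sgpoid_divides :: "(nat, nat) sgpoid \<Rightarrow> (nat, nat) sgpoid \<Rightarrow> bool" where
  "sgpoid_divides S T \<longleftrightarrow>
     (\<exists>U :: (nat, nat) sgpoid. is_semigroupoid U \<and>
        (\<exists>h\<in>sgpoid_hom U T. faithful U h) \<and>
        (\<exists>(f, g)\<in>sgpoid_hom U S.
           bij_betw f (vertices U) (vertices S) \<and> g ` edges U = edges S))"

definition product_sgpoid ::
  "'i set \<Rightarrow> ('i \<Rightarrow> ('v, 'e) sgpoid) \<Rightarrow> ('i \<Rightarrow> 'v, 'i \<Rightarrow> 'e) sgpoid" where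
  "product_sgpoid I S =
     \<lparr>vertices = (\<Pi>\<^sub>E i\<in>I. vertices (S i)),
      edges = (\<Pi>\<^sub>E i\<in>I. edges (S i)),
      source = (\<lambda>s. \<lambda>i\<in>I. source (S i) (s i)),
      target = (\<lambda>s. \<lambda>i\<in>I. target (S i) (s i)),
      ecomp = (\<lambda>s t. \<lambda>i\<in>I. ecomp (S i) (s i) (t i))\<rparr>"

definition sgpoid_iso ::
  "('v, 'e) sgpoid \<Rightarrow> ('w, 'f) sgpoid \<Rightarrow> (('v \<Rightarrow> 'w) \<times> ('e \<Rightarrow> 'f)) set" where
  "sgpoid_iso S T = {(f, g) \<in> sgpoid_hom S T.
     bij_betw f (vertices S) (vertices T) \<and> bij_betw g (edges S) (edges T)}"

definition sgpoid_pseudovariety :: "(nat, nat) sgpoid set \<Rightarrow> bool" where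
  "sgpoid_pseudovariety W \<longleftrightarrow>
     W \<subseteq> fin_sgpoids \<and>
     (\<forall>T\<in>W. \<forall>S\<in>fin_sgpoids. sgpoid_divides S T \<longrightarrow> S \<in> W) \<and>
     (\<forall>(I::nat set) S. \<forall>P\<in>fin_sgpoids. finite I \<longrightarrow> (\<forall>i\<in>I. S i \<in> W) \<longrightarrow>
        sgpoid_iso (product_sgpoid I S) P \<noteq> {} \<longrightarrow> P \<in> W)"

definition sgpoid_of_sgp :: "nat sgp \<Rightarrow> (nat, nat) sgpoid" where
  "sgpoid_of_sgp S =
     \<lparr>vertices = {0}, edges = carrier S, source = (\<lambda>_. 0), target = (\<lambda>_. 0), ecomp = sop S\<rparr>"

definition local_sgp :: "('v, 'e) sgpoid \<Rightarrow> 'v \<Rightarrow> 'e sgp" where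
  "local_sgp S v =
     \<lparr>carrier = {s \<in> edges S. source S s = v \<and> target S s = v}, sop = ecomp S\<rparr>"

definition global_sgpoids :: "nat sgp set \<Rightarrow> (nat, nat) sgpoid set" where
  "global_sgpoids V = \<Inter>{W. sgpoid_pseudovariety W \<and> sgpoid_of_sgp ` V \<subseteq> W}"

definition locally_sgpoids :: "nat sgp set \<Rightarrow> (nat, nat) sgpoid set" where
  "locally_sgpoids V = {S \<in> fin_sgpoids.
     \<forall>v\<in>vertices S. carrier (local_sgp S v) \<noteq> {} \<longrightarrow> local_sgp S v \<in> V}"

definition local_pseudovariety :: "nat sgp set \<Rightarrow> bool" where
  "local_pseudovariety V \<longleftrightarrow> global_sgpoids V = locally_sgpoids V"

end

theory Submission
  imports Defs "HOL-Library.Ramsey"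
begin

text \<open>
  Say that \<open>S\<close> is covered by \<open>V\<close> if it satisfies the pseudoidentities of \<open>DS \<inter> RS\<close> and has a
  relational morphism to some \<open>T \<in> V\<close> under which elements related to the same \<open>t\<close> have the same
  \<open>(\<omega>+1)\<close>-power. The covered semigroups form a pseudovariety containing \<open>V\<close>. It is closed under
  bideterministic product: if a word with a factor \<open>b\<^sup>n\<close>, \<open>n\<close> large, is factorized as an element of \<open>LaK\<close>,
  then the marked letter is not inside \<open>b\<^sup>n\<close>, since pumping would contradict one of the code
  conditions; so words built from high powers with equal values are syntactically equivalent.
  Hence the closure consists of covered semigroups.

  Let \<open>S\<close> be a finite semigroupoid with covered local semigroups. Identifying coterminal edges whose
  completions to loops have equal \<open>(\<omega>+1)\<close>-powers gives a quotient with local semigroups in \<open>V\<close>, which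
  divides some \<open>T \<in> V\<close> by locality. By induction on the \<open>\<J>\<close>-order every edge \<open>s\<close> of \<open>S\<close> is recognized in the
  closure. If \<open>s\<close> is regular, it is determined by its image in \<open>T\<close> up to edges strictly \<open>\<J>\<close>-above it.
  Otherwise, factorize a path with value \<open>s\<close> into regular blocks separated by letters, with as few
  separating letters as possible. By \<open>DS \<inter> RS\<close> no separating letter is \<open>\<J>\<close>-above a neighbouring block,
  so it does not occur there, and the corresponding product of languages is bideterministic.
\<close>

section \<open>Products of words and powers\<close>

text \<open>The closure is known only as a least class, which gives no grip on its members; being
  covered is a necessary condition that is easy to test. It is strong enough, because locally
  covered semigroupoids already divide members of the closure. Covers control (\<omega>+1)-powers
  only: a marked product can separate words with equal values in the recognizing semigroup, but not
  their high powers. Under the identities regular elements are their own (\<omega>+1)-powers, so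
  covers still see them; all other edges must be produced by products of languages. That
  construction stays finite because factorizations with fewest markers are bounded: by Ramsey's
  theorem a long one has adjacent segments with a common idempotent value, which is regular, and
  these could be merged. So finitely many types of factorization suffice. Bideterminism has to be
  checked at each marker against the two neighbouring blocks only, since markers can be located one
  after the other from the right. There is no identity element, so empty words, empty blocks and
  one-sided multiples need separate care.\<close>

fun wprod :: "('a \<Rightarrow> 'a \<Rightarrow> 'a) \<Rightarrow> 'a list \<Rightarrow> 'a" where
  "wprod f [] = undefined"
| "wprod f [a] = a"
| "wprod f (a # b # w) = f a (wprod f (b # w))"

lemma wprod_Cons: "w \<noteq> [] \<Longrightarrow> wprod f (a # w) = f a (wprod f w)"
  by (cases w) auto

definition composable :: "('v, 'e) sgpoid \<Rightarrow> 'e list \<Rightarrow> bool" where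
  "composable S w \<longleftrightarrow>
     set w \<subseteq> edges S \<and> successively (\<lambda>a b. target S a = source S b) w"

lemma composable_Nil [simp]: "composable S []"
  by (simp add: composable_def)

lemma composable_single [simp]: "composable S [a] \<longleftrightarrow> a \<in> edges S"
  by (simp add: composable_def)

lemma composable_append_iff:
  "composable S (u @ v) \<longleftrightarrow> composable S u \<and> composable S v \<and>
     (u = [] \<or> v = [] \<or> target S (last u) = source S (hd v))"
  by (auto simp: composable_def successively_append_iff)

lemma composable_Cons_iff:
  "composable S (a # v) \<longleftrightarrow> a \<in> edges S \<and> composable S v \<and>
     (v = [] \<or> target S a = source S (hd v))"
  using composable_append_iff[of S "[a]" v] by simp

lemmas composable_simps = composable_append_iff composable_Cons_iff

locale semigroupoid =
  fixes S :: "('v, 'e) sgpoid"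
  assumes is_sgpoid: "is_semigroupoid S"
begin

abbreviation E where "E \<equiv> edges S"
abbreviation src where "src \<equiv> source S"
abbreviation tgt where "tgt \<equiv> target S"
abbreviation comp (infixl \<open>\<odot>\<close> 70) where "comp \<equiv> ecomp S"
abbreviation ev where "ev \<equiv> wprod (ecomp S)"

lemma comp_edge: "\<lbrakk>s \<in> E; t \<in> E; tgt s = src t\<rbrakk> \<Longrightarrow> s \<odot> t \<in> E"
  and comp_src: "\<lbrakk>s \<in> E; t \<in> E; tgt s = src t\<rbrakk> \<Longrightarrow> src (s \<odot> t) = src s"
  and comp_tgt: "\<lbrakk>s \<in> E; t \<in> E; tgt s = src t\<rbrakk> \<Longrightarrow> tgt (s \<odot> t) = tgt t"
  using is_sgpoid by (auto simp: is_semigroupoid_def)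

lemma comp_assoc:
  "\<lbrakk>s \<in> E; t \<in> E; u \<in> E; tgt s = src t; tgt t = src u\<rbrakk> \<Longrightarrow> s \<odot> t \<odot> u = s \<odot> (t \<odot> u)"
  using is_sgpoid by (auto simp: is_semigroupoid_def)

lemmas comp_ends = comp_edge comp_src comp_tgt
  and comp_simps = comp_assoc comp_edge comp_src comp_tgt

lemma src_vertex: "s \<in> E \<Longrightarrow> src s \<in> vertices S"
  and tgt_vertex: "s \<in> E \<Longrightarrow> tgt s \<in> vertices S"
  using is_sgpoid by (auto simp: is_semigroupoid_def)

lemma ev_path:
  "\<lbrakk>composable S w; w \<noteq> []\<rbrakk> \<Longrightarrow>
    ev w \<in> E \<and> src (ev w) = src (hd w) \<and> tgt (ev w) = tgt (last w)"
proof (induction w)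
  case (Cons a w)
  then show ?case
    by (cases "w = []") (auto simp: composable_Cons_iff wprod_Cons comp_ends)
qed simp

lemmas ev_edge = ev_path[THEN conjunct1]
  and ev_src = ev_path[THEN conjunct2, THEN conjunct1]
  and ev_tgt = ev_path[THEN conjunct2, THEN conjunct2]

lemma ev_append:
  "\<lbrakk>composable S (u @ v); u \<noteq> []; v \<noteq> []\<rbrakk> \<Longrightarrow> ev (u @ v) = ev u \<odot> ev v"
proof (induction u)
  case (Cons a u)
  show ?case
  proof (cases "u = []")
    case True
    then show ?thesis using Cons by (simp add: wprod_Cons)
  next
    case False
    have 1: "composable S (u @ v)" "a \<in> E" "tgt a = src (hd u)"
      using Cons.prems False by (auto simp: composable_Cons_iff)
    have c: "composable S u" "composable S v" "tgt (last u) = src (hd v)"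
      using 1 False Cons.prems by (auto simp: composable_append_iff)
    have "ev ((a # u) @ v) = a \<odot> (ev u \<odot> ev v)"
      using Cons.IH 1 False Cons.prems by (simp add: wprod_Cons)
    also have "\<dots> = a \<odot> ev u \<odot> ev v"
      using c False Cons.prems 1 by (simp add: comp_assoc ev_path)
    finally show ?thesis using False by (simp add: wprod_Cons)
  qed
qed simp

text \<open>An edge determines its end vertices, so a path with the same value as \<open>v\<close>
  fits into the same context. Either of \<open>u\<close> and \<open>w\<close> may be empty.\<close>

lemma ev_append3:
  assumes "composable S (u @ v @ w)" "v \<noteq> []" "composable S v'" "v' \<noteq> []" "ev v' = ev v"
  shows "composable S (u @ v' @ w)" "ev (u @ v' @ w) = ev (u @ v @ w)"
proof -
  have c: "composable S v" using assms by (simp add: composable_append_iff)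
  have e: "src (hd v') = src (hd v)" "tgt (last v') = tgt (last v)"
    using ev_path[OF c] ev_path[OF assms(3)] assms by auto
  show c': "composable S (u @ v' @ w)"
    using assms e by (auto simp: composable_append_iff)
  have cc: "composable S (v @ w)" "composable S (v' @ w)" 
    using assms(1) c' by (simp_all add: composable_append_iff)
  have 1: "ev (v' @ w) = ev (v @ w)"
    using cc assms by (cases "w = []") (auto simp: ev_append)
  show "ev (u @ v' @ w) = ev (u @ v @ w)"
    using 1 assms c' by (cases "u = []") (auto simp: ev_append)
qed

end

text \<open>Powers are values of constant words, hence positive only (the zeroth power is
  \<open>undefined\<close>); in a local semigroup they thereby become values of paths.\<close>

definition spow :: "('a, 'm) sgp_scheme \<Rightarrow> 'a \<Rightarrow> nat \<Rightarrow> 'a" where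
  "spow S x n = wprod (sop S) (replicate n x)"

lemma composable_sgp [simp]: "composable (sgpoid_of_sgp S) w \<longleftrightarrow> set w \<subseteq> carrier S"
proof (induction w)
  case (Cons a w)
  then show ?case by (auto simp: composable_Cons_iff sgpoid_of_sgp_def)
qed simp

locale sgp =
  fixes S :: "nat sgp"
  assumes is_sgp: "is_semigroup S"
begin

text \<open>A semigroup is a one-vertex semigroupoid, so the path calculus covers products of words.
  The last two rewrites discharge the end conditions, which become \<open>0 = 0\<close>.\<close>

sublocale semigroupoid "sgpoid_of_sgp S"
  rewrites "ecomp (sgpoid_of_sgp S) = sop S"
    and "edges (sgpoid_of_sgp S) = carrier S"
    and "\<And>x. source (sgpoid_of_sgp S) x = 0"
    and "\<And>x. target (sgpoid_of_sgp S) x = 0"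
    and "(0::nat) = 0 \<equiv> True"
    and "\<And>P. (True \<Longrightarrow> PROP P) \<equiv> PROP P"
  using is_sgp
  by unfold_locales
     (auto simp: is_semigroup_def sgpoid_of_sgp_def is_semigroupoid_def)

abbreviation mul (infixl \<open>\<bullet>\<close> 70) where "mul \<equiv> sop S"

lemma mult_closed: "\<lbrakk>x \<in> carrier S; y \<in> carrier S\<rbrakk> \<Longrightarrow> x \<bullet> y \<in> carrier S"
  and mult_assoc: "\<lbrakk>x \<in> carrier S; y \<in> carrier S; z \<in> carrier S\<rbrakk> \<Longrightarrow>
    x \<bullet> y \<bullet> z = x \<bullet> (y \<bullet> z)"
  using is_sgp by (auto simp: is_semigroup_def)

lemma wprod_closed: "\<lbrakk>set w \<subseteq> carrier S; w \<noteq> []\<rbrakk> \<Longrightarrow> wprod (sop S) w \<in> carrier S"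
  using ev_edge[of w] by simp

lemma wprod_append: "\<lbrakk>set u \<subseteq> carrier S; set v \<subseteq> carrier S; u \<noteq> []; v \<noteq> []\<rbrakk> \<Longrightarrow>
    wprod (sop S) (u @ v) = wprod (sop S) u \<bullet> wprod (sop S) v"
  using ev_append[of u v] by simp

lemma spow_closed: "\<lbrakk>x \<in> carrier S; n > 0\<rbrakk> \<Longrightarrow> spow S x n \<in> carrier S"
  using wprod_closed[of "replicate n x"] by (simp add: spow_def)

lemma spow_1 [simp]: "spow S x (Suc 0) = x"
  by (simp add: spow_def)

lemma spow_add:
  "\<lbrakk>x \<in> carrier S; m > 0; n > 0\<rbrakk> \<Longrightarrow> spow S x (m + n) = spow S x m \<bullet> spow S x n"
  using wprod_append[of "replicate m x" "replicate n x"] by (simp add: spow_def replicate_add)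

lemma spow_Suc: "\<lbrakk>x \<in> carrier S; n > 0\<rbrakk> \<Longrightarrow> spow S x (Suc n) = x \<bullet> spow S x n"
  using spow_add[of x "Suc 0" n] by simp

lemma spow_Suc2: "\<lbrakk>x \<in> carrier S; n > 0\<rbrakk> \<Longrightarrow> spow S x (Suc n) = spow S x n \<bullet> x"
  using spow_add[of x n "Suc 0"] by simp

lemma spow_mult:
  "\<lbrakk>x \<in> carrier S; m > 0; n > 0\<rbrakk> \<Longrightarrow> spow S (spow S x m) n = spow S x (m * n)"
proof (induction n)
  case (Suc n)
  show ?case
  proof (cases "n = 0")
    case False
    then show ?thesis
      using Suc spow_add[of x m "m * n"] by (simp add: spow_Suc spow_closed)
  qed simp
qed simp

end

lemma sgp_hom_wprod:
  assumes "h \<in> sgp_hom S T" "set w \<subseteq> carrier S" "w \<noteq> []" "is_semigroup S"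
  shows "h (wprod (sop S) w) = wprod (sop T) (map h w)"
  using assms(2,3)
proof (induction w)
  case (Cons a w)
  have cl: "set v \<subseteq> carrier S \<Longrightarrow> v \<noteq> [] \<Longrightarrow> wprod (sop S) v \<in> carrier S" for v
  proof (induction v)
    case (Cons b v)
    then show ?case using assms(4) by (cases "v = []") (auto simp: wprod_Cons is_semigroup_def)
  qed simp
  show ?case
    using Cons cl[of w] assms(1) by (cases "w = []") (auto simp: wprod_Cons sgp_hom_def)
qed simp

lemma sgp_hom_spow:
  assumes "h \<in> sgp_hom S T" "x \<in> carrier S" "n > 0" "is_semigroup S"
  shows "h (spow S x n) = spow T (h x) n"
  using sgp_hom_wprod[OF assms(1) _ _ assms(4), of "replicate n x"] assms
  by (auto simp: spow_def)

lemma sgp_hom_closed: "h \<in> sgp_hom S T \<Longrightarrow> x \<in> carrier S \<Longrightarrow> h x \<in> carrier T"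
  by (auto simp: sgp_hom_def)

lemma sgp_hom_mult:
  "h \<in> sgp_hom S T \<Longrightarrow> x \<in> carrier S \<Longrightarrow> y \<in> carrier S \<Longrightarrow> h (x \<cdot>\<^bsub>S\<^esub> y) = h x \<cdot>\<^bsub>T\<^esub> h y"
  by (auto simp: sgp_hom_def)

lemma free_hom_append:
  assumes "\<phi> \<in> sgp_hom (free_sgp A) S"
    "u \<in> lists A" "v \<in> lists A" "u \<noteq> []" "v \<noteq> []"
  shows "\<phi> (u @ v) = \<phi> u \<cdot>\<^bsub>S\<^esub> \<phi> v"
  using assms by (simp add: sgp_hom_def free_sgp_def)

lemma free_hom_closed:
  "\<lbrakk>\<phi> \<in> sgp_hom (free_sgp A) S; u \<in> lists A; u \<noteq> []\<rbrakk> \<Longrightarrow> \<phi> u \<in> carrier S"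
  by (auto simp: sgp_hom_def free_sgp_def)

lemma free_hom_cong:
  assumes \<phi>: "\<phi> \<in> sgp_hom (free_sgp A) S" and eq: "\<phi> u = \<phi> v"
    and l: "u \<in> lists A" "v \<in> lists A" "u \<noteq> []" "v \<noteq> []" "x \<in> lists A" "y \<in> lists A"
  shows "\<phi> (x @ u @ y) = \<phi> (x @ v @ y)"
proof -
  have 1: "\<phi> (u @ y) = \<phi> (v @ y)"
    using l eq by (cases "y = []") (simp_all add: free_hom_append[OF \<phi>])
  then show ?thesis
    using l by (cases "x = []") (simp_all add: free_hom_append[OF \<phi>])
qed

lemma free_hom_power:
  assumes \<phi>: "\<phi> \<in> sgp_hom (free_sgp A) S" and b: "b \<in> lists A" "b \<noteq> []" and n: "n > 0"
  shows "\<phi> (concat (replicate n b)) = spow S (\<phi> b) n"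
  using n
proof (induction n)
  case (Suc n)
  have "concat (replicate n b) \<in> lists A" using b by (auto simp: in_lists_conv_set)
  then show ?case
    using Suc b by (cases n) (auto simp: spow_def free_hom_append[OF \<phi>] wprod_Cons)
qed simp

lemma free_hom_extend:
  assumes "is_semigroup S" "\<forall>a\<in>A. t a \<in> carrier S"
  shows "(\<lambda>w. wprod (sop S) (map t w)) \<in> sgp_hom (free_sgp A) (S :: nat sgp)"
proof -
  interpret sgp S by unfold_locales fact
  have c: "set (map t x) \<subseteq> carrier S" if "x \<in> lists A" for x
    using assms(2) that by auto
  show ?thesis
    using wprod_closed[OF c] wprod_append[OF c c]
    by (auto simp: sgp_hom_def free_sgp_def)
qed

section \<open>Idempotent exponents\<close>

text \<open>One \<open>N\<close> plays \<omega> for all elements at once, and \<open>Suc N\<close>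
  plays \<omega>+1. Every positive multiple serves equally well, which lets several semigroups share
  an exponent.\<close>

definition idem_exponent :: "('a, 'm) sgp_scheme \<Rightarrow> nat \<Rightarrow> bool" where
  "idem_exponent S N \<longleftrightarrow>
     N > 0 \<and> (\<forall>x\<in>carrier S. spow S x N \<cdot>\<^bsub>S\<^esub> spow S x N = spow S x N)"

context sgp
begin

lemma spow_idem:
  assumes "e \<in> carrier S" "e \<bullet> e = e" "n > 0"
  shows "spow S e n = e"
  using assms(3)
proof (induction n)
  case (Suc n)
  then show ?case using assms by (cases "n = 0") (auto simp: spow_Suc)
qed simp

lemma exponent_multiple:
  assumes "idem_exponent S N" "k > 0" "x \<in> carrier S"
  shows "spow S x (N * k) = spow S x N" "spow S x (Suc (N * k)) = spow S x (Suc N)"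
proof -
  have N: "N > 0" and i: "spow S x N \<bullet> spow S x N = spow S x N"
    using assms by (auto simp: idem_exponent_def)
  have "spow S x (N * k) = spow S (spow S x N) k"
    using assms N by (simp add: spow_mult)
  then show *: "spow S x (N * k) = spow S x N"
    using spow_idem[OF _ i] N assms by (simp add: spow_closed)
  then show "spow S x (Suc (N * k)) = spow S x (Suc N)"
    using assms N by (simp add: spow_Suc)
qed

lemma idem_exponent_mult: "idem_exponent S N \<Longrightarrow> k > 0 \<Longrightarrow> idem_exponent S (N * k)"
  using exponent_multiple by (simp add: idem_exponent_def)

text \<open>The powers with exponents \<open>N\<close> and \<open>2 * N\<close> agree, so powers are
  periodic from index \<open>N\<close> on. Pumping a long power inside a language rests on
  this.\<close>

lemma spow_period:
  assumes N: "idem_exponent S N" and x: "x \<in> carrier S" and i: "i \<ge> N"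
  shows "spow S x (i + N) = spow S x i"
proof (cases "i = N")
  case True
  then show ?thesis using exponent_multiple(1)[OF N, of 2 x] x by (simp add: mult_2_right)
next
  case False
  have N0: "N > 0" using N by (auto simp: idem_exponent_def)
  obtain j where "i = N + j" using le_Suc_ex[OF i] by auto
  with False have j: "i = N + j" "j > 0" by auto
  have "spow S x (i + N) = spow S x (N * 2 + j)" using j by (simp add: algebra_simps mult_2_right)
  also have "\<dots> = spow S x (N * 2) \<bullet> spow S x j" using x j N0 by (subst spow_add) auto
  also have "\<dots> = spow S x N \<bullet> spow S x j" using exponent_multiple(1)[OF N, of 2 x] x by simp
  also have "\<dots> = spow S x i" using x j N0 by (simp add: spow_add)
  finally show ?thesis .
qed

lemma exists_idem_power:
  assumes "finite (carrier S)" "x \<in> carrier S"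
  shows "\<exists>n>0. spow S x n \<bullet> spow S x n = spow S x n"
proof -
  have "\<not> inj (\<lambda>i. spow S x (Suc i))"
  proof
    assume "inj (\<lambda>i. spow S x (Suc i))"
    moreover have "range (\<lambda>i. spow S x (Suc i)) \<subseteq> carrier S" using assms(2) spow_closed by auto
    ultimately show False using assms(1) finite_subset finite_imageD infinite_UNIV_nat by metis
  qed
  then obtain i j where ij: "i < j" "spow S x (Suc i) = spow S x (Suc j)"
    by (metis (mono_tags, lifting) injI linorder_neqE_nat)
  define p d where "p = Suc i" and "d = j - i"
  have p: "p > 0" "d > 0" "spow S x (p + d) = spow S x p" using ij by (auto simp: p_def d_def)
  have per: "spow S x (m + d) = spow S x m" if mp: "m \<ge> p" for m
  proof (cases "m = p")
    case False
    obtain r where "m = p + r" using le_Suc_ex[OF mp] by auto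
    with False have r: "m = p + r" "r > 0" by auto
    have "spow S x (p + d + r) = spow S x (p + d) \<bullet> spow S x r"
      by (rule spow_add[OF assms(2)]) (use p(1) r(2) in auto)
    also have "\<dots> = spow S x (p + r)"
      unfolding p(3) by (rule spow_add[OF assms(2) p(1) r(2), symmetric])
    also have "p + d + r = m + d" using r(1) by simp
    finally show ?thesis using r(1) by simp
  qed (use p in simp)
  have per': "spow S x (m + k * d) = spow S x m" if "m \<ge> p" for m k
  proof (induction k)
    case (Suc k)
    have "m + Suc k * d = (m + k * d) + d" by simp
    moreover have "m + k * d \<ge> p" using that by simp
    ultimately show ?case using Suc per[of "m + k * d"] by metis
  qed simp
  \<comment> \<open>\<open>p\<close> is an index and \<open>d\<close> a period, so an exponent that
    is at least \<open>p\<close> and divisible by \<open>d\<close> yields an idempotent.\<close>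
  have pd: "p * d > 0" "p * d \<ge> p" using p by auto
  have "spow S x (p * d) \<bullet> spow S x (p * d) = spow S x (p * d)"
    using per'[OF pd(2), of p] spow_add[OF assms(2) pd(1) pd(1)] by simp
  then show ?thesis using pd by blast
qed

lemma exists_idem_exponent:
  assumes "finite (carrier S)"
  shows "\<exists>N. idem_exponent S N"
proof -
  obtain n where n: "\<forall>x\<in>carrier S. n x > (0::nat) \<and>
      spow S x (n x) \<bullet> spow S x (n x) = spow S x (n x)"
    using exists_idem_power[OF assms] by metis
  define N where "N = prod n (carrier S)"
  have "N > 0" unfolding N_def by (rule prod_pos) (use n in blast)
  moreover have "spow S x N \<bullet> spow S x N = spow S x N" if x: "x \<in> carrier S" for x
  proof -
    define R where "R = prod n (carrier S - {x})"
    have N: "N = n x * R" unfolding N_def R_def by (rule prod.remove[OF assms x])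
    have r: "R > 0" unfolding R_def by (rule prod_pos) (use n in blast)
    have nx: "n x > 0" "spow S x (n x) \<bullet> spow S x (n x) = spow S x (n x)"
      using n x by blast+
    have "spow S x N = spow S (spow S x (n x)) R"
      unfolding N by (rule spow_mult[OF x nx(1) r, symmetric])
    also have "\<dots> = spow S x (n x)"
      by (rule spow_idem[OF spow_closed[OF x nx(1)] nx(2) r])
    finally have *: "spow S x N = spow S x (n x)" .
    show ?thesis unfolding * by (rule nx(2))
  qed
  ultimately show ?thesis unfolding idem_exponent_def by blast
qed

section \<open>The pseudoidentities of DS and RS\<close>

lemma principal_ideal_trans:
  assumes "s \<in> carrier S" "t \<in> principal_ideal S s"
  shows "principal_ideal S t \<subseteq> principal_ideal S s"
proof -
  have l: "x \<bullet> z \<in> principal_ideal S s" if z: "z \<in> principal_ideal S s" and x: "x \<in> carrier S" for x z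
  proof -
    from z consider "z = s" | u where "u \<in> carrier S" "z = u \<bullet> s"
      | v where "v \<in> carrier S" "z = s \<bullet> v"
      | u v where "u \<in> carrier S" "v \<in> carrier S" "z = u \<bullet> s \<bullet> v"
      by (auto simp: principal_ideal_def)
    then show ?thesis
    proof cases
      case (2 u)
      then have "x \<bullet> z = (x \<bullet> u) \<bullet> s" using x assms(1) by (simp add: mult_assoc)
      then show ?thesis using 2 x mult_closed unfolding principal_ideal_def by blast
    next
      case (3 v)
      then have "x \<bullet> z = x \<bullet> s \<bullet> v" using x assms(1) by (simp add: mult_assoc)
      then show ?thesis using 3 x unfolding principal_ideal_def by blast
    next
      case (4 u v)
      then have "x \<bullet> z = (x \<bullet> u) \<bullet> s \<bullet> v"
        using x assms(1) by (simp add: mult_assoc mult_closed)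
      then show ?thesis using 4 x mult_closed unfolding principal_ideal_def by blast
    qed (use x in \<open>auto simp: principal_ideal_def\<close>)
  qed
  have r: "z \<bullet> y \<in> principal_ideal S s" if z: "z \<in> principal_ideal S s" and y: "y \<in> carrier S" for y z
  proof -
    from z consider "z = s" | u where "u \<in> carrier S" "z = u \<bullet> s"
      | v where "v \<in> carrier S" "z = s \<bullet> v"
      | u v where "u \<in> carrier S" "v \<in> carrier S" "z = u \<bullet> s \<bullet> v"
      by (auto simp: principal_ideal_def)
    then show ?thesis
    proof cases
      case (3 v)
      then have "z \<bullet> y = s \<bullet> (v \<bullet> y)" using y assms(1) by (simp add: mult_assoc)
      then show ?thesis using 3 y mult_closed unfolding principal_ideal_def by blast
    next
      case (4 u v)
      then have "z \<bullet> y = u \<bullet> s \<bullet> (v \<bullet> y)"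
        using y assms(1) by (simp add: mult_assoc mult_closed)
      then show ?thesis using 4 y mult_closed unfolding principal_ideal_def by blast
    qed (use y in \<open>auto simp: principal_ideal_def\<close>)
  qed
  show ?thesis
  proof
    fix z assume "z \<in> principal_ideal S t"
    then show "z \<in> principal_ideal S s"
      unfolding principal_ideal_def[of S t] using assms(2) l r by blast
  qed
qed

lemma J_class_iff:
  assumes "s \<in> carrier S"
  shows "t \<in> J_class S s \<longleftrightarrow>
    t \<in> carrier S \<and> t \<in> principal_ideal S s \<and> s \<in> principal_ideal S t"
proof -
  have "u \<in> principal_ideal S u" for u by (simp add: principal_ideal_def)
  then show ?thesis
    unfolding J_class_def using principal_ideal_trans assms by blast
qed

text \<open>A regular \<open>s\<close> equals \<open>e \<bullet> s \<bullet> f\<close> for the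
  idempotents \<open>e = s \<bullet> z\<close> and \<open>f = z \<bullet> s\<close>; these supply
  the multipliers that membership in the ideal may leave out.\<close>

lemma principal_ideal_regular:
  assumes s: "s \<in> regular_elements S" and t: "t \<in> carrier S" and st: "s \<in> principal_ideal S t"
  shows "\<exists>a\<in>carrier S. \<exists>b\<in>carrier S. s = a \<bullet> t \<bullet> b"
proof -
  obtain z where z: "z \<in> carrier S" "s = s \<bullet> z \<bullet> s" and sc: "s \<in> carrier S"
    using s by (auto simp: regular_elements_def)
  define e f where "e = s \<bullet> z" and "f = z \<bullet> s"
  have ef: "e \<in> carrier S" "f \<in> carrier S" "s = e \<bullet> s \<bullet> f"
    using z sc mult_assoc mult_closed by (auto simp: e_def f_def)
  from st consider "s = t" | x where "x \<in> carrier S" "s = x \<bullet> t"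
    | y where "y \<in> carrier S" "s = t \<bullet> y"
    | x y where "x \<in> carrier S" "y \<in> carrier S" "s = x \<bullet> t \<bullet> y"
    by (auto simp: principal_ideal_def)
  then show ?thesis
  proof cases
    case 1
    then show ?thesis using ef by auto
  next
    case (2 x)
    then have "s = (e \<bullet> x) \<bullet> t \<bullet> f" using ef t mult_assoc mult_closed by metis
    then show ?thesis using 2 ef mult_closed by blast
  next
    case (3 y)
    then have "s = e \<bullet> t \<bullet> (y \<bullet> f)" using ef t mult_assoc mult_closed by metis
    then show ?thesis using 3 ef mult_closed by blast
  next
    case (4 x y)
    then show ?thesis by auto
  qed
qed

lemma spow_conj:
  assumes "x \<in> carrier S" "y \<in> carrier S" "n > 0"
  shows "spow S (x \<bullet> y) (Suc n) = x \<bullet> spow S (y \<bullet> x) n \<bullet> y"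
  using assms(3)
proof (induction n)
  case (Suc n)
  show ?case
  proof (cases "n = 0")
    case True
    then show ?thesis using assms by (simp add: spow_Suc mult_assoc mult_closed)
  next
    case False
    then show ?thesis using Suc assms
      by (simp add: spow_Suc[of _ "Suc n"] spow_Suc[of "y \<bullet> x" n] mult_assoc mult_closed spow_closed)
  qed
qed simp

lemma spow_absorb_right:
  assumes "c \<in> carrier S" "g \<in> carrier S" "c \<bullet> g = c" "n > 0"
  shows "spow S c n \<bullet> g = spow S c n"
  using assms(4)
proof (induction n)
  case (Suc n)
  then show ?case using assms by (cases "n = 0") (auto simp: spow_Suc mult_assoc spow_closed)
qed simp

lemma spow_absorb_left:
  assumes "c \<in> carrier S" "g \<in> carrier S" "g \<bullet> c = c" "n > 0"
  shows "g \<bullet> spow S c n = spow S c n"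
  using assms(4)
proof (induction n)
  case (Suc n)
  then show ?case using assms
    by (cases "n = 0") (auto simp: spow_Suc spow_closed simp flip: mult_assoc)
qed simp

lemma spow_sandwich:
  assumes "c \<in> carrier S" "b \<in> carrier S" "s \<in> carrier S" "s = c \<bullet> s \<bullet> b" "n > 0"
  shows "s = spow S c n \<bullet> s \<bullet> spow S b n"
  using assms(5)
proof (induction n)
  case (Suc n)
  show ?case
  proof (cases "n = 0")
    case False
    have "s = c \<bullet> (spow S c n \<bullet> s \<bullet> spow S b n) \<bullet> b"
      using Suc False assms by auto
    then show ?thesis
      using False assms by (simp add: spow_Suc[of c] spow_Suc2[of b] mult_assoc mult_closed spow_closed)
  qed (use assms in simp)
qed simp

text \<open>Iterating \<open>s = c \<bullet> s \<bullet> b\<close> brings idempotent powers to both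
  sides of \<open>s\<close>, where they are absorbed. This is stability of finite semigroups in
  equational form.\<close>

lemma spow_fix:
  assumes N: "idem_exponent S N"
    and "c \<in> carrier S" "b \<in> carrier S" "s \<in> carrier S" "s = c \<bullet> s \<bullet> b"
  shows "spow S c N \<bullet> s = s" "s \<bullet> spow S b N = s"
proof -
  have N0: "N > 0" and i: "spow S c N \<bullet> spow S c N = spow S c N"
    "spow S b N \<bullet> spow S b N = spow S b N"
    using assms by (auto simp: idem_exponent_def)
  have s: "s = spow S c N \<bullet> s \<bullet> spow S b N"
    using spow_sandwich[OF assms(2-5) N0] .
  have cl: "spow S c N \<in> carrier S" "spow S b N \<in> carrier S" using assms N0 by (auto simp: spow_closed)
  show "spow S c N \<bullet> s = s" "s \<bullet> spow S b N = s"
    using s i cl assms(4) mult_assoc mult_closed by metis+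
qed

text \<open>With \<open>k = a \<bullet> g\<close> one gets
  \<open>e = k \<bullet> e \<bullet> b\<close>, so \<open>spow S k N\<close> fixes \<open>e\<close>
  from the left; since this power absorbs \<open>g\<close> on its right, it equals \<open>e\<close>,
  and then \<open>e \<bullet> g = e\<close>. Thus an idempotent strictly below \<open>e\<close> in
  the natural order is never \<open>J\<close>-equivalent to \<open>e\<close>.\<close>

lemma J_idem_below:
  assumes N: "idem_exponent S N" and c: "e \<in> carrier S" "g \<in> carrier S" "a \<in> carrier S" "b \<in> carrier S"
    and eg: "e \<bullet> g = g" "g \<bullet> e = g" "g \<bullet> g = g" and e: "e = a \<bullet> g \<bullet> b"
  shows "g = e"
proof -
  define k where "k = a \<bullet> g"
  have k: "k \<in> carrier S" using c by (simp add: k_def mult_closed)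
  have N0: "N > 0" using N by (auto simp: idem_exponent_def)
  have "e = k \<bullet> e \<bullet> b" using e eg c by (simp add: k_def mult_assoc)
  then have 1: "spow S k N \<bullet> e = e" using spow_fix(1)[OF N k c(4) c(1)] by simp
  have "k \<bullet> g = k" using c eg by (simp add: k_def mult_assoc)
  then have 2: "spow S k N \<bullet> g = spow S k N" using spow_absorb_right k c N0 by simp
  have cl: "spow S k N \<in> carrier S" using k N0 by (simp add: spow_closed)
  show ?thesis using 1 2 eg c cl mult_assoc by metis
qed

end

text \<open>The first identity, ((xy)^\<omega>(yx)^\<omega>(xy)^\<omega>)^\<omega> = (xy)^\<omega>,
  is the classical basis of \<open>DS\<close>. In its presence regular elements lie in subgroups, so
  regularity of a product of two idempotents takes the equational form
  (x^\<omega>y^\<omega>)^(\<omega>+1) = x^\<omega>y^\<omega>; this is how \<open>RS\<close>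
  enters.\<close>

definition ds_rs_identities :: "('a, 'm) sgp_scheme \<Rightarrow> nat \<Rightarrow> bool" where
  "ds_rs_identities S N \<longleftrightarrow> (\<forall>x\<in>carrier S. \<forall>y\<in>carrier S.
     spow S (spow S (x \<cdot>\<^bsub>S\<^esub> y) N \<cdot>\<^bsub>S\<^esub> spow S (y \<cdot>\<^bsub>S\<^esub> x) N \<cdot>\<^bsub>S\<^esub> spow S (x \<cdot>\<^bsub>S\<^esub> y) N) N
       = spow S (x \<cdot>\<^bsub>S\<^esub> y) N \<and>
     spow S (spow S x N \<cdot>\<^bsub>S\<^esub> spow S y N) (Suc N) = spow S x N \<cdot>\<^bsub>S\<^esub> spow S y N)"

lemma (in sgp) subsemigroup_spow:
  assumes "subsemigroup H S" "x \<in> H" "n > 0"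
  shows "spow S x n \<in> H"
  using assms(3)
proof (induction n)
  case (Suc n)
  then show ?case using assms by (cases "n = 0") (auto simp: spow_Suc subsemigroup_def)
qed simp

text \<open>For \<open>DS\<close>: the conjugate idempotents e = (xy)^N and f = (yx)^N are
  \<open>J\<close>-equivalent, so efe stays in their class, and its idempotent power lies below e
  and must be e. For \<open>RS\<close>: a product s of two idempotents is regular, so e = s^N is in
  the class of s; stability puts s into eS, hence es = s.\<close>

lemma DS_RS_identities:
  assumes S: "S \<in> DS" "S \<in> RS" and N: "idem_exponent S N"
  shows "ds_rs_identities S N"
proof -
  interpret sgp S using S by unfold_locales (auto simp: DS_def fin_sgps_def)
  have N0: "N > 0" using N by (auto simp: idem_exponent_def)
  \<comment> \<open>\<open>N - 1\<close> may be 0 and there is no zeroth power;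
    \<open>M = 2 * N - 1\<close> is positive and \<open>Suc M\<close> is still a multiple of
    \<open>N\<close>. The same device returns later.\<close>
  obtain M where M: "N * 2 = Suc M" "M > 0" "N * 3 = Suc (N + M)"
    using N0 by (intro that[of "2 * N - 1"]) auto
  have e2: "spow S x (Suc M) = spow S x N" and e3: "spow S x (Suc (N + M)) = spow S x N"
    if "x \<in> carrier S" for x
    using exponent_multiple(1)[OF N _ that, of 2] exponent_multiple(1)[OF N _ that, of 3]
    unfolding M by simp_all
  have idem: "spow S x N \<cdot>\<^bsub>S\<^esub> spow S x N = spow S x N" if "x \<in> carrier S" for x
    using that N by (auto simp: idem_exponent_def)
  have J: "subsemigroup (J_class S s) S" if "s \<in> regular_elements S" for s
    using S that by (auto simp: DS_def)
  have reg_idem: "e \<in> regular_elements S" if "e \<in> carrier S" "e \<cdot>\<^bsub>S\<^esub> e = e" for e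
    using that by (auto simp: regular_elements_def intro!: bexI[of _ e])
  show ?thesis unfolding ds_rs_identities_def
  proof (intro ballI conjI)
    fix x y assume xy: "x \<in> carrier S" "y \<in> carrier S"
    define e f where "e = spow S (x \<cdot>\<^bsub>S\<^esub> y) N" and "f = spow S (y \<cdot>\<^bsub>S\<^esub> x) N"
    have ef: "e \<in> carrier S" "f \<in> carrier S" "e \<cdot>\<^bsub>S\<^esub> e = e" "f \<cdot>\<^bsub>S\<^esub> f = f"
      using xy N0 by (auto simp: e_def f_def spow_closed mult_closed idem)
    have conj: "spow S (u \<cdot>\<^bsub>S\<^esub> v) N \<in> principal_ideal S (spow S (v \<cdot>\<^bsub>S\<^esub> u) N)"
      if uv: "u \<in> carrier S" "v \<in> carrier S" for u v
    proof -
      define g where "g = spow S (v \<cdot>\<^bsub>S\<^esub> u) M"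
      have g: "g \<in> carrier S" using uv N0 M(2) by (simp add: g_def spow_closed mult_closed)
      have "spow S (u \<cdot>\<^bsub>S\<^esub> v) N = spow S (u \<cdot>\<^bsub>S\<^esub> v) (Suc (N + M))"
        using e3[OF mult_closed[OF uv]] by simp
      also have "\<dots> = u \<cdot>\<^bsub>S\<^esub> (spow S (v \<cdot>\<^bsub>S\<^esub> u) N \<cdot>\<^bsub>S\<^esub> g) \<cdot>\<^bsub>S\<^esub> v"
        using uv N0 M(2) by (subst spow_conj) (auto simp: spow_add mult_closed g_def)
      also have "\<dots> = u \<cdot>\<^bsub>S\<^esub> spow S (v \<cdot>\<^bsub>S\<^esub> u) N \<cdot>\<^bsub>S\<^esub> (g \<cdot>\<^bsub>S\<^esub> v)"
        using uv g N0 by (simp add: mult_assoc mult_closed spow_closed)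
      finally show ?thesis using uv g mult_closed unfolding principal_ideal_def by blast
    qed
    have fJ: "f \<in> J_class S e" using ef conj xy by (auto simp: J_class_iff e_def f_def)
    have eJ: "e \<in> J_class S e" using ef by (auto simp: J_class_def)
    note Je = J[OF reg_idem[OF ef(1) ef(3)]]
    have h: "e \<cdot>\<^bsub>S\<^esub> f \<cdot>\<^bsub>S\<^esub> e \<in> J_class S e" using Je eJ fJ by (auto simp: subsemigroup_def)
    define g where "g = spow S (e \<cdot>\<^bsub>S\<^esub> f \<cdot>\<^bsub>S\<^esub> e) N"
    have gJ: "g \<in> J_class S e" unfolding g_def by (rule subsemigroup_spow[OF Je h N0])
    then have gc: "g \<in> carrier S" and ge: "e \<in> principal_ideal S g"
      using J_class_iff ef by auto
    have hc: "e \<cdot>\<^bsub>S\<^esub> f \<cdot>\<^bsub>S\<^esub> e \<in> carrier S" using ef by (simp add: mult_closed)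
    have gg: "g \<cdot>\<^bsub>S\<^esub> g = g" unfolding g_def by (rule idem[OF hc])
    have g1: "g \<cdot>\<^bsub>S\<^esub> e = g" unfolding g_def
      using hc ef N0 by (intro spow_absorb_right) (auto simp: mult_assoc mult_closed)
    have g2: "e \<cdot>\<^bsub>S\<^esub> g = g" unfolding g_def
      using hc ef N0 by (intro spow_absorb_left) (auto simp: mult_closed simp flip: mult_assoc)
    obtain a b where "a \<in> carrier S" "b \<in> carrier S" "e = a \<cdot>\<^bsub>S\<^esub> g \<cdot>\<^bsub>S\<^esub> b"
      using principal_ideal_regular[OF reg_idem[OF ef(1) ef(3)] gc ge] by auto
    then show "spow S (spow S (x \<cdot>\<^bsub>S\<^esub> y) N \<cdot>\<^bsub>S\<^esub> spow S (y \<cdot>\<^bsub>S\<^esub> x) N \<cdot>\<^bsub>S\<^esub> spow S (x \<cdot>\<^bsub>S\<^esub> y) N) N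
       = spow S (x \<cdot>\<^bsub>S\<^esub> y) N"
      using J_idem_below[OF N ef(1) gc _ _ g2 g1 gg] by (auto simp: g_def e_def f_def)
  next
    fix x y assume xy: "x \<in> carrier S" "y \<in> carrier S"
    define s where "s = spow S x N \<cdot>\<^bsub>S\<^esub> spow S y N"
    have "spow S x N \<in> regular_elements S" "spow S y N \<in> regular_elements S"
      using xy N0 by (auto intro!: reg_idem simp: spow_closed idem)
    then have sr: "s \<in> regular_elements S" using S by (auto simp: RS_def subsemigroup_def s_def)
    then have s: "s \<in> carrier S" by (auto simp: regular_elements_def)
    define e where "e = spow S s N"
    have e: "e \<in> carrier S" "e \<cdot>\<^bsub>S\<^esub> e = e" using s N0 by (auto simp: e_def spow_closed idem)
    have "e \<in> J_class S s" unfolding e_def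
      by (rule subsemigroup_spow[OF J[OF sr] _ N0]) (use s in \<open>simp add: J_class_def\<close>)
    then obtain a b where ab: "a \<in> carrier S" "b \<in> carrier S" "s = a \<cdot>\<^bsub>S\<^esub> e \<cdot>\<^bsub>S\<^esub> b"
      using principal_ideal_regular[OF sr] s J_class_iff by metis
    define h where "h = spow S s M"
    have h: "h \<in> carrier S" using s N0 M(2) by (simp add: h_def spow_closed)
    have eh: "e = s \<cdot>\<^bsub>S\<^esub> h"
      using e2[OF s] spow_Suc[OF s M(2)] by (simp add: e_def h_def)
    have hb: "h \<cdot>\<^bsub>S\<^esub> b \<in> carrier S" using h ab mult_closed by simp
    \<comment> \<open>By stability the relation s = a s (hb) makes (hb)^N fix s on the right.
      Writing this power as hb times k puts s = s h b k into the right ideal of e = sh.\<close>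
    have "s = a \<cdot>\<^bsub>S\<^esub> (s \<cdot>\<^bsub>S\<^esub> h) \<cdot>\<^bsub>S\<^esub> b" using ab(3) unfolding eh .
    also have "\<dots> = a \<cdot>\<^bsub>S\<^esub> s \<cdot>\<^bsub>S\<^esub> (h \<cdot>\<^bsub>S\<^esub> b)"
      using ab(1,2) s h by (simp add: mult_assoc mult_closed)
    finally have "s = a \<cdot>\<^bsub>S\<^esub> s \<cdot>\<^bsub>S\<^esub> (h \<cdot>\<^bsub>S\<^esub> b)" .
    then have 1: "s \<cdot>\<^bsub>S\<^esub> spow S (h \<cdot>\<^bsub>S\<^esub> b) N = s" using spow_fix(2)[OF N ab(1) hb s] by simp
    define k where "k = spow S (h \<cdot>\<^bsub>S\<^esub> b) M"
    have k: "k \<in> carrier S" using hb N0 M(2) by (simp add: k_def spow_closed)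
    have "s = s \<cdot>\<^bsub>S\<^esub> (h \<cdot>\<^bsub>S\<^esub> b \<cdot>\<^bsub>S\<^esub> k)"
      using 1 e2[OF hb] spow_Suc[OF hb M(2)] by (simp add: k_def)
    also have "\<dots> = e \<cdot>\<^bsub>S\<^esub> (b \<cdot>\<^bsub>S\<^esub> k)"
      unfolding eh using ab(1,2) s h k by (simp add: mult_assoc mult_closed)
    finally have "s = e \<cdot>\<^bsub>S\<^esub> (b \<cdot>\<^bsub>S\<^esub> k)" .
    moreover have "e \<cdot>\<^bsub>S\<^esub> (e \<cdot>\<^bsub>S\<^esub> (b \<cdot>\<^bsub>S\<^esub> k)) = e \<cdot>\<^bsub>S\<^esub> (b \<cdot>\<^bsub>S\<^esub> k)"
      using e ab(2) k by (simp add: mult_closed flip: mult_assoc)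
    ultimately have "e \<cdot>\<^bsub>S\<^esub> s = s" by metis
    then have "spow S s (Suc N) = s" using s N0 by (simp add: spow_Suc2 e_def)
    then show "spow S (spow S x N \<cdot>\<^bsub>S\<^esub> spow S y N) (Suc N) = spow S x N \<cdot>\<^bsub>S\<^esub> spow S y N"
      by (simp add: s_def)
  qed
qed

section \<open>Division and products\<close>

definition rel_morphism :: "('a, 'm) sgp_scheme \<Rightarrow> ('b, 'n) sgp_scheme \<Rightarrow> ('a \<times> 'b) set \<Rightarrow> bool" where
  "rel_morphism S T \<tau> \<longleftrightarrow> \<tau> \<subseteq> carrier S \<times> carrier T \<and> carrier S \<subseteq> fst ` \<tau> \<and>
     (\<forall>s t s' t'. (s, t) \<in> \<tau> \<longrightarrow> (s', t') \<in> \<tau> \<longrightarrow> (s \<cdot>\<^bsub>S\<^esub> s', t \<cdot>\<^bsub>T\<^esub> t') \<in> \<tau>)"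

lemma rel_morphism_total: "rel_morphism S T \<tau> \<Longrightarrow> s \<in> carrier S \<Longrightarrow> \<exists>t. (s, t) \<in> \<tau>"
  unfolding rel_morphism_def by force

text \<open>The second coordinates form a subsemigroup of \<open>T\<close>, on which the inverse of
  \<open>\<tau>\<close> is a surjective homomorphism onto \<open>S\<close>.\<close>

lemma pseudovariety_division:
  assumes V: "sgp_pseudovariety V" and T: "T \<in> V" and S: "S \<in> fin_sgps"
    and \<tau>: "rel_morphism S T \<tau>" and inj: "\<And>s s' t. \<lbrakk>(s, t) \<in> \<tau>; (s', t) \<in> \<tau>\<rbrakk> \<Longrightarrow> s = s'"
  shows "S \<in> V"
proof -
  define H where "H = snd ` \<tau>"
  define h where "h t = (THE s. (s, t) \<in> \<tau>)" for t
  have h: "h t = s" if "(s, t) \<in> \<tau>" for s t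
    unfolding h_def using that inj by blast
  have ne: "carrier S \<noteq> {}" using S by (auto simp: fin_sgps_def is_semigroup_def)
  have sub: "subsemigroup H T"
    unfolding subsemigroup_def
  proof (intro conjI ballI)
    show "H \<noteq> {}" using \<tau> ne by (auto simp: rel_morphism_def H_def)
    show "H \<subseteq> carrier T" using \<tau> by (auto simp: rel_morphism_def H_def)
    fix x y assume "x \<in> H" "y \<in> H"
    then obtain s s' where "(s, x) \<in> \<tau>" "(s', y) \<in> \<tau>" by (force simp: H_def)
    then have "(s \<cdot>\<^bsub>S\<^esub> s', x \<cdot>\<^bsub>T\<^esub> y) \<in> \<tau>" using \<tau> by (simp add: rel_morphism_def)
    then show "x \<cdot>\<^bsub>T\<^esub> y \<in> H" by (force simp: H_def)
  qed
  have "h \<in> sgp_epi (T\<lparr>carrier := H\<rparr>) S"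
  proof -
    have "h ` H = carrier S"
    proof
      show "h ` H \<subseteq> carrier S" using \<tau> h by (auto simp: rel_morphism_def H_def)
      show "carrier S \<subseteq> h ` H"
      proof
        fix s assume "s \<in> carrier S"
        then obtain t where "(s, t) \<in> \<tau>" using rel_morphism_total[OF \<tau>] by blast
        then show "s \<in> h ` H" using h by (force simp: H_def)
      qed
    qed
    moreover have "h (x \<cdot>\<^bsub>T\<^esub> y) = h x \<cdot>\<^bsub>S\<^esub> h y" if xy: "x \<in> H" "y \<in> H" for x y
    proof -
      obtain s s' where s: "(s, x) \<in> \<tau>" "(s', y) \<in> \<tau>" using xy by (force simp: H_def)
      then have "(s \<cdot>\<^bsub>S\<^esub> s', x \<cdot>\<^bsub>T\<^esub> y) \<in> \<tau>" using \<tau> by (simp add: rel_morphism_def)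
      then show ?thesis using s h by simp
    qed
    ultimately show ?thesis by (auto simp: sgp_epi_def sgp_hom_def)
  qed
  moreover have "T\<lparr>carrier := H\<rparr> \<in> V" using V T sub by (simp add: sgp_pseudovariety_def)
  ultimately show ?thesis using V S unfolding sgp_pseudovariety_def by blast
qed

text \<open>Classes contain only semigroups on \<open>nat\<close>, while the elements of a product
  are functions.\<close>

lemma nat_copy:
  fixes X :: "'a sgp"
  assumes X: "is_semigroup X" and fin: "finite (carrier X)"
  shows "\<exists>P\<in>fin_sgps. sgp_iso X P \<noteq> {}"
proof -
  obtain g where g: "bij_betw g (carrier X) {0..<card (carrier X)}"
    using ex_bij_betw_finite_nat[OF fin] by blast
  define k where "k = inv_into (carrier X) g"
  define P :: "nat sgp" where
    "P = \<lparr>carrier = g ` carrier X, sop = \<lambda>a b. g (k a \<cdot>\<^bsub>X\<^esub> k b)\<rparr>"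
  have k: "k (g x) = x" if "x \<in> carrier X" for x
    using g that by (simp add: k_def bij_betw_def)
  have "P \<in> fin_sgps"
    using X fin k by (auto simp: fin_sgps_def P_def is_semigroup_def)
  moreover have "g \<in> sgp_iso X P"
    using X k g by (auto simp: sgp_iso_def sgp_hom_def P_def is_semigroup_def bij_betw_def)
  ultimately show ?thesis by blast
qed

text \<open>A direct product up to isomorphism, given by coordinate maps that are jointly injective
  and jointly surjective. Later arguments then need not touch carriers of functions.\<close>

definition projections :: "'i set \<Rightarrow> ('i \<Rightarrow> nat sgp) \<Rightarrow> nat sgp \<Rightarrow> ('i \<Rightarrow> nat \<Rightarrow> nat) \<Rightarrow> bool" where
  "projections I S P \<pi> \<longleftrightarrow> (\<forall>i\<in>I. \<pi> i \<in> sgp_hom P (S i)) \<and>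
     (\<forall>x\<in>carrier P. \<forall>y\<in>carrier P. (\<forall>i\<in>I. \<pi> i x = \<pi> i y) \<longrightarrow> x = y) \<and>
     (\<forall>f. (\<forall>i\<in>I. f i \<in> carrier (S i)) \<longrightarrow> (\<exists>x\<in>carrier P. \<forall>i\<in>I. \<pi> i x = f i))"

lemma iso_product_projections:
  assumes S: "\<And>i. i \<in> I \<Longrightarrow> is_semigroup (S i)" and "sgp_iso (product_sgp I S) P \<noteq> {}"
  shows "\<exists>\<pi>. projections I S P \<pi>"
proof -
  let ?X = "product_sgp I S"
  obtain h where h: "h \<in> sgp_hom ?X P" and b: "bij_betw h (carrier ?X) (carrier P)"
    using assms(2) by (auto simp: sgp_iso_def)
  define k where "k = inv_into (carrier ?X) h"
  have k: "k p \<in> carrier ?X" "h (k p) = p" if "p \<in> carrier P" for p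
    using b that by (auto simp: k_def bij_betw_def inv_into_into f_inv_into_f)
  have kh: "k (h x) = x" if "x \<in> carrier ?X" for x
    using b that by (simp add: k_def bij_betw_def)
  have cl: "x \<cdot>\<^bsub>?X\<^esub> y \<in> carrier ?X" if "x \<in> carrier ?X" "y \<in> carrier ?X" for x y
    using that S by (fastforce simp: product_sgp_def is_semigroup_def PiE_iff)
  have km: "k (p \<cdot>\<^bsub>P\<^esub> q) = k p \<cdot>\<^bsub>?X\<^esub> k q" if "p \<in> carrier P" "q \<in> carrier P" for p q
  proof -
    have "h (k p \<cdot>\<^bsub>?X\<^esub> k q) = p \<cdot>\<^bsub>P\<^esub> q" using sgp_hom_mult[OF h] k that by simp
    then show ?thesis using kh[OF cl] k(1) that by metis
  qed
  have "projections I S P (\<lambda>i p. k p i)"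
    unfolding projections_def
  proof (intro conjI ballI allI impI)
    fix i assume "i \<in> I"
    then show "(\<lambda>p. k p i) \<in> sgp_hom P (S i)"
      using k km by (auto simp: sgp_hom_def product_sgp_def)
  next
    fix x y assume xy: "x \<in> carrier P" "y \<in> carrier P" "\<forall>i\<in>I. k x i = k y i"
    then have "k x = k y"
      using k by (intro PiE_ext[of _ I "\<lambda>i. carrier (S i)"]) (auto simp: product_sgp_def)
    then show "x = y" using k xy by metis
  next
    fix f assume f: "\<forall>i\<in>I. f i \<in> carrier (S i)"
    then have m: "restrict f I \<in> carrier ?X" by (simp add: product_sgp_def)
    then have "h (restrict f I) \<in> carrier P" using h by (auto simp: sgp_hom_def)
    then show "\<exists>x\<in>carrier P. \<forall>i\<in>I. k x i = f i" using kh[OF m] by (intro bexI[of _ "h (restrict f I)"]) auto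
  qed
  then show ?thesis by blast
qed

lemma pseudovariety_product:
  fixes I :: "nat set"
  assumes V: "sgp_pseudovariety V" and I: "finite I" and S: "\<And>i. i \<in> I \<Longrightarrow> S i \<in> V"
  shows "\<exists>P\<in>V. \<exists>\<pi>. projections I S P \<pi>"
proof -
  let ?X = "product_sgp I S"
  have Sf: "is_semigroup (S i)" "finite (carrier (S i))" if "i \<in> I" for i
    using V S[OF that] by (auto simp: sgp_pseudovariety_def fin_sgps_def)
  have "carrier ?X \<noteq> {}"
    using Sf by (auto simp: product_sgp_def is_semigroup_def PiE_eq_empty_iff)
  then have "is_semigroup ?X"
    using Sf(1) by (auto simp: is_semigroup_def product_sgp_def PiE_iff fun_eq_iff)
  moreover have "finite (carrier ?X)" using Sf I by (simp add: product_sgp_def finite_PiE)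
  ultimately obtain P where P: "P \<in> fin_sgps" "sgp_iso ?X P \<noteq> {}" using nat_copy by blast
  have "P \<in> V"
    using V P I S unfolding sgp_pseudovariety_def by blast
  moreover have "\<exists>\<pi>. projections I S P \<pi>"
    using iso_product_projections[of I S P] Sf P by blast
  ultimately show ?thesis by blast
qed

lemma pseudovariety_fin: "sgp_pseudovariety V \<Longrightarrow> S \<in> V \<Longrightarrow> is_semigroup S \<and> finite (carrier S)"
  by (auto simp: sgp_pseudovariety_def fin_sgps_def)

section \<open>An upper bound for the bideterministic closure\<close>

text \<open>An element of a subgroup is its own (\<omega>+1)-power, so on such elements this is
  plain injectivity; elsewhere it is weaker.\<close>

definition power_injective :: "('a, 'm) sgp_scheme \<Rightarrow> nat \<Rightarrow> ('a \<times> 'b) set \<Rightarrow> bool" where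
  "power_injective S N \<tau> \<longleftrightarrow>
     (\<forall>s s' t. (s, t) \<in> \<tau> \<longrightarrow> (s', t) \<in> \<tau> \<longrightarrow> spow S s (Suc N) = spow S s' (Suc N))"

text \<open>The exponent is a parameter because finitely many semigroups, such as the factors of a
  product or the local semigroups of a semigroupoid, must be covered with a common one.\<close>

definition covered_at :: "nat sgp set \<Rightarrow> ('a, 'm) sgp_scheme \<Rightarrow> nat \<Rightarrow> bool" where
  "covered_at V S N \<longleftrightarrow> idem_exponent S N \<and> ds_rs_identities S N \<and>
     (\<exists>T\<in>V. \<exists>\<tau>. rel_morphism S T \<tau> \<and> power_injective S N \<tau>)"

definition bidet_bound :: "nat sgp set \<Rightarrow> nat sgp set" where
  "bidet_bound V = {S \<in> fin_sgps. \<exists>N. covered_at V S N}"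

section \<open>Closure properties of the class of covered semigroups\<close>

lemma ds_rs_identities_multiple:
  assumes S: "is_semigroup (S :: nat sgp)" and N: "idem_exponent S N" and k: "k > 0"
    and D: "ds_rs_identities S N"
  shows "ds_rs_identities S (N * k)"
proof -
  interpret sgp S by unfold_locales fact
  have N0: "N > 0" using N by (simp add: idem_exponent_def)
  note e = exponent_multiple[OF N k]
  have c: "spow S x N \<in> carrier S" if "x \<in> carrier S" for x using that N0 by (simp add: spow_closed)
  show ?thesis
    using D unfolding ds_rs_identities_def by (simp add: e mult_closed c)
qed

lemma covered_at_multiple:
  assumes S: "is_semigroup (S :: nat sgp)" and N: "covered_at V S N" and k: "k > 0"
  shows "covered_at V S (N * k)"
proof -
  interpret sgp S by unfold_locales fact
  have N': "idem_exponent S N" using N by (simp add: covered_at_def)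
  obtain T \<tau> where T: "T \<in> V" "rel_morphism S T \<tau>" "power_injective S N \<tau>"
    using N by (auto simp: covered_at_def)
  have "power_injective S (N * k) \<tau>"
    unfolding power_injective_def
  proof (intro allI impI)
    fix s s' t assume st: "(s, t) \<in> \<tau>" "(s', t) \<in> \<tau>"
    then have "s \<in> carrier S" "s' \<in> carrier S" using T by (auto simp: rel_morphism_def)
    moreover have "spow S s (Suc N) = spow S s' (Suc N)"
      using T(3) st unfolding power_injective_def by blast
    ultimately show "spow S s (Suc (N * k)) = spow S s' (Suc (N * k))"
      using exponent_multiple(2)[OF N' k] by simp
  qed
  then show ?thesis
    using N k T idem_exponent_mult ds_rs_identities_multiple[OF S]
    unfolding covered_at_def by blast
qed

text \<open>Each semigroup comes with its own exponent; the product of these is a multiple of each,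
  and covers survive passing to multiples.\<close>

lemma covered_at_common:
  assumes I: "finite I" and S: "\<And>i. i \<in> I \<Longrightarrow> is_semigroup (S i :: nat sgp)"
    and ex: "\<And>i. i \<in> I \<Longrightarrow> \<exists>N. covered_at V (S i) N"
  shows "\<exists>N>0. \<forall>i\<in>I. covered_at V (S i) N"
proof -
  obtain n where n: "\<And>i. i \<in> I \<Longrightarrow> covered_at V (S i) (n i)" using ex by metis
  then have pos: "\<And>i. i \<in> I \<Longrightarrow> n i > 0" by (auto simp: covered_at_def idem_exponent_def)
  have "covered_at V (S i) (prod n I)" if i: "i \<in> I" for i
  proof -
    have "prod n (I - {i}) > 0" by (rule prod_pos) (use pos in blast)
    then show ?thesis
      using covered_at_multiple[OF S[OF i] n[OF i]] prod.remove[OF I i, of n] by simp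
  qed
  moreover have "prod n I > 0" by (rule prod_pos) (use pos in blast)
  ultimately show ?thesis by blast
qed

lemma covered_at_subsemigroup:
  assumes N: "covered_at V S N" and H: "subsemigroup H S"
  shows "covered_at V (S\<lparr>carrier := H\<rparr>) N"
proof -
  have HS: "H \<subseteq> carrier S" using H by (simp add: subsemigroup_def)
  have p: "spow (S\<lparr>carrier := H\<rparr>) = spow S" by (simp add: spow_def fun_eq_iff)
  obtain T \<tau> where T: "T \<in> V" "rel_morphism S T \<tau>" "power_injective S N \<tau>"
    using N by (auto simp: covered_at_def)
  define \<sigma> where "\<sigma> = {(s, t) \<in> \<tau>. s \<in> H}"
  have "rel_morphism (S\<lparr>carrier := H\<rparr>) T \<sigma>"
  proof -
    have "H \<subseteq> fst ` \<sigma>" using T(2) HS rel_morphism_total[OF T(2)] by (force simp: \<sigma>_def)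
    then show ?thesis using T(2) H by (auto simp: rel_morphism_def \<sigma>_def subsemigroup_def)
  qed
  moreover have "power_injective (S\<lparr>carrier := H\<rparr>) N \<sigma>"
    using T(3) by (auto simp: power_injective_def \<sigma>_def p)
  moreover have "idem_exponent (S\<lparr>carrier := H\<rparr>) N" "ds_rs_identities (S\<lparr>carrier := H\<rparr>) N"
    using N HS by (auto simp: covered_at_def idem_exponent_def ds_rs_identities_def p subset_iff)
  ultimately show ?thesis using T(1) unfolding covered_at_def by blast
qed

text \<open>The cover is carried forward along \<open>h\<close>: an element of \<open>T\<close> is
  related to everything its preimages are related to. Power injectivity survives because
  (\<omega>+1)-powers commute with \<open>h\<close>.\<close>

lemma covered_at_quotient:
  assumes S: "is_semigroup (S :: nat sgp)" and N: "covered_at V S N" and h: "h \<in> sgp_epi S T"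
  shows "covered_at V (T :: nat sgp) N"
proof -
  interpret sgp S by unfold_locales fact
  have hh: "h \<in> sgp_hom S T" and hs: "h ` carrier S = carrier T" using h by (auto simp: sgp_epi_def)
  have N0: "N > 0" using N by (auto simp: covered_at_def idem_exponent_def)
  have p: "spow T (h x) n = h (spow S x n)" if "x \<in> carrier S" "n > 0" for x n
    using sgp_hom_spow[OF hh that S] by simp
  have m: "h x \<cdot>\<^bsub>T\<^esub> h y = h (x \<cdot>\<^bsub>S\<^esub> y)" if "x \<in> carrier S" "y \<in> carrier S" for x y
    using sgp_hom_mult[OF hh that] by simp
  obtain U \<tau> where U: "U \<in> V" "rel_morphism S U \<tau>" "power_injective S N \<tau>"
    using N by (auto simp: covered_at_def)
  define \<sigma> where "\<sigma> = {(h s, t) | s t. (s, t) \<in> \<tau>}"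
  have \<tau>c: "s \<in> carrier S" "t \<in> carrier U" if "(s, t) \<in> \<tau>" for s t
    using that U(2) by (auto simp: rel_morphism_def)
  have "rel_morphism T U \<sigma>"
    unfolding rel_morphism_def
  proof (intro conjI allI impI)
    show "\<sigma> \<subseteq> carrier T \<times> carrier U" using \<tau>c hs by (auto simp: \<sigma>_def)
    show "carrier T \<subseteq> fst ` \<sigma>" 
    proof
      fix y assume "y \<in> carrier T"
      then obtain x where x: "y = h x" "x \<in> carrier S" using hs by auto
      then obtain t where "(x, t) \<in> \<tau>" using rel_morphism_total[OF U(2)] by blast
      then have "(y, t) \<in> \<sigma>" using x by (auto simp: \<sigma>_def)
      then show "y \<in> fst ` \<sigma>" by force
    qed
    fix s t s' t' assume "(s, t) \<in> \<sigma>" "(s', t') \<in> \<sigma>"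
    then obtain r r' where r: "(r, t) \<in> \<tau>" "(r', t') \<in> \<tau>" "s = h r" "s' = h r'" by (auto simp: \<sigma>_def)
    then have "(r \<cdot>\<^bsub>S\<^esub> r', t \<cdot>\<^bsub>U\<^esub> t') \<in> \<tau>" using U(2) by (simp add: rel_morphism_def)
    then show "(s \<cdot>\<^bsub>T\<^esub> s', t \<cdot>\<^bsub>U\<^esub> t') \<in> \<sigma>" using r m \<tau>c by (auto simp: \<sigma>_def)
  qed
  moreover have "power_injective T N \<sigma>"
    unfolding power_injective_def
  proof (intro allI impI)
    fix s s' t assume "(s, t) \<in> \<sigma>" "(s', t) \<in> \<sigma>"
    then obtain r r' where r: "(r, t) \<in> \<tau>" "(r', t) \<in> \<tau>" "s = h r" "s' = h r'" by (auto simp: \<sigma>_def)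
    then have "spow S r (Suc N) = spow S r' (Suc N)"
      using U(3) unfolding power_injective_def by blast
    then show "spow T s (Suc N) = spow T s' (Suc N)"
      using r \<tau>c(1) by (simp add: p)
  qed
  moreover have "idem_exponent T N"
    unfolding idem_exponent_def hs[symmetric]
  proof (intro conjI N0 ballI, elim imageE)
    fix y x assume x: "y = h x" "x \<in> carrier S"
    have "spow S x N \<cdot>\<^bsub>S\<^esub> spow S x N = spow S x N"
      using N x by (simp add: covered_at_def idem_exponent_def)
    then show "spow T y N \<cdot>\<^bsub>T\<^esub> spow T y N = spow T y N"
      unfolding x(1) using x(2) N0 by (simp add: p m spow_closed)
  qed
  moreover have "ds_rs_identities T N"
    unfolding ds_rs_identities_def hs[symmetric]
  proof (intro ballI, elim imageE)
    fix x' y' x y assume xy: "x' = h x" "y' = h y" "x \<in> carrier S" "y \<in> carrier S"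
    have "ds_rs_identities S N" using N by (simp add: covered_at_def)
    from this[unfolded ds_rs_identities_def, rule_format, OF xy(3,4)]
    show "spow T (spow T (x' \<cdot>\<^bsub>T\<^esub> y') N \<cdot>\<^bsub>T\<^esub> spow T (y' \<cdot>\<^bsub>T\<^esub> x') N \<cdot>\<^bsub>T\<^esub> spow T (x' \<cdot>\<^bsub>T\<^esub> y') N) N
       = spow T (x' \<cdot>\<^bsub>T\<^esub> y') N \<and>
      spow T (spow T x' N \<cdot>\<^bsub>T\<^esub> spow T y' N) (Suc N) = spow T x' N \<cdot>\<^bsub>T\<^esub> spow T y' N"
      unfolding xy(1,2) using xy(3,4) N0 by (simp add: p m spow_closed mult_closed)
  qed
  ultimately show ?thesis using U(1) unfolding covered_at_def by blast
qed

lemma covered_at_product: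
  fixes I :: "nat set"
  assumes V: "sgp_pseudovariety V" and I: "finite I" and P: "is_semigroup P"
    and S: "\<And>i. i \<in> I \<Longrightarrow> is_semigroup (S i)"
    and N: "N > 0" "\<And>i. i \<in> I \<Longrightarrow> covered_at V (S i) N" and \<pi>: "projections I S P \<pi>"
  shows "covered_at V P N"
proof -
  interpret sgp P by unfold_locales fact
  have \<pi>h: "\<pi> i \<in> sgp_hom P (S i)" if "i \<in> I" for i using \<pi> that by (simp add: projections_def)
  have eqI: "x = y" if "x \<in> carrier P" "y \<in> carrier P" "\<And>i. i \<in> I \<Longrightarrow> \<pi> i x = \<pi> i y" for x y
    using \<pi> that by (simp add: projections_def)
  have c: "\<pi> i x \<in> carrier (S i)" if "i \<in> I" "x \<in> carrier P" for i x
    using sgp_hom_closed[OF \<pi>h] that by simp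
  have p: "\<pi> i (spow P x n) = spow (S i) (\<pi> i x) n" if "i \<in> I" "x \<in> carrier P" "n > 0" for i x n
    using sgp_hom_spow[OF \<pi>h[OF that(1)] that(2,3) P] .
  have m: "\<pi> i (x \<cdot>\<^bsub>P\<^esub> y) = \<pi> i x \<cdot>\<^bsub>S i\<^esub> \<pi> i y" if "i \<in> I" "x \<in> carrier P" "y \<in> carrier P" for i x y
    using sgp_hom_mult[OF \<pi>h[OF that(1)] that(2,3)] .
  obtain T \<tau> where T: "\<And>i. i \<in> I \<Longrightarrow> T i \<in> V \<and> rel_morphism (S i) (T i) (\<tau> i) \<and> power_injective (S i) N (\<tau> i)"
    using N(2) unfolding covered_at_def by metis
  obtain Q \<rho> where Q: "Q \<in> V" "projections I T Q \<rho>"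
    using pseudovariety_product[OF V I, of T] T by blast
  define \<sigma> where "\<sigma> = {(x, q). x \<in> carrier P \<and> q \<in> carrier Q \<and> (\<forall>i\<in>I. (\<pi> i x, \<rho> i q) \<in> \<tau> i)}"
  have Qs: "is_semigroup Q" using pseudovariety_fin[OF V Q(1)] by simp
  have "rel_morphism P Q \<sigma>"
    unfolding rel_morphism_def
  proof (intro conjI allI impI)
    show "\<sigma> \<subseteq> carrier P \<times> carrier Q" by (auto simp: \<sigma>_def)
    show "carrier P \<subseteq> fst ` \<sigma>"
    proof
      fix x assume x: "x \<in> carrier P"
      have ex: "\<exists>t. (\<pi> i x, t) \<in> \<tau> i" if "i \<in> I" for i
        using T[OF that] rel_morphism_total[OF _ c[OF that x]] by blast
      obtain f where f: "\<And>i. i \<in> I \<Longrightarrow> (\<pi> i x, f i) \<in> \<tau> i" using ex by metis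
      then have "f i \<in> carrier (T i)" if "i \<in> I" for i using that T by (fastforce simp: rel_morphism_def)
      then obtain q where "q \<in> carrier Q" "\<And>i. i \<in> I \<Longrightarrow> \<rho> i q = f i"
        using Q(2) unfolding projections_def by metis
      then have "(x, q) \<in> \<sigma>" using x f by (simp add: \<sigma>_def)
      then show "x \<in> fst ` \<sigma>" by force
    qed
    fix s t s' t' assume a: "(s, t) \<in> \<sigma>" "(s', t') \<in> \<sigma>"
    have "t \<cdot>\<^bsub>Q\<^esub> t' \<in> carrier Q" using a Qs by (auto simp: \<sigma>_def is_semigroup_def)
    moreover have "\<rho> i (t \<cdot>\<^bsub>Q\<^esub> t') = \<rho> i t \<cdot>\<^bsub>T i\<^esub> \<rho> i t'" if "i \<in> I" for i
      using a that Q(2) by (auto simp: \<sigma>_def projections_def sgp_hom_def)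
    ultimately show "(s \<cdot>\<^bsub>P\<^esub> s', t \<cdot>\<^bsub>Q\<^esub> t') \<in> \<sigma>"
      using a T by (auto simp: \<sigma>_def mult_closed m rel_morphism_def)
  qed
  moreover have "power_injective P N \<sigma>"
    unfolding power_injective_def
  proof (intro allI impI)
    fix s s' t assume a: "(s, t) \<in> \<sigma>" "(s', t) \<in> \<sigma>"
    show "spow P s (Suc N) = spow P s' (Suc N)"
    proof (rule eqI)
      fix i assume i: "i \<in> I"
      have "(\<pi> i s, \<rho> i t) \<in> \<tau> i" "(\<pi> i s', \<rho> i t) \<in> \<tau> i" "s \<in> carrier P" "s' \<in> carrier P"
        using a i by (auto simp: \<sigma>_def)
      moreover from this have "spow (S i) (\<pi> i s) (Suc N) = spow (S i) (\<pi> i s') (Suc N)"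
        using T[OF i] unfolding power_injective_def by blast
      ultimately show "\<pi> i (spow P s (Suc N)) = \<pi> i (spow P s' (Suc N))"
        using i by (simp add: p)
    qed (use a in \<open>auto simp: \<sigma>_def spow_closed\<close>)
  qed
  moreover have "idem_exponent P N"
    unfolding idem_exponent_def
  proof (intro conjI ballI N(1))
    fix x assume x: "x \<in> carrier P"
    show "spow P x N \<cdot>\<^bsub>P\<^esub> spow P x N = spow P x N"
    proof (rule eqI)
      fix i assume i: "i \<in> I"
      have "idem_exponent (S i) N" using N(2)[OF i] by (simp add: covered_at_def)
      then show "\<pi> i (spow P x N \<cdot>\<^bsub>P\<^esub> spow P x N) = \<pi> i (spow P x N)"
        using c[OF i x] i x N(1) by (simp add: p m spow_closed idem_exponent_def)
    qed (use x N(1) in \<open>auto simp: spow_closed mult_closed\<close>)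
  qed
  moreover have "ds_rs_identities P N"
    unfolding ds_rs_identities_def
  proof (intro conjI ballI)
    fix x y assume xy: "x \<in> carrier P" "y \<in> carrier P"
    have D: "ds_rs_identities (S i) N" if "i \<in> I" for i using N(2)[OF that] by (simp add: covered_at_def)
    note D = this[unfolded ds_rs_identities_def, rule_format, OF _ c c, OF _ _ xy(1) _ xy(2)]
    show "spow P (spow P (x \<cdot>\<^bsub>P\<^esub> y) N \<cdot>\<^bsub>P\<^esub> spow P (y \<cdot>\<^bsub>P\<^esub> x) N \<cdot>\<^bsub>P\<^esub> spow P (x \<cdot>\<^bsub>P\<^esub> y) N) N
       = spow P (x \<cdot>\<^bsub>P\<^esub> y) N"
    proof (rule eqI)
      fix i assume i: "i \<in> I"
      show "\<pi> i (spow P (spow P (x \<cdot>\<^bsub>P\<^esub> y) N \<cdot>\<^bsub>P\<^esub> spow P (y \<cdot>\<^bsub>P\<^esub> x) N \<cdot>\<^bsub>P\<^esub> spow P (x \<cdot>\<^bsub>P\<^esub> y) N) N)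
         = \<pi> i (spow P (x \<cdot>\<^bsub>P\<^esub> y) N)"
        using D[OF i i i] i xy N(1) by (simp add: p m spow_closed mult_closed)
    qed (use xy N(1) in \<open>auto simp: spow_closed mult_closed\<close>)
    show "spow P (spow P x N \<cdot>\<^bsub>P\<^esub> spow P y N) (Suc N) = spow P x N \<cdot>\<^bsub>P\<^esub> spow P y N"
    proof (rule eqI)
      fix i assume i: "i \<in> I"
      show "\<pi> i (spow P (spow P x N \<cdot>\<^bsub>P\<^esub> spow P y N) (Suc N)) = \<pi> i (spow P x N \<cdot>\<^bsub>P\<^esub> spow P y N)"
        using D[OF i i i] i xy N(1) by (simp add: p m spow_closed mult_closed)
    qed (use xy N(1) in \<open>auto simp: spow_closed mult_closed\<close>)
  qed
  ultimately show ?thesis using Q(1) unfolding covered_at_def by blast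
qed

lemma bidet_bound_pseudovariety:
  assumes V: "sgp_pseudovariety V"
  shows "sgp_pseudovariety (bidet_bound V)"
  unfolding sgp_pseudovariety_def
proof (intro conjI ballI allI impI)
  show "bidet_bound V \<subseteq> fin_sgps" by (auto simp: bidet_bound_def)
next
  fix S H assume S: "S \<in> bidet_bound V" and H: "subsemigroup H S"
  then have "S\<lparr>carrier := H\<rparr> \<in> fin_sgps"
    unfolding bidet_bound_def fin_sgps_def is_semigroup_def subsemigroup_def subset_iff
    by (auto intro: finite_subset)
  then show "S\<lparr>carrier := H\<rparr> \<in> bidet_bound V"
    using covered_at_subsemigroup[OF _ H] S by (auto simp: bidet_bound_def)
next
  fix S T assume "S \<in> bidet_bound V" "T \<in> fin_sgps" "sgp_epi S T \<noteq> {}"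
  then show "T \<in> bidet_bound V"
    using covered_at_quotient[of S V _ _ T] unfolding bidet_bound_def fin_sgps_def by blast
next
  fix I :: "nat set" and S P
  assume P: "P \<in> fin_sgps" and I: "finite I" and S: "\<forall>i\<in>I. S i \<in> bidet_bound V"
    and iso: "sgp_iso (product_sgp I S) P \<noteq> {}"
  have Ss: "is_semigroup (S i)" "\<exists>N. covered_at V (S i) N" if "i \<in> I" for i
    using S that by (auto simp: bidet_bound_def fin_sgps_def)
  obtain N where N: "N > 0" "\<And>i. i \<in> I \<Longrightarrow> covered_at V (S i) N"
    using covered_at_common[OF I, of S V] Ss by blast
  obtain \<pi> where \<pi>: "projections I S P \<pi>" using iso_product_projections[OF Ss(1) iso] by blast
  have "covered_at V P N"
    by (rule covered_at_product[OF V I _ _ N(1) _ \<pi>]) (use P Ss N in \<open>auto simp: fin_sgps_def\<close>)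
  then show "P \<in> bidet_bound V" using P by (auto simp: bidet_bound_def)
qed

text \<open>A member of \<open>V\<close> is covered by itself through the identity relation;
  \<open>DS\<close> and \<open>RS\<close> are needed for the identities.\<close>

lemma subset_bidet_bound:
  assumes V: "sgp_pseudovariety V" and sub: "V \<subseteq> DS \<inter> RS"
  shows "V \<subseteq> bidet_bound V"
proof
  fix S assume S: "S \<in> V"
  have fs: "is_semigroup S" "finite (carrier S)" using pseudovariety_fin[OF V S] by auto
  interpret sgp S by unfold_locales fact
  obtain N where N: "idem_exponent S N" using exists_idem_exponent[OF fs(2)] by blast
  have "ds_rs_identities S N" using DS_RS_identities[OF _ _ N] S sub by blast
  moreover have "rel_morphism S S (Id_on (carrier S))"
    unfolding rel_morphism_def by (force simp: mult_closed)
  moreover have "power_injective S N (Id_on (carrier S))"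
    by (auto simp: power_injective_def)
  ultimately have "covered_at V S N" using N S unfolding covered_at_def by blast
  then show "S \<in> bidet_bound V" using fs by (auto simp: bidet_bound_def fin_sgps_def)
qed

section \<open>Recognizable languages\<close>

lemma recognizable_iff:
  "recognizable V A L \<longleftrightarrow> L \<subseteq> lists A - {[]} \<and>
     (\<exists>S\<in>V. \<exists>\<phi>\<in>sgp_hom (free_sgp A) S.
        \<forall>u\<in>lists A - {[]}. \<forall>v\<in>lists A - {[]}. \<phi> u = \<phi> v \<longrightarrow> u \<in> L \<longrightarrow> v \<in> L)"
  (is "?l \<longleftrightarrow> ?r")
proof
  assume ?l
  then obtain S \<phi> where 1: "L \<subseteq> lists A - {[]}" "S \<in> V" "\<phi> \<in> sgp_hom (free_sgp A) S"
    "L = {w \<in> lists A - {[]}. \<phi> w \<in> \<phi> ` L}"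
    unfolding recognizable_def by blast
  have "v \<in> L" if "u \<in> L" "v \<in> lists A - {[]}" "\<phi> u = \<phi> v" for u v
  proof -
    have "\<phi> v \<in> \<phi> ` L" unfolding that(3)[symmetric] using that(1) by (rule imageI)
    then have "v \<in> {w \<in> lists A - {[]}. \<phi> w \<in> \<phi> ` L}" using that(2) by blast
    then show ?thesis unfolding 1(4)[symmetric] .
  qed
  then have "\<forall>u\<in>lists A - {[]}. \<forall>v\<in>lists A - {[]}. \<phi> u = \<phi> v \<longrightarrow> u \<in> L \<longrightarrow> v \<in> L" by simp
  then show ?r using 1(1) by (intro conjI bexI[OF _ 1(2)] bexI[OF _ 1(3)])
next
  assume ?r
  then obtain S \<phi> where 1: "L \<subseteq> lists A - {[]}" "S \<in> V" "\<phi> \<in> sgp_hom (free_sgp A) S"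
    "\<forall>u\<in>lists A - {[]}. \<forall>v\<in>lists A - {[]}. \<phi> u = \<phi> v \<longrightarrow> u \<in> L \<longrightarrow> v \<in> L"
    by blast
  have "L = {w \<in> lists A - {[]}. \<phi> w \<in> \<phi> ` L}"
  proof
    show "L \<subseteq> {w \<in> lists A - {[]}. \<phi> w \<in> \<phi> ` L}" using 1(1) by blast
    show "{w \<in> lists A - {[]}. \<phi> w \<in> \<phi> ` L} \<subseteq> L"
    proof
      fix w assume "w \<in> {w \<in> lists A - {[]}. \<phi> w \<in> \<phi> ` L}"
      then obtain u where "w \<in> lists A - {[]}" "u \<in> L" "\<phi> u = \<phi> w" by auto
      then show "w \<in> L" using 1(1,4) by blast
    qed
  qed
  then show ?l using 1 unfolding recognizable_def by blast
qed

lemma sgp_hom_comp: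
  "h \<in> sgp_hom S T \<Longrightarrow> k \<in> sgp_hom T U \<Longrightarrow> (\<lambda>x. k (h x)) \<in> sgp_hom S U"
  unfolding sgp_hom_def by (auto simp: Pi_iff)

lemma hom_eq_on_words:
  assumes "\<phi> \<in> sgp_hom (free_sgp A) S" "\<psi> \<in> sgp_hom (free_sgp A) S"
    "\<And>a. a \<in> A \<Longrightarrow> \<phi> [a] = \<psi> [a]" "w \<in> lists A" "w \<noteq> []"
  shows "\<phi> w = \<psi> w"
  using assms(4,5)
proof (induction w)
  case (Cons a w)
  show ?case
  proof (cases "w = []")
    case False
    then show ?thesis
      using Cons assms(3) free_hom_append[OF assms(1), of "[a]" w] free_hom_append[OF assms(2), of "[a]" w]
      by simp
  qed (use Cons assms(3) in simp)
qed simp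

lemma common_hom:
  fixes I :: "nat set"
  assumes V: "sgp_pseudovariety V" and I: "finite I" and S: "\<And>i. i \<in> I \<Longrightarrow> S i \<in> V"
    and \<phi>: "\<And>i. i \<in> I \<Longrightarrow> \<phi> i \<in> sgp_hom (free_sgp A) (S i)"
  shows "\<exists>P\<in>V. \<exists>\<psi>\<in>sgp_hom (free_sgp A) P. \<forall>i\<in>I. \<forall>u\<in>lists A - {[]}. \<forall>v\<in>lists A - {[]}.
    \<psi> u = \<psi> v \<longrightarrow> \<phi> i u = \<phi> i v"
proof -
  obtain P \<pi> where P: "P \<in> V" "projections I S P \<pi>" using pseudovariety_product[OF V I, of S] S by blast
  have Ps: "is_semigroup P" using pseudovariety_fin[OF V P(1)] by simp
  have "\<exists>p\<in>carrier P. \<forall>i\<in>I. \<pi> i p = \<phi> i [a]" if a: "a \<in> A" for a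
  proof -
    have "\<forall>i\<in>I. \<phi> i [a] \<in> carrier (S i)" using free_hom_closed[OF \<phi>, of _ "[a]"] a by simp
    then show ?thesis using P(2) unfolding projections_def by (elim conjE) (erule allE, erule mp)
  qed
  then obtain t where t: "\<And>a. a \<in> A \<Longrightarrow> t a \<in> carrier P \<and> (\<forall>i\<in>I. \<pi> i (t a) = \<phi> i [a])" by metis
  define \<psi> where "\<psi> w = wprod (sop P) (map t w)" for w
  have \<psi>: "\<psi> \<in> sgp_hom (free_sgp A) P"
    unfolding \<psi>_def by (rule free_hom_extend[OF Ps]) (use t in blast)
  have "\<pi> i (\<psi> w) = \<phi> i w" if i: "i \<in> I" and w: "w \<in> lists A - {[]}" for i w
  proof -
    have "(\<lambda>w. \<pi> i (\<psi> w)) \<in> sgp_hom (free_sgp A) (S i)"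
      using sgp_hom_comp[OF \<psi>] P(2) i unfolding projections_def by blast
    then show ?thesis
      by (rule hom_eq_on_words[OF _ \<phi>[OF i]]) (use t i w in \<open>auto simp: \<psi>_def\<close>)
  qed
  then have "\<forall>i\<in>I. \<forall>u\<in>lists A - {[]}. \<forall>v\<in>lists A - {[]}. \<psi> u = \<psi> v \<longrightarrow> \<phi> i u = \<phi> i v"
    by metis
  then show ?thesis using P(1) \<psi> by blast
qed

text \<open>By freeness it is enough to choose a related image for each letter, since
  \<open>\<tau>\<close> is closed under products.\<close>

lemma rel_morphism_word_hom:
  assumes \<tau>: "rel_morphism S T \<tau>" and T: "is_semigroup (T :: nat sgp)"
    and \<phi>: "\<phi> \<in> sgp_hom (free_sgp A) S"
  shows "\<exists>\<psi>\<in>sgp_hom (free_sgp A) T. \<forall>w\<in>lists A - {[]}. (\<phi> w, \<psi> w) \<in> \<tau>"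
proof -
  have "\<exists>t. (\<phi> [a], t) \<in> \<tau>" if "a \<in> A" for a
    using rel_morphism_total[OF \<tau>] free_hom_closed[OF \<phi>, of "[a]"] that by simp
  then obtain t where t: "\<And>a. a \<in> A \<Longrightarrow> (\<phi> [a], t a) \<in> \<tau>" by metis
  define \<psi> where "\<psi> w = wprod (sop T) (map t w)" for w
  have \<psi>: "\<psi> \<in> sgp_hom (free_sgp A) T"
    unfolding \<psi>_def by (rule free_hom_extend[OF T]) (use t \<tau> in \<open>auto simp: rel_morphism_def\<close>)
  have "(\<phi> w, \<psi> w) \<in> \<tau>" if "w \<in> lists A" "w \<noteq> []" for w
    using that
  proof (induction w)
    case (Cons a w)
    show ?case
    proof (cases "w = []")
      case True
      then show ?thesis using Cons t by (simp add: \<psi>_def)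
    next
      case False
      have aw: "[a] \<in> lists A" "w \<in> lists A" "[a] \<noteq> []" using Cons.hyps by auto
      have "\<phi> ([a] @ w) = \<phi> [a] \<cdot>\<^bsub>S\<^esub> \<phi> w" "\<psi> ([a] @ w) = \<psi> [a] \<cdot>\<^bsub>T\<^esub> \<psi> w"
        using free_hom_append[OF \<phi> aw False] free_hom_append[OF \<psi> aw False] .
      moreover have "(\<phi> [a], \<psi> [a]) \<in> \<tau>" using Cons t by (simp add: \<psi>_def)
      ultimately show ?thesis using Cons False \<tau> by (simp add: rel_morphism_def)
    qed
  qed simp
  then show ?thesis using \<psi> by blast
qed

text \<open>Stated with contexts \<open>x\<close> and \<open>y\<close> rather than for whole words.
  Then \<open>{[]}\<close>, the exceptional factor allowed in a product, satisfies it vacuously and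
  needs no separate treatment.\<close>

definition saturates :: "'a set \<Rightarrow> ('a list \<Rightarrow> 'b) \<Rightarrow> 'a list set \<Rightarrow> bool" where
  "saturates A \<phi> L \<longleftrightarrow> (\<forall>x\<in>lists A. \<forall>y\<in>lists A. \<forall>u\<in>lists A - {[]}. \<forall>v\<in>lists A - {[]}.
     \<phi> u = \<phi> v \<longrightarrow> x @ u @ y \<in> L \<longrightarrow> x @ v @ y \<in> L)"

lemma saturates_common:
  fixes V :: "nat sgp set"
  assumes V: "sgp_pseudovariety V"
    and L: "\<And>L. L \<in> \<L> \<Longrightarrow> recognizable V A L \<or> L = {[]}" and fin: "finite \<L>"
  shows "\<exists>S\<in>V. \<exists>\<phi>\<in>sgp_hom (free_sgp A) S. \<forall>L\<in>\<L>. saturates A \<phi> L"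
proof -
  define \<L>' where "\<L>' = {L \<in> \<L>. recognizable V A L}"
  obtain e :: "_ \<Rightarrow> nat" where e: "inj_on e \<L>'" 
    using finite_imp_inj_to_nat_seg[of \<L>'] fin by (auto simp: \<L>'_def)
  have "\<exists>S \<phi>. S \<in> V \<and> \<phi> \<in> sgp_hom (free_sgp A) S \<and>
     (\<forall>u\<in>lists A - {[]}. \<forall>v\<in>lists A - {[]}. \<phi> u = \<phi> v \<longrightarrow> u \<in> L \<longrightarrow> v \<in> L)" if "L \<in> \<L>'" for L
    using that unfolding \<L>'_def recognizable_iff by blast
  then obtain S \<phi> where S: "\<And>L. L \<in> \<L>' \<Longrightarrow> S L \<in> V \<and> \<phi> L \<in> sgp_hom (free_sgp A) (S L) \<and>
     (\<forall>u\<in>lists A - {[]}. \<forall>v\<in>lists A - {[]}. \<phi> L u = \<phi> L v \<longrightarrow> u \<in> L \<longrightarrow> v \<in> L)"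
    by metis
  define k where "k = inv_into \<L>' e"
  have k: "k i \<in> \<L>'" if "i \<in> e ` \<L>'" for i using that by (simp add: k_def inv_into_into)
  have ke: "k (e L) = L" if "L \<in> \<L>'" for L using that e by (simp add: k_def)
  have fI: "finite (e ` \<L>')" using fin by (simp add: \<L>'_def)
  have 1: "S (k i) \<in> V" "\<phi> (k i) \<in> sgp_hom (free_sgp A) (S (k i))" if "i \<in> e ` \<L>'" for i
    using S k[OF that] by blast+
  obtain P \<psi> where P: "P \<in> V" "\<psi> \<in> sgp_hom (free_sgp A) P"
    "\<forall>i\<in>e ` \<L>'. \<forall>u\<in>lists A - {[]}. \<forall>v\<in>lists A - {[]}. \<psi> u = \<psi> v \<longrightarrow> \<phi> (k i) u = \<phi> (k i) v"
    using common_hom[OF V fI, of "\<lambda>i. S (k i)" "\<lambda>i. \<phi> (k i)" A] 1 by auto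
  have "saturates A \<psi> L" if L: "L \<in> \<L>" for L
  proof (cases "L \<in> \<L>'")
    case True
    have "x @ v @ y \<in> L" if "x \<in> lists A" "y \<in> lists A" "u \<in> lists A - {[]}" "v \<in> lists A - {[]}"
      "\<psi> u = \<psi> v" "x @ u @ y \<in> L" for x y u v
    proof -
      have "\<psi> (x @ u @ y) = \<psi> (x @ v @ y)" by (rule free_hom_cong[OF P(2) that(5)]) (use that(1-4) in auto)
      moreover have m: "x @ u @ y \<in> lists A - {[]}" "x @ v @ y \<in> lists A - {[]}" using that by auto
      ultimately have "\<phi> L (x @ u @ y) = \<phi> L (x @ v @ y)"
        using P(3)[rule_format, OF imageI[OF True] m] unfolding ke[OF True] by simp
      then show ?thesis
        using conjunct2[OF conjunct2[OF S[OF True]], rule_format, OF m] that(6) by blast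
    qed
    then show ?thesis unfolding saturates_def by blast
  next
    case False
    then have "L = {[]}" using L assms(2)[OF L] by (simp add: \<L>'_def)
    then show ?thesis by (auto simp: saturates_def)
  qed
  then show ?thesis using P by blast
qed

lemma recognizable_saturates:
  assumes "S \<in> V" "\<phi> \<in> sgp_hom (free_sgp A) S" "L \<subseteq> lists A - {[]}" "saturates A \<phi> L"
  shows "recognizable V A L"
proof -
  have "v \<in> L" if "u \<in> lists A - {[]}" "v \<in> lists A - {[]}" "\<phi> u = \<phi> v" "u \<in> L" for u v
    using assms(4)[unfolded saturates_def, rule_format, OF lists.Nil lists.Nil that(1-3)] that(4) by simp
  then show ?thesis unfolding recognizable_iff using assms by blast
qed

section \<open>Syntactic semigroups\<close>

definition syntactic_eq :: "'a set \<Rightarrow> 'a list set \<Rightarrow> 'a list \<Rightarrow> 'a list \<Rightarrow> bool" where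
  "syntactic_eq A M u v \<longleftrightarrow> (\<forall>x\<in>lists A. \<forall>y\<in>lists A. x @ u @ y \<in> M \<longleftrightarrow> x @ v @ y \<in> M)"

lemma syntactic_eq_append:
  assumes "syntactic_eq A M u u'" "syntactic_eq A M v v'" "u' \<in> lists A" "v \<in> lists A"
  shows "syntactic_eq A M (u @ v) (u' @ v')"
proof -
  have "x @ (u @ v) @ y \<in> M \<longleftrightarrow> x @ (u' @ v') @ y \<in> M" if "x \<in> lists A" "y \<in> lists A" for x y
  proof -
    have "x @ u @ (v @ y) \<in> M \<longleftrightarrow> x @ u' @ (v @ y) \<in> M"
      using assms(1,4) that by (simp add: syntactic_eq_def)
    also have "\<dots> \<longleftrightarrow> (x @ u') @ v @ y \<in> M" by simp
    also have "\<dots> \<longleftrightarrow> (x @ u') @ v' @ y \<in> M"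
      using assms(2,3) that unfolding syntactic_eq_def by (metis append_in_lists_conv)
    finally show ?thesis by simp
  qed
  then show ?thesis by (simp add: syntactic_eq_def)
qed

text \<open>Any map \<open>f\<close> with finitely many values that refines the syntactic congruence
  bounds the number of classes. The classes are numbered and multiplied through chosen
  representatives.\<close>

lemma syntactic_semigroup:
  assumes A: "A \<noteq> {}" and fin: "finite (f ` (lists A - {[]}))"
    and f: "\<And>u v. \<lbrakk>u \<in> lists A - {[]}; v \<in> lists A - {[]}; f u = f v\<rbrakk> \<Longrightarrow> syntactic_eq A M u v"
  shows "\<exists>T\<in>fin_sgps. \<exists>\<eta>\<in>sgp_epi (free_sgp A) T.
    \<forall>u\<in>lists A - {[]}. \<forall>v\<in>lists A - {[]}. \<eta> u = \<eta> v \<longleftrightarrow> syntactic_eq A M u v"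
proof -
  let ?W = "lists A - {[]}"
  define cl where "cl u = {v \<in> ?W. syntactic_eq A M u v}" for u
  have cl: "cl u = cl v \<longleftrightarrow> syntactic_eq A M u v" if "u \<in> ?W" "v \<in> ?W" for u v
  proof
    assume "cl u = cl v"
    moreover have "v \<in> cl v" using that by (simp add: cl_def syntactic_eq_def)
    ultimately show "syntactic_eq A M u v" unfolding cl_def by blast
  next
    assume "syntactic_eq A M u v"
    then show "cl u = cl v" by (auto simp: cl_def syntactic_eq_def)
  qed
  have "cl u = cl (inv_into ?W f (f u))" if "u \<in> ?W" for u
  proof -
    have m: "f u \<in> f ` ?W" using that by blast
    show ?thesis
      unfolding cl[OF that inv_into_into[OF m]]
      by (rule f[OF that inv_into_into[OF m]]) (simp add: f_inv_into_f[OF m])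
  qed
  then have "cl ` ?W \<subseteq> (\<lambda>y. cl (inv_into ?W f y)) ` f ` ?W" by blast
  then have "finite (cl ` ?W)" by (rule finite_subset) (intro finite_imageI fin)
  then obtain g :: "_ \<Rightarrow> nat" where g: "inj_on g (cl ` ?W)"
    using finite_imp_inj_to_nat_seg[of "cl ` ?W"] by auto
  define \<eta> where "\<eta> u = g (cl u)" for u
  have \<eta>: "\<eta> u = \<eta> v \<longleftrightarrow> syntactic_eq A M u v" if "u \<in> ?W" "v \<in> ?W" for u v
    using cl[OF that] g that by (auto simp: \<eta>_def inj_on_def)
  define r where "r = inv_into ?W \<eta>"
  have r: "r (\<eta> u) \<in> ?W" "\<eta> (r (\<eta> u)) = \<eta> u" if "u \<in> ?W" for u
    using that by (auto simp: r_def inv_into_into f_inv_into_f simp del: Diff_iff)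
  define T :: "nat sgp" where "T = \<lparr>carrier = \<eta> ` ?W, sop = \<lambda>i j. \<eta> (r i @ r j)\<rparr>"
  have app: "\<eta> (r (\<eta> u) @ r (\<eta> v)) = \<eta> (u @ v)" if uv: "u \<in> ?W" "v \<in> ?W" for u v
  proof -
    have "syntactic_eq A M (r (\<eta> u)) u" "syntactic_eq A M (r (\<eta> v)) v"
      using r[OF uv(1)] r[OF uv(2)] \<eta> uv by blast+
    then have "syntactic_eq A M (r (\<eta> u) @ r (\<eta> v)) (u @ v)"
      using syntactic_eq_append uv r by blast
    then show ?thesis using \<eta> r[OF uv(1)] r[OF uv(2)] uv by auto
  qed
  have "\<eta> \<in> sgp_epi (free_sgp A) T"
    using app by (auto simp: sgp_epi_def sgp_hom_def free_sgp_def T_def)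
  moreover have "T \<in> fin_sgps"
  proof -
    obtain a where "a \<in> A" using A by blast
    then have "[a] \<in> ?W" by simp
    then have "?W \<noteq> {}" by blast
    moreover have "finite (\<eta> ` ?W)" using \<open>finite (cl ` ?W)\<close> by (simp add: \<eta>_def flip: image_image)
    moreover have "\<eta> (r (\<eta> u) @ r (\<eta> v)) \<in> \<eta> ` ?W" if "u \<in> ?W" "v \<in> ?W" for u v
      unfolding app[OF that] using that by (intro imageI) auto
    moreover have "\<eta> (r (\<eta> (r (\<eta> u) @ r (\<eta> v))) @ r (\<eta> w)) = \<eta> (r (\<eta> u) @ r (\<eta> (r (\<eta> v) @ r (\<eta> w))))"
      if "u \<in> ?W" "v \<in> ?W" "w \<in> ?W" for u v w
    proof -
      have "u @ v \<in> ?W" "v @ w \<in> ?W" using that by auto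
      then show ?thesis using app that by simp
    qed
    ultimately show ?thesis by (simp add: fin_sgps_def is_semigroup_def T_def del: Diff_iff)
  qed
  ultimately show ?thesis using \<eta> by blast
qed

text \<open>The syntactic semigroup divides every recognizing semigroup: the pairs of values of one
  word form a relational morphism, injective because words with equal \<open>\<phi>\<close>-value
  are syntactically equivalent.\<close>

lemma syntactic_semigroup_mem:
  assumes V: "sgp_pseudovariety V" and M: "recognizable V A M" and T: "T \<in> fin_sgps"
    and \<eta>: "\<eta> \<in> sgp_epi (free_sgp A) T"
    and eq: "\<And>u v. \<lbrakk>u \<in> lists A - {[]}; v \<in> lists A - {[]}; syntactic_eq A M u v\<rbrakk> \<Longrightarrow> \<eta> u = \<eta> v"
  shows "T \<in> V"
proof -
  obtain S \<phi> where S: "S \<in> V" "\<phi> \<in> sgp_hom (free_sgp A) S" and sat: "saturates A \<phi> M"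
    using saturates_common[OF V, of "{M}" A] M by auto
  have \<eta>h: "\<eta> \<in> sgp_hom (free_sgp A) T" and \<eta>s: "\<eta> ` (lists A - {[]}) = carrier T"
    using \<eta> by (auto simp: sgp_epi_def free_sgp_def)
  define \<tau> where "\<tau> = (\<lambda>u. (\<eta> u, \<phi> u)) ` (lists A - {[]})"
  have "rel_morphism T S \<tau>"
    unfolding rel_morphism_def
  proof (intro conjI allI impI)
    show "\<tau> \<subseteq> carrier T \<times> carrier S"
      using free_hom_closed[OF \<eta>h] free_hom_closed[OF S(2)] by (auto simp: \<tau>_def)
    show "carrier T \<subseteq> fst ` \<tau>" unfolding \<eta>s[symmetric] by (force simp: \<tau>_def)
    fix s t s' t' assume "(s, t) \<in> \<tau>" "(s', t') \<in> \<tau>"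
    then obtain u v where uv: "u \<in> lists A - {[]}" "v \<in> lists A - {[]}"
      "s = \<eta> u" "t = \<phi> u" "s' = \<eta> v" "t' = \<phi> v" by (auto simp: \<tau>_def)
    then have "(s \<cdot>\<^bsub>T\<^esub> s', t \<cdot>\<^bsub>S\<^esub> t') = (\<lambda>u. (\<eta> u, \<phi> u)) (u @ v)"
      by (simp add: free_hom_append[OF \<eta>h] free_hom_append[OF S(2)])
    moreover have "u @ v \<in> lists A - {[]}" using uv by auto
    ultimately show "(s \<cdot>\<^bsub>T\<^esub> s', t \<cdot>\<^bsub>S\<^esub> t') \<in> \<tau>" unfolding \<tau>_def by (rule image_eqI)
  qed
  then show ?thesis
  proof (rule pseudovariety_division[OF V S(1) T])
    fix s s' t assume "(s, t) \<in> \<tau>" "(s', t) \<in> \<tau>"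
    then obtain u v where uv: "u \<in> lists A - {[]}" "v \<in> lists A - {[]}"
      "s = \<eta> u" "s' = \<eta> v" "\<phi> u = \<phi> v" by (auto simp: \<tau>_def)
    have "syntactic_eq A M u v"
      using sat uv unfolding saturates_def syntactic_eq_def by metis
    then show "s = s'" using eq uv by simp
  qed
qed

section \<open>Bideterministic products\<close>

abbreviation wpow :: "'a list \<Rightarrow> nat \<Rightarrow> 'a list" where
  "wpow b n \<equiv> concat (replicate n b)"

lemma wpow_add: "wpow b (m + n) = wpow b m @ wpow b n"
  by (simp add: replicate_add)

lemma wpow_lists: "b \<in> lists A \<Longrightarrow> wpow b n \<in> lists A"
  by (induction n) auto

lemma length_wpow: "length (wpow b n) = n * length b"
  by (induction n) auto

lemma wpow_Nil: "wpow b n = [] \<longleftrightarrow> n = 0 \<or> b = []"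
  by (auto simp: length_wpow simp flip: length_0_conv)

locale bidet_product =
  fixes A :: "'a set" and a :: 'a and L K :: "'a list set" and S :: "nat sgp" and \<phi> :: "'a list \<Rightarrow> nat"
  assumes a: "a \<in> A" and LA: "L \<subseteq> lists A" and KA: "K \<subseteq> lists A"
    and S: "is_semigroup S" and \<phi>: "\<phi> \<in> sgp_hom (free_sgp A) S"
    and satL: "saturates A \<phi> L" and satK: "saturates A \<phi> K"
    and pre: "prefix_code A {u @ [a] | u. u \<in> L}"
    and suf: "suffix_code A {[a] @ v | v. v \<in> K}"
begin

definition M where "M = {u @ [a] @ v | u v. u \<in> L \<and> v \<in> K}"

lemma M_words: "M \<subseteq> lists A - {[]}"
proof
  fix w assume "w \<in> M"
  then obtain l k where "l \<in> L" "k \<in> K" "w = l @ [a] @ k" by (auto simp: M_def)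
  moreover from this have "l \<in> lists A" "k \<in> lists A" using LA KA by blast+
  ultimately show "w \<in> lists A - {[]}" using a by simp
qed

lemma M_I: "l \<in> L \<Longrightarrow> k \<in> K \<Longrightarrow> w = l @ [a] @ k \<Longrightarrow> w \<in> M"
  unfolding M_def by blast

text \<open>The marked letter of a factorization in \<open>LaK\<close> never falls inside the factor \<open>U\<close>.\<close>

definition avoiding :: "'a list \<Rightarrow> bool" where
  "avoiding U \<longleftrightarrow> (\<forall>p q l k. p \<in> lists A \<longrightarrow> q \<in> lists A \<longrightarrow> l \<in> L \<longrightarrow> k \<in> K \<longrightarrow>
     p @ U @ q = l @ [a] @ k \<longrightarrow> length l < length p \<or> length p + length U \<le> length l)"

lemma avoiding_append:
  assumes U: "avoiding U" "avoiding W" and l: "U \<in> lists A" "W \<in> lists A"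
  shows "avoiding (U @ W)"
  unfolding avoiding_def
proof (intro allI impI)
  fix p q l k assume h: "p \<in> lists A" "q \<in> lists A" "l \<in> L" "k \<in> K" "p @ (U @ W) @ q = l @ [a] @ k"
  have "length l < length p \<or> length p + length U \<le> length l"
    using U(1)[unfolded avoiding_def, rule_format, of p "W @ q" l k] h l by simp
  moreover have "length l < length (p @ U) \<or> length (p @ U) + length W \<le> length l"
    using U(2)[unfolded avoiding_def, rule_format, of "p @ U" q l k] h l by simp
  ultimately show "length l < length p \<or> length p + length (U @ W) \<le> length l" by auto
qed

text \<open>With the marked letter outside \<open>U\<close>, the whole factor \<open>U\<close> lies
  within the word of \<open>L\<close> or that of \<open>K\<close>, where saturation allows its
  replacement. Only \<open>U\<close>, not \<open>W\<close>, has to be avoiding.\<close>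

lemma M_pump:
  assumes "avoiding U" "U \<in> lists A - {[]}" "W \<in> lists A - {[]}" "\<phi> U = \<phi> W"
    and pq: "p \<in> lists A" "q \<in> lists A" "p @ U @ q \<in> M"
  shows "p @ W @ q \<in> M"
proof -
  obtain l k where lk: "l \<in> L" "k \<in> K" "p @ U @ q = l @ [a] @ k" using pq(3) by (auto simp: M_def)
  have lkA: "l \<in> lists A" "k \<in> lists A" using lk LA KA by auto
  have "length l < length p \<or> length p + length U \<le> length l"
    using assms(1) lk pq unfolding avoiding_def by blast
  then show ?thesis
  proof
    assume len: "length l < length p"
    then obtain p' where p': "p = l @ [a] @ p'" "p' @ U @ q = k"
      using lk(3) by (auto simp: append_eq_append_conv2 append_eq_Cons_conv)
    have "p' @ W @ q \<in> K"
      using satK[unfolded saturates_def, rule_format, of p' q U W] p' lk assms pq lkA by auto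
    then show ?thesis using p' by (intro M_I[OF lk(1)]) auto
  next
    assume len: "length p + length U \<le> length l"
    then obtain q' where q': "l = p @ U @ q'" "q = q' @ [a] @ k"
      using lk(3) by (auto simp: append_eq_append_conv2 append_eq_Cons_conv)
    have "p @ W @ q' \<in> L"
      using satL[unfolded saturates_def, rule_format, of p q' U W] q' lk assms pq lkA by auto
    then show ?thesis using lk(2) q' by (auto intro: M_I)
  qed
qed

lemma avoiding_syntactic_eq:
  assumes "avoiding U" "avoiding W" "U \<in> lists A - {[]}" "W \<in> lists A - {[]}" "\<phi> U = \<phi> W"
  shows "syntactic_eq A M U W"
  using M_pump[OF assms(1,3,4,5)] M_pump[OF assms(2,4,3) assms(5)[symmetric]]
  unfolding syntactic_eq_def by blast

lemma no_prefix:
  assumes "l \<in> L" "l @ [a] @ w \<in> L" "w \<in> lists A"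
  shows False
proof -
  have "l @ [a] \<in> {u @ [a] | u. u \<in> L}" "(l @ [a] @ w) @ [a] \<in> {u @ [a] | u. u \<in> L}"
    using assms(1,2) by blast+
  moreover have "(l @ [a] @ w) @ [a] = (l @ [a]) @ (w @ [a])" "w @ [a] \<in> lists A - {[]}"
    using assms(3) a by auto
  ultimately show False using pre unfolding prefix_code_def by blast
qed

lemma no_suffix:
  assumes "k \<in> K" "w @ [a] @ k \<in> K" "w \<in> lists A"
  shows False
proof -
  have "[a] @ k \<in> {[a] @ v | v. v \<in> K}" "[a] @ (w @ [a] @ k) \<in> {[a] @ v | v. v \<in> K}"
    using assms(1,2) by blast+
  moreover have "[a] @ (w @ [a] @ k) = ([a] @ w) @ ([a] @ k)" "[a] @ w \<in> lists A - {[]}"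
    using assms(3) a by auto
  ultimately show False using suf unfolding suffix_code_def by blast
qed

text \<open>If the marked letter fell into one copy of \<open>b\<close>, at least
  \<open>2 * N\<close> further copies would remain, so at least \<open>N\<close> on one side.
  Periodicity allows \<open>N\<close> more copies there, and the longer word of \<open>L\<close> (or
  \<open>K\<close>) extends the old one across the letter \<open>a\<close>, against
  \<open>no_prefix\<close> (or \<open>no_suffix\<close>).\<close>

lemma avoiding_wpow:
  assumes N: "idem_exponent S N" and b: "b \<in> lists A" "b \<noteq> []" and n: "n \<ge> 2 * N + 1"
  shows "avoiding (wpow b n)"
  unfolding avoiding_def
proof (intro allI impI, rule ccontr)
  fix p q l k assume h: "p \<in> lists A" "q \<in> lists A" "l \<in> L" "k \<in> K" "p @ wpow b n @ q = l @ [a] @ k"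
    and "\<not> (length l < length p \<or> length p + length (wpow b n) \<le> length l)"
  then have len: "length p \<le> length l" "length l < length p + n * length b"
    by (auto simp: length_wpow)
  interpret sgp S by unfold_locales (rule S)
  have N0: "N > 0" using N by (simp add: idem_exponent_def)
  \<comment> \<open>\<open>i\<close> copies of \<open>b\<close> precede the one that is hit,
    \<open>j\<close> follow it, and the marked letter has position \<open>r\<close> within
    it.\<close>
  define m where "m = length l - length p"
  define i where "i = m div length b"
  define j where "j = n - 1 - i"
  define r where "r = m mod length b"
  have lb: "length b > 0" using b by simp
  have "m < n * length b" using len by (simp add: m_def)
  then have "i < n" unfolding i_def by (simp add: less_mult_imp_div_less)
  then have nij: "n = i + Suc j" by (simp add: j_def)
  have r: "r < length b" using lb by (simp add: r_def)
  define b1 where "b1 = take r b"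
  define b2 where "b2 = drop (Suc r) b"
  have bb: "b = b1 @ [b ! r] @ b2" using r by (simp add: b1_def b2_def id_take_nth_drop)
  have lA: "b1 \<in> lists A" "b2 \<in> lists A" "k \<in> lists A" using b h KA
    by (auto simp: b1_def b2_def dest: in_set_takeD in_set_dropD)
  have ll: "length l = length (p @ wpow b i @ b1)"
  proof -
    have "length (wpow b i @ b1) = i * length b + r" using r by (simp add: length_wpow b1_def)
    also have "\<dots> = m" by (simp add: i_def r_def)
    finally show ?thesis using len by (simp add: m_def)
  qed
  have "p @ wpow b n @ q = p @ wpow b i @ b @ wpow b j @ q" unfolding nij wpow_add by simp
  also have "\<dots> = (p @ wpow b i @ b1) @ [b ! r] @ (b2 @ wpow b j @ q)" by (subst bb) simp
  finally have "(p @ wpow b i @ b1) @ [b ! r] @ (b2 @ wpow b j @ q) = l @ [a] @ k" using h by simp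
  from this[unfolded append_eq_append_conv[OF disjI1[OF ll[symmetric]]]]
  have eqs: "l = p @ wpow b i @ b1" "b ! r = a" "k = b2 @ wpow b j @ q" by auto
  then have bb': "b = b1 @ [a] @ b2" using bb by simp
  have per: "\<phi> (wpow b (c + N)) = \<phi> (wpow b c)" if "c \<ge> N" for c
    using free_hom_power[OF \<phi> b, of "c + N"] free_hom_power[OF \<phi> b, of c] that N0
      spow_period[OF N free_hom_closed[OF \<phi> b] that] by simp
  have N1: "wpow b N = b @ wpow b (N - 1)" "wpow b N = wpow b (N - 1) @ b"
    using N0 wpow_add[of 1 "N - 1" b] wpow_add[of "N - 1" 1 b] by simp_all
  have wl: "wpow b c \<in> lists A - {[]}" if "c > 0" for c
    using wpow_lists[OF b(1)] b(2) that by (simp add: wpow_Nil)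
  have "i \<ge> N \<or> j \<ge> N" using nij n by linarith
  then show False
  proof
    assume i: "i \<ge> N"
    have "p @ wpow b i @ b1 \<in> L" using eqs h by simp
    then have "p @ wpow b (i + N) @ b1 \<in> L"
      using satL[unfolded saturates_def, rule_format, OF h(1) lA(1) wl wl per[OF i, symmetric]] N0 i by auto
    \<comment> \<open>The first inserted copy is split as \<open>b1 @ [a] @ b2\<close>; its part
      \<open>b1\<close> completes \<open>l\<close>.\<close>
    moreover have "p @ wpow b (i + N) @ b1 = l @ [a] @ (b2 @ wpow b (N - 1) @ b1)"
      unfolding wpow_add N1(1) eqs(1) by (subst (2) bb') simp
    ultimately have "l @ [a] @ (b2 @ wpow b (N - 1) @ b1) \<in> L" by (simp only:)
    then show False by (rule no_prefix[OF h(3)]) (use lA wpow_lists[OF b(1)] in simp)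
  next
    assume j: "j \<ge> N"
    have "b2 @ wpow b j @ q \<in> K" using eqs h by simp
    then have "b2 @ wpow b (j + N) @ q \<in> K"
      using satK[unfolded saturates_def, rule_format, OF lA(2) h(2) wl wl per[OF j, symmetric]] N0 j by auto
    moreover have "b2 @ wpow b (j + N) @ q = (b2 @ wpow b (N - 1) @ b1) @ [a] @ k"
      unfolding add.commute[of j] wpow_add N1(2) eqs(3) by (subst (2) bb') simp
    ultimately have "(b2 @ wpow b (N - 1) @ b1) @ [a] @ k \<in> K" by (simp only:)
    then show False by (rule no_suffix[OF h(4)]) (use lA wpow_lists[OF b(1)] in simp)
  qed
qed

definition opt_val :: "'a list \<Rightarrow> nat option" where
  "opt_val p = (if p = [] then None else Some (\<phi> p))"

text \<open>A finite invariant in the manner of the Schuetzenberger product: besides the value of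
  \<open>u\<close> it records the values of both sides of every occurrence of \<open>a\<close>, with
  \<open>None\<close> for an empty side. It serves to bound the number of syntactic classes of
  \<open>M\<close>.\<close>

definition factor_key :: "'a list \<Rightarrow> nat \<times> (nat option \<times> nat option) set" where
  "factor_key u = (\<phi> u, {(opt_val p, opt_val q) | p q. u = p @ [a] @ q})"

lemma saturates_opt:
  assumes "saturates A \<phi> X" "opt_val p = opt_val p'" "p \<in> lists A" "p' \<in> lists A" "x \<in> lists A" "y \<in> lists A"
    "x @ p @ y \<in> X"
  shows "x @ p' @ y \<in> X"
proof (cases "p = []")
  case True
  then show ?thesis using assms by (auto simp: opt_val_def split: if_splits)
next
  case False
  then have "p' \<noteq> []" "\<phi> p = \<phi> p'" using assms(2) by (auto simp: opt_val_def split: if_splits)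
  then show ?thesis
    using assms(1)[unfolded saturates_def, rule_format, of x y p p'] assms False by simp
qed

text \<open>The marked letter lies left of \<open>u\<close>, right of \<open>u\<close> or inside.
  The first two cases need only the value of \<open>u\<close>; in the third the key provides a split
  of \<open>v\<close> with the same side values.\<close>

lemma factor_key_pump:
  assumes uv: "u \<in> lists A - {[]}" "v \<in> lists A - {[]}" "factor_key u = factor_key v"
    and xy: "x \<in> lists A" "y \<in> lists A" "x @ u @ y \<in> M"
  shows "x @ v @ y \<in> M"
proof -
  have \<phi>uv: "\<phi> u = \<phi> v" using uv by (simp add: factor_key_def)
  obtain l k where lk: "l \<in> L" "k \<in> K" "x @ u @ y = l @ [a] @ k" using xy by (auto simp: M_def)
  have lkA: "l \<in> lists A" "k \<in> lists A" using lk LA KA by auto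
  consider "length l < length x" | "length x + length u \<le> length l"
    | "length x \<le> length l" "length l < length x + length u" by linarith
  then show ?thesis
  proof cases
    case 1
    then obtain p' where p': "x = l @ [a] @ p'" "p' @ u @ y = k"
      using lk(3) by (auto simp: append_eq_append_conv2 append_eq_Cons_conv)
    have "p' @ v @ y \<in> K"
      using satK[unfolded saturates_def, rule_format, of p' y u v] p' lk \<phi>uv uv xy lkA by auto
    then show ?thesis using p' by (intro M_I[OF lk(1)]) auto
  next
    case 2
    then obtain q' where q': "l = x @ u @ q'" "y = q' @ [a] @ k"
      using lk(3) by (auto simp: append_eq_append_conv2 append_eq_Cons_conv)
    have "x @ v @ q' \<in> L"
      using satL[unfolded saturates_def, rule_format, of x q' u v] q' lk \<phi>uv uv xy lkA by auto
    then show ?thesis using lk(2) q' by (auto intro: M_I)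
  next
    case 3
    then obtain p q where pq: "l = x @ p" "u = p @ [a] @ q" "k = q @ y"
      using lk(3) by (auto simp: append_eq_append_conv2 append_eq_Cons_conv)
    then have "(opt_val p, opt_val q) \<in> snd (factor_key v)"
      unfolding uv(3)[symmetric] by (auto simp: factor_key_def)
    then obtain p' q' where pq': "opt_val p = opt_val p'" "opt_val q = opt_val q'" "v = p' @ [a] @ q'"
      by (auto simp: factor_key_def)
    have "x @ p' @ [] \<in> L"
      by (rule saturates_opt[OF satL pq'(1)]) (use pq pq' uv xy lk in auto)
    moreover have "[] @ q' @ y \<in> K"
      by (rule saturates_opt[OF satK pq'(2)]) (use pq pq' uv xy lk in auto)
    ultimately show ?thesis by (rule M_I) (simp add: pq'(3))
  qed
qed

lemma finite_factor_key:
  assumes "finite (carrier S)"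
  shows "finite (factor_key ` (lists A - {[]}))"
proof (rule finite_subset)
  let ?O = "insert None (Some ` carrier S)"
  show "factor_key ` (lists A - {[]}) \<subseteq> carrier S \<times> Pow (?O \<times> ?O)"
  proof
    fix y assume "y \<in> factor_key ` (lists A - {[]})"
    then obtain u where u: "u \<in> lists A - {[]}" "y = factor_key u" by blast
    have o: "opt_val p \<in> ?O" if "p \<in> lists A" for p
      using free_hom_closed[OF \<phi>, of p] that by (simp add: opt_val_def)
    have "opt_val p \<in> ?O \<and> opt_val q \<in> ?O" if "u = p @ [a] @ q" for p q
      using u(1) that by (intro conjI o) auto
    then have "snd y \<subseteq> ?O \<times> ?O" unfolding u(2) factor_key_def snd_conv by blast
    moreover have "fst y \<in> carrier S" using free_hom_closed[OF \<phi>, of u] u by (simp add: factor_key_def)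
    ultimately show "y \<in> carrier S \<times> Pow (?O \<times> ?O)" by (cases y) simp
  qed
  show "finite (carrier S \<times> Pow (?O \<times> ?O))" using assms by simp
qed

lemma syntactic_semigroup_M:
  assumes "finite (carrier S)"
  shows "\<exists>T\<in>fin_sgps. \<exists>\<eta>\<in>sgp_epi (free_sgp A) T.
    \<forall>u\<in>lists A - {[]}. \<forall>v\<in>lists A - {[]}. \<eta> u = \<eta> v \<longleftrightarrow> syntactic_eq A M u v"
proof (rule syntactic_semigroup[OF _ finite_factor_key[OF assms]])
  show "A \<noteq> {}" using a by blast
  fix u v assume "u \<in> lists A - {[]}" "v \<in> lists A - {[]}" "factor_key u = factor_key v"
  then show "syntactic_eq A M u v"
    using factor_key_pump unfolding syntactic_eq_def by metis
qed

lemma syntactic_recognizes: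
  assumes "T \<in> W" "\<eta> \<in> sgp_epi (free_sgp A) T"
    and eq: "\<And>u v. \<lbrakk>u \<in> lists A - {[]}; v \<in> lists A - {[]}; \<eta> u = \<eta> v\<rbrakk> \<Longrightarrow> syntactic_eq A M u v"
  shows "recognizable W A {u @ [a] @ v | u v. u \<in> L \<and> v \<in> K}"
  unfolding M_def[symmetric]
proof (rule recognizable_saturates[OF assms(1) _ M_words])
  show "\<eta> \<in> sgp_hom (free_sgp A) T" using assms(2) by (simp add: sgp_epi_def)
  show "saturates A \<eta> M" using eq unfolding saturates_def syntactic_eq_def by blast
qed

text \<open>Words assembled from high powers are avoiding, so for them equal
  \<open>\<phi>\<close>-values give equal \<open>\<eta>\<close>-values (\<open>key\<close>). The
  words occurring in the identities and in (\<omega>+1)-powers are of this kind, so these properties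
  pass from \<open>S\<close> to \<open>T\<close>, although \<open>T\<close> need not divide
  \<open>S\<close>.\<close>

lemma covered_syntactic:
  assumes V: "sgp_pseudovariety V" and cov: "covered_at V S N"
    and T: "T \<in> fin_sgps" and \<eta>: "\<eta> \<in> sgp_epi (free_sgp A) T"
    and eq: "\<And>u v. \<lbrakk>u \<in> lists A - {[]}; v \<in> lists A - {[]}; syntactic_eq A M u v\<rbrakk> \<Longrightarrow> \<eta> u = \<eta> v"
  shows "\<exists>n. covered_at V T n"
proof -
  have Ts: "is_semigroup T" "finite (carrier T)" using T by (auto simp: fin_sgps_def)
  interpret T: sgp T by unfold_locales (rule Ts)
  interpret S: sgp S by unfold_locales (rule S)
  obtain N1 where N1: "idem_exponent T N1" using T.exists_idem_exponent Ts by blast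
  have \<eta>h: "\<eta> \<in> sgp_hom (free_sgp A) T" and \<eta>s: "carrier T = \<eta> ` (lists A - {[]})"
    using \<eta> by (auto simp: sgp_epi_def free_sgp_def)
  have N1p: "N1 > 0" using N1 by (simp add: idem_exponent_def)
  have idS: "idem_exponent S N" using cov by (simp add: covered_at_def)
  then have Np: "N > 0" by (simp add: idem_exponent_def)
  \<comment> \<open>A multiple of \<open>N\<close> and of \<open>N1\<close>, as needed for
    \<open>S\<close> and \<open>T\<close>, and at least \<open>3 * N\<close>, which exceeds the
    bound in \<open>avoiding_wpow\<close>.\<close>
  define n where "n = N * (N1 * 3)"
  have "n \<ge> N * 3" using N1p by (simp add: n_def)
  then have n: "n \<ge> 2 * N + 1" "n > 0" using Np by linarith+
  have covn: "covered_at V S n" unfolding n_def by (rule covered_at_multiple[OF S cov]) (use N1p in simp)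
  have idT: "idem_exponent T n"
    using T.idem_exponent_mult[OF N1, of "N * 3"] Np by (simp add: n_def mult.left_commute)
  let ?W = "lists A - {[]}"
  have pw: "wpow b m \<in> ?W" if "b \<in> ?W" "m > 0" for b m
    using that by (auto simp: wpow_Nil dest: wpow_lists)
  have ap: "u @ v \<in> ?W" if "u \<in> ?W" "v \<in> ?W" for u v using that by auto
  have \<phi>p: "\<phi> (wpow b m) = spow S (\<phi> b) m" "\<eta> (wpow b m) = spow T (\<eta> b) m" if "b \<in> ?W" "m > 0" for b m
    using free_hom_power[OF \<phi>] free_hom_power[OF \<eta>h] that by auto
  have \<phi>a: "\<phi> (u @ v) = \<phi> u \<cdot>\<^bsub>S\<^esub> \<phi> v" "\<eta> (u @ v) = \<eta> u \<cdot>\<^bsub>T\<^esub> \<eta> v" if "u \<in> ?W" "v \<in> ?W" for u v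
    using free_hom_append[OF \<phi>] free_hom_append[OF \<eta>h] that by auto
  have \<phi>c: "\<phi> u \<in> carrier S" if "u \<in> ?W" for u using free_hom_closed[OF \<phi>] that by auto
  have av: "avoiding (wpow b m)" if "b \<in> ?W" "m \<ge> n" for b m
    using avoiding_wpow[OF idS] that n by auto
  have key: "\<eta> u = \<eta> v" if "u \<in> ?W" "v \<in> ?W" "avoiding u" "avoiding v" "\<phi> u = \<phi> v" for u v
    using eq avoiding_syntactic_eq that by blast
  obtain Q \<tau> where Q: "Q \<in> V" "rel_morphism S Q \<tau>" "power_injective S n \<tau>"
    using covn by (auto simp: covered_at_def)
  have "is_semigroup Q" using pseudovariety_fin[OF V Q(1)] by simp
  then obtain \<psi> where \<psi>: "\<psi> \<in> sgp_hom (free_sgp A) Q" "\<And>w. w \<in> ?W \<Longrightarrow> (\<phi> w, \<psi> w) \<in> \<tau>"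
    using rel_morphism_word_hom[OF Q(2) _ \<phi>] by blast
  \<comment> \<open>\<open>T\<close> is covered by the same \<open>Q\<close> as \<open>S\<close>,
    through a letterwise lift \<open>\<psi>\<close> of the cover of \<open>S\<close>.\<close>
  define \<sigma> where "\<sigma> = (\<lambda>w. (\<eta> w, \<psi> w)) ` ?W"
  have "rel_morphism T Q \<sigma>"
    unfolding rel_morphism_def
  proof (intro conjI allI impI)
    show "\<sigma> \<subseteq> carrier T \<times> carrier Q"
      using free_hom_closed[OF \<eta>h] free_hom_closed[OF \<psi>(1)] by (auto simp: \<sigma>_def)
    show "carrier T \<subseteq> fst ` \<sigma>" unfolding \<eta>s by (force simp: \<sigma>_def)
    fix s t s' t' assume "(s, t) \<in> \<sigma>" "(s', t') \<in> \<sigma>"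
    then obtain u v where uv: "u \<in> ?W" "v \<in> ?W" "s = \<eta> u" "t = \<psi> u" "s' = \<eta> v" "t' = \<psi> v"
      by (auto simp: \<sigma>_def)
    then have "(s \<cdot>\<^bsub>T\<^esub> s', t \<cdot>\<^bsub>Q\<^esub> t') = (\<lambda>w. (\<eta> w, \<psi> w)) (u @ v)"
      by (simp add: free_hom_append[OF \<eta>h] free_hom_append[OF \<psi>(1)])
    then show "(s \<cdot>\<^bsub>T\<^esub> s', t \<cdot>\<^bsub>Q\<^esub> t') \<in> \<sigma>" unfolding \<sigma>_def by (rule image_eqI) (use uv ap in blast)
  qed
  moreover have "power_injective T n \<sigma>"
    unfolding power_injective_def
  proof (intro allI impI)
    fix s s' t assume st: "(s, t) \<in> \<sigma>" "(s', t) \<in> \<sigma>"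
    obtain u where u: "u \<in> ?W" "s = \<eta> u" "t = \<psi> u" using st(1) by (auto simp: \<sigma>_def)
    obtain v where v: "v \<in> ?W" "s' = \<eta> v" "t = \<psi> v" using st(2) by (auto simp: \<sigma>_def)
    note uv = u(1) v(1) u(2) v(2)
    have "(\<phi> u, \<psi> u) \<in> \<tau>" "(\<phi> v, \<psi> u) \<in> \<tau>" using \<psi>(2)[OF uv(1)] \<psi>(2)[OF uv(2)] u v by auto
    then have "\<phi> (wpow u (Suc n)) = \<phi> (wpow v (Suc n))"
      unfolding \<phi>p(1)[OF uv(1) zero_less_Suc] \<phi>p(1)[OF uv(2) zero_less_Suc]
      using Q(3) unfolding power_injective_def by blast
    then have "\<eta> (wpow u (Suc n)) = \<eta> (wpow v (Suc n))"
      by (intro key pw av uv) auto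
    then show "spow T s (Suc n) = spow T s' (Suc n)"
      unfolding \<phi>p(2)[OF uv(1) zero_less_Suc] \<phi>p(2)[OF uv(2) zero_less_Suc] uv(3,4) .
  qed
  moreover have "ds_rs_identities T n"
    unfolding ds_rs_identities_def \<eta>s
  proof (intro ballI, elim imageE)
    fix x' y' x y assume xy: "x' = \<eta> x" "y' = \<eta> y" "x \<in> ?W" "y \<in> ?W"
    have D: "ds_rs_identities S n" using covn by (simp add: covered_at_def)
    note D = D[unfolded ds_rs_identities_def, rule_format, OF \<phi>c[OF xy(3)] \<phi>c[OF xy(4)]]
    note w = xy(3,4) ap[OF xy(3,4)] ap[OF xy(4,3)]
    let ?e = "wpow (x @ y) n" and ?f = "wpow (y @ x) n"
    have ef: "?e \<in> ?W" "?f \<in> ?W" "?e @ ?f \<in> ?W" "(?e @ ?f) @ ?e \<in> ?W" by (intro pw ap w n(2))+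
    have g: "wpow x n \<in> ?W" "wpow y n \<in> ?W" "wpow x n @ wpow y n \<in> ?W" by (intro pw ap w n(2))+
    \<comment> \<open>Both sides are powers with exponent \<open>n\<close>, hence avoiding, and
      their \<open>\<phi>\<close>-values agree by the first identity in \<open>S\<close>.\<close>
    have "\<eta> (wpow ((?e @ ?f) @ ?e) n) = \<eta> ?e"
    proof (rule key)
      show "\<phi> (wpow ((?e @ ?f) @ ?e) n) = \<phi> ?e"
        using conjunct1[OF D] by (simp only: \<phi>p(1)[OF ef(4) n(2)] \<phi>a(1)[OF ef(3,1)] \<phi>a(1)[OF ef(1,2)]
          \<phi>p(1)[OF w(3) n(2)] \<phi>p(1)[OF w(4) n(2)] \<phi>a(1)[OF w(1,2)] \<phi>a(1)[OF w(2,1)])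
    qed (intro pw av ef w n(2) order_refl)+
    then have 1: "spow T (spow T (x' \<cdot>\<^bsub>T\<^esub> y') n \<cdot>\<^bsub>T\<^esub> spow T (y' \<cdot>\<^bsub>T\<^esub> x') n \<cdot>\<^bsub>T\<^esub> spow T (x' \<cdot>\<^bsub>T\<^esub> y') n) n
       = spow T (x' \<cdot>\<^bsub>T\<^esub> y') n"
      by (simp only: xy(1,2) \<phi>p(2)[OF ef(4) n(2)] \<phi>a(2)[OF ef(3,1)] \<phi>a(2)[OF ef(1,2)]
          \<phi>p(2)[OF w(3) n(2)] \<phi>p(2)[OF w(4) n(2)] \<phi>a(2)[OF w(1,2)] \<phi>a(2)[OF w(2,1)])
    have "\<eta> (wpow (wpow x n @ wpow y n) (Suc n)) = \<eta> (wpow x n @ wpow y n)"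
    proof (rule key)
      show "\<phi> (wpow (wpow x n @ wpow y n) (Suc n)) = \<phi> (wpow x n @ wpow y n)"
        using conjunct2[OF D] by (simp only: \<phi>p(1)[OF g(3) zero_less_Suc] \<phi>a(1)[OF g(1,2)]
          \<phi>p(1)[OF w(1) n(2)] \<phi>p(1)[OF w(2) n(2)])
      \<comment> \<open>This word is a concatenation of two powers and not visibly a power, so
        concatenation of avoiding words is needed.\<close>
      show "avoiding (wpow x n @ wpow y n)"
        using g by (intro avoiding_append av w order_refl) auto
      show "avoiding (wpow (wpow x n @ wpow y n) (Suc n))" using g(3) by (intro av) auto
      show "wpow (wpow x n @ wpow y n) (Suc n) \<in> ?W" using g(3) by (intro pw) auto
    qed (fact g(3))
    then have 2: "spow T (spow T x' n \<cdot>\<^bsub>T\<^esub> spow T y' n) (Suc n) = spow T x' n \<cdot>\<^bsub>T\<^esub> spow T y' n"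
      by (simp only: xy(1,2) \<phi>p(2)[OF g(3) zero_less_Suc] \<phi>a(2)[OF g(1,2)]
          \<phi>p(2)[OF w(1) n(2)] \<phi>p(2)[OF w(2) n(2)])
    show "spow T (spow T (x' \<cdot>\<^bsub>T\<^esub> y') n \<cdot>\<^bsub>T\<^esub> spow T (y' \<cdot>\<^bsub>T\<^esub> x') n \<cdot>\<^bsub>T\<^esub> spow T (x' \<cdot>\<^bsub>T\<^esub> y') n) n
       = spow T (x' \<cdot>\<^bsub>T\<^esub> y') n \<and>
      spow T (spow T x' n \<cdot>\<^bsub>T\<^esub> spow T y' n) (Suc n) = spow T x' n \<cdot>\<^bsub>T\<^esub> spow T y' n"
      using 1 2 by blast
  qed
  ultimately show ?thesis using idT Q(1) unfolding covered_at_def by blast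
qed

end

lemma bidet_product_setup:
  assumes V: "sgp_pseudovariety V" and a: "a \<in> A"
    and L: "recognizable V A L \<or> L = {[]}" and K: "recognizable V A K \<or> K = {[]}"
    and pre: "prefix_code A {u @ [a] | u. u \<in> L}" and suf: "suffix_code A {[a] @ v | v. v \<in> K}"
  shows "\<exists>S\<in>V. \<exists>\<phi>. bidet_product A a L K S \<phi>"
proof -
  obtain S \<phi> where S: "S \<in> V" "\<phi> \<in> sgp_hom (free_sgp A) S" "saturates A \<phi> L" "saturates A \<phi> K"
    using saturates_common[OF V, of "{L, K}" A] L K by auto
  have "L \<subseteq> lists A" "K \<subseteq> lists A" using L K by (auto simp: recognizable_def)
  then have "bidet_product A a L K S \<phi>"
    using S a pre suf pseudovariety_fin[OF V S(1)] by unfold_locales auto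
  then show ?thesis using S(1) by blast
qed

lemma bidet_bound_closed:
  assumes V: "sgp_pseudovariety V"
  shows "closed_under_bideterministic_product (bidet_bound V)"
  unfolding closed_under_bideterministic_product_def
proof (intro allI ballI impI)
  fix A :: "nat set" and a L K
  let ?W = "bidet_bound V"
  assume a: "a \<in> A" and LK: "recognizable ?W A L \<or> L = {[]}" "recognizable ?W A K \<or> K = {[]}"
    and code: "prefix_code A {u @ [a] | u. u \<in> L}" "suffix_code A {[a] @ v | v. v \<in> K}"
  obtain S \<phi> where SW: "S \<in> ?W" and bp: "bidet_product A a L K S \<phi>"
    using bidet_product_setup[OF bidet_bound_pseudovariety[OF V] a LK code] by blast
  interpret bidet_product A a L K S \<phi> by (rule bp)
  obtain N where N: "covered_at V S N" "finite (carrier S)" using SW by (auto simp: bidet_bound_def fin_sgps_def)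
  obtain T \<eta> where T: "T \<in> fin_sgps" "\<eta> \<in> sgp_epi (free_sgp A) T"
    and eq: "\<And>u v. \<lbrakk>u \<in> lists A - {[]}; v \<in> lists A - {[]}\<rbrakk> \<Longrightarrow> \<eta> u = \<eta> v \<longleftrightarrow> syntactic_eq A M u v"
    using syntactic_semigroup_M[OF N(2)] by blast
  have "T \<in> ?W"
    using covered_syntactic[OF V N(1) T] eq T(1) by (auto simp: bidet_bound_def)
  then show "recognizable ?W A {u @ [a] @ v | u v. u \<in> L \<and> v \<in> K}"
    by (rule syntactic_recognizes[OF _ T(2)]) (use eq in blast)
qed

lemma sgp_pseudovariety_Inter:
  assumes "\<F> \<noteq> {}" "\<And>W. W \<in> \<F> \<Longrightarrow> sgp_pseudovariety W"
  shows "sgp_pseudovariety (\<Inter>\<F>)"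
  unfolding sgp_pseudovariety_def
proof (intro conjI ballI allI impI InterI)
  show "\<Inter>\<F> \<subseteq> fin_sgps" using assms unfolding sgp_pseudovariety_def by blast
next
  fix S H W assume "S \<in> \<Inter>\<F>" "subsemigroup H S" "W \<in> \<F>"
  then show "S\<lparr>carrier := H\<rparr> \<in> W" using assms(2)[of W] by (auto simp: sgp_pseudovariety_def)
next
  fix S T W assume h: "S \<in> \<Inter>\<F>" "T \<in> fin_sgps" "sgp_epi S T \<noteq> {}" "W \<in> \<F>"
  then have "S \<in> W" by blast
  then show "T \<in> W"
    using assms(2)[OF h(4), unfolded sgp_pseudovariety_def] h(2,3) by blast
next
  fix I :: "nat set" and S P W
  assume h: "P \<in> fin_sgps" "finite I" "\<forall>i\<in>I. S i \<in> \<Inter>\<F>" "sgp_iso (product_sgp I S) P \<noteq> {}" "W \<in> \<F>"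
  then have "\<forall>i\<in>I. S i \<in> W" by blast
  then show "P \<in> W"
    using assms(2)[OF h(5), unfolded sgp_pseudovariety_def] h(1,2,4) by blast
qed

lemma recognizable_mono: "V \<subseteq> W \<Longrightarrow> recognizable V A L \<Longrightarrow> recognizable W A L"
  unfolding recognizable_def by blast

lemma bideterministic_closure_properties:
  assumes V: "sgp_pseudovariety V" and sub: "V \<subseteq> DS \<inter> RS"
  defines "W \<equiv> bideterministic_closure V"
  shows "sgp_pseudovariety W" "closed_under_bideterministic_product W" "V \<subseteq> W" "W \<subseteq> bidet_bound V"
proof -
  define \<F> where "\<F> = {W. sgp_pseudovariety W \<and> closed_under_bideterministic_product W \<and> V \<subseteq> W}"
  have W: "W = \<Inter>\<F>" by (simp add: W_def bideterministic_closure_def \<F>_def)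
  \<comment> \<open>Besides bounding \<open>W\<close>, this shows that the family is nonempty; an
    empty intersection would contain every structure.\<close>
  have B: "bidet_bound V \<in> \<F>"
    using bidet_bound_pseudovariety[OF V] bidet_bound_closed[OF V] subset_bidet_bound[OF V sub]
    by (simp add: \<F>_def)
  show ps: "sgp_pseudovariety W"
    unfolding W by (rule sgp_pseudovariety_Inter) (use B in \<open>auto simp: \<F>_def\<close>)
  show "V \<subseteq> W" unfolding W \<F>_def by blast
  show "W \<subseteq> bidet_bound V" unfolding W using B by blast
  show "closed_under_bideterministic_product W"
    unfolding closed_under_bideterministic_product_def
  proof (intro allI ballI impI)
    fix A :: "nat set" and a L K
    assume fA: "finite A" and a: "a \<in> A" and LK: "recognizable W A L \<or> L = {[]}" "recognizable W A K \<or> K = {[]}"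
      and code: "prefix_code A {u @ [a] | u. u \<in> L}" "suffix_code A {[a] @ v | v. v \<in> K}"
    obtain S \<phi> where SW: "S \<in> W" and bp: "bidet_product A a L K S \<phi>"
      using bidet_product_setup[OF ps a LK code] by blast
    interpret bidet_product A a L K S \<phi> by (rule bp)
    have "finite (carrier S)" using pseudovariety_fin[OF ps SW] by simp
    from syntactic_semigroup_M[OF this]
    obtain T \<eta> where T: "T \<in> fin_sgps" "\<eta> \<in> sgp_epi (free_sgp A) T"
      and eq: "\<And>u v. \<lbrakk>u \<in> lists A - {[]}; v \<in> lists A - {[]}\<rbrakk> \<Longrightarrow> \<eta> u = \<eta> v \<longleftrightarrow> syntactic_eq A M u v"
      by blast
    have "T \<in> U" if U: "U \<in> \<F>" for U
    proof -
      have WU: "W \<subseteq> U" unfolding W using U by blast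
      have "recognizable U A L \<or> L = {[]}" "recognizable U A K \<or> K = {[]}"
        using LK recognizable_mono[OF WU] by blast+
      then have "recognizable U A M"
        using U fA a code unfolding \<F>_def closed_under_bideterministic_product_def M_def by blast
      then show ?thesis
        using syntactic_semigroup_mem[OF _ _ T] eq U by (auto simp: \<F>_def)
    qed
    then have "T \<in> W" unfolding W by blast
    then show "recognizable W A {u @ [a] @ v | u v. u \<in> L \<and> v \<in> K}"
      by (rule syntactic_recognizes[OF _ T(2)]) (use eq in blast)
  qed
qed

section \<open>Semigroupoids dividing a semigroup\<close>

text \<open>The target has a single vertex, so no map on vertices is needed, and only composable
  pairs are constrained.\<close>

definition sgpoid_rel :: "('v, 'e) sgpoid \<Rightarrow> nat sgp \<Rightarrow> ('e \<times> nat) set \<Rightarrow> bool" where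
  "sgpoid_rel S T \<tau> \<longleftrightarrow> \<tau> \<subseteq> edges S \<times> carrier T \<and> edges S \<subseteq> fst ` \<tau> \<and>
     (\<forall>s t s' t'. (s, t) \<in> \<tau> \<longrightarrow> (s', t') \<in> \<tau> \<longrightarrow> target S s = source S s' \<longrightarrow>
        (ecomp S s s', t \<cdot>\<^bsub>T\<^esub> t') \<in> \<tau>)"

definition coterminal :: "('v, 'e) sgpoid \<Rightarrow> 'e \<Rightarrow> 'e \<Rightarrow> bool" where
  "coterminal S s t \<longleftrightarrow> source S s = source S t \<and> target S s = target S t"

definition faithful_rel :: "('v, 'e) sgpoid \<Rightarrow> ('e \<times> nat) set \<Rightarrow> bool" where
  "faithful_rel S \<tau> \<longleftrightarrow> (\<forall>s s' t. (s, t) \<in> \<tau> \<longrightarrow> (s', t) \<in> \<tau> \<longrightarrow> coterminal S s s' \<longrightarrow> s = s')"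

text \<open>An explicit form of the global class, with division written as a faithful relation. A
  single member of \<open>V\<close> suffices because \<open>V\<close> is closed under finite
  products.\<close>

definition dividing_sgpoids :: "nat sgp set \<Rightarrow> (nat, nat) sgpoid set" where
  "dividing_sgpoids V =
     {S \<in> fin_sgpoids. \<exists>T\<in>V. \<exists>\<tau>. sgpoid_rel S T \<tau> \<and> faithful_rel S \<tau>}"

lemma sgpoid_rel_total: "sgpoid_rel S T \<tau> \<Longrightarrow> s \<in> edges S \<Longrightarrow> \<exists>t. (s, t) \<in> \<tau>"
  unfolding sgpoid_rel_def by force

lemma sgpoid_relD:
  assumes "sgpoid_rel S T \<tau>" "(s, t) \<in> \<tau>"
  shows "s \<in> edges S" "t \<in> carrier T"
  using assms by (auto simp: sgpoid_rel_def)

lemma sgpoid_rel_comp: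
  assumes "sgpoid_rel S T \<tau>" "(s, t) \<in> \<tau>" "(s', t') \<in> \<tau>" "target S s = source S s'"
  shows "(ecomp S s s', t \<cdot>\<^bsub>T\<^esub> t') \<in> \<tau>"
  using assms by (auto simp: sgpoid_rel_def)

lemma dividing_divisor:
  assumes S: "S \<in> dividing_sgpoids V" and S': "S' \<in> fin_sgpoids" and div: "sgpoid_divides S' S"
  shows "S' \<in> dividing_sgpoids V"
proof -
  obtain T \<tau> where T: "T \<in> V" and \<tau>: "sgpoid_rel S T \<tau>" "faithful_rel S \<tau>"
    using S by (auto simp: dividing_sgpoids_def)
  obtain U :: "(nat, nat) sgpoid" and f g f' g' where U: "is_semigroupoid U"
    and h: "(f, g) \<in> sgpoid_hom U S" "faithful U (f, g)"
    and h': "(f', g') \<in> sgpoid_hom U S'" "bij_betw f' (vertices U) (vertices S')" "g' ` edges U = edges S'"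
    using div unfolding sgpoid_divides_def by auto
  interpret U: semigroupoid U by unfold_locales (rule U)
  have f'inj: "x = y" if "f' x = f' y" "x \<in> vertices U" "y \<in> vertices U" for x y
    using h'(2) that by (auto simp: bij_betw_def inj_on_def)
  have g: "g u \<in> edges S" "source S (g u) = f (source U u)" "target S (g u) = f (target U u)"
    if "u \<in> edges U" for u
    using h(1) that by (auto simp: sgpoid_hom_def)
  have g': "g' u \<in> edges S'" "source S' (g' u) = f' (source U u)" "target S' (g' u) = f' (target U u)"
    if "u \<in> edges U" for u
    using h'(1) that by (auto simp: sgpoid_hom_def)
  define \<sigma> where "\<sigma> = {(g' u, t) | u t. u \<in> edges U \<and> (g u, t) \<in> \<tau>}"
  have "sgpoid_rel S' T \<sigma>"
    unfolding sgpoid_rel_def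
  proof (intro conjI allI impI)
    show "\<sigma> \<subseteq> edges S' \<times> carrier T" using g' sgpoid_relD[OF \<tau>(1)] by (auto simp: \<sigma>_def)
    show "edges S' \<subseteq> fst ` \<sigma>"
    proof
      fix s assume "s \<in> edges S'"
      then obtain u where u: "u \<in> edges U" "s = g' u" using h'(3) by auto
      then obtain t where "(g u, t) \<in> \<tau>" using g(1) sgpoid_rel_total[OF \<tau>(1)] by blast
      then have "(s, t) \<in> \<sigma>" using u by (auto simp: \<sigma>_def)
      then show "s \<in> fst ` \<sigma>" by force
    qed
    fix s t s' t' assume st: "(s, t) \<in> \<sigma>" "(s', t') \<in> \<sigma>" "target S' s = source S' s'"
    obtain u where u: "u \<in> edges U" "(g u, t) \<in> \<tau>" "s = g' u" using st(1) by (auto simp: \<sigma>_def)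
    obtain v where v: "v \<in> edges U" "(g v, t') \<in> \<tau>" "s' = g' v" using st(2) by (auto simp: \<sigma>_def)
    \<comment> \<open>Composability lifts from \<open>S'\<close> to \<open>U\<close> because the
      quotient map is injective on vertices.\<close>
    have uv: "target U u = source U v"
      using st(3)[unfolded u(3) v(3) g'(3)[OF u(1)] g'(2)[OF v(1)]]
      by (rule f'inj[OF _ U.tgt_vertex[OF u(1)] U.src_vertex[OF v(1)]])
    then have "g (ecomp U u v) = ecomp S (g u) (g v)" "g' (ecomp U u v) = ecomp S' s s'"
      using h(1) h'(1) u v by (auto simp: sgpoid_hom_def)
    moreover have "(ecomp S (g u) (g v), t \<cdot>\<^bsub>T\<^esub> t') \<in> \<tau>"
      using sgpoid_rel_comp[OF \<tau>(1) u(2) v(2)] g u v uv by simp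
    ultimately show "(ecomp S' s s', t \<cdot>\<^bsub>T\<^esub> t') \<in> \<sigma>"
      using U.comp_edge[OF u(1) v(1) uv] unfolding \<sigma>_def mem_Collect_eq by metis
  qed
  moreover have "faithful_rel S' \<sigma>"
    unfolding faithful_rel_def
  proof (intro allI impI)
    fix s s' t assume st: "(s, t) \<in> \<sigma>" "(s', t) \<in> \<sigma>" "coterminal S' s s'"
    obtain u where u: "u \<in> edges U" "(g u, t) \<in> \<tau>" "s = g' u" using st(1) by (auto simp: \<sigma>_def)
    obtain v where v: "v \<in> edges U" "(g v, t) \<in> \<tau>" "s' = g' v" using st(2) by (auto simp: \<sigma>_def)
    have uv: "source U u = source U v" "target U u = target U v"
      using st(3)[unfolded coterminal_def u(3) v(3) g'(2,3)[OF u(1)] g'(2,3)[OF v(1)]]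
        f'inj[OF _ U.src_vertex[OF u(1)] U.src_vertex[OF v(1)]]
        f'inj[OF _ U.tgt_vertex[OF u(1)] U.tgt_vertex[OF v(1)]] by blast+
    then have "coterminal S (g u) (g v)" using g u v by (simp add: coterminal_def)
    then have "g u = g v" using \<tau>(2) u v unfolding faithful_rel_def by blast
    moreover have "inj_on g {s \<in> edges U. source U s = source U u \<and> target U s = target U u}"
      using h(2) U.src_vertex[OF u(1)] U.tgt_vertex[OF u(1)] by (auto simp: faithful_def)
    ultimately have "u = v" using u v uv by (auto dest: inj_onD)
    then show "s = s'" using u v by simp
  qed
  ultimately show ?thesis using T S' unfolding dividing_sgpoids_def by blast
qed

lemma dividing_product:
  fixes I :: "nat set"
  assumes V: "sgp_pseudovariety V" and I: "finite I" and S: "\<And>i. i \<in> I \<Longrightarrow> S i \<in> dividing_sgpoids V"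
    and P: "P \<in> fin_sgpoids" and iso: "sgpoid_iso (product_sgpoid I S) P \<noteq> {}"
  shows "P \<in> dividing_sgpoids V"
proof -
  let ?X = "product_sgpoid I S"
  obtain T \<tau> where T: "\<And>i. i \<in> I \<Longrightarrow> T i \<in> V \<and> sgpoid_rel (S i) (T i) (\<tau> i) \<and> faithful_rel (S i) (\<tau> i)"
    using S unfolding dividing_sgpoids_def mem_Collect_eq Bex_def by metis
  then have Tr: "\<And>i. i \<in> I \<Longrightarrow> sgpoid_rel (S i) (T i) (\<tau> i)" by blast
  obtain Q \<rho> where Q: "Q \<in> V" "projections I T Q \<rho>"
    using pseudovariety_product[OF V I, of T] T by blast
  have Qs: "is_semigroup Q" using pseudovariety_fin[OF V Q(1)] by simp
  obtain f g where fg: "(f, g) \<in> sgpoid_hom ?X P" "bij_betw f (vertices ?X) (vertices P)"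
    "bij_betw g (edges ?X) (edges P)" using iso by (auto simp: sgpoid_iso_def)
  have finj: "x = y" if "f x = f y" "x \<in> vertices ?X" "y \<in> vertices ?X" for x y
    using fg(2) that by (auto simp: bij_betw_def inj_on_def)
  have gs: "g ` edges ?X = edges P" using fg(3) by (simp add: bij_betw_def)
  have e: "u \<in> edges ?X \<longleftrightarrow> u \<in> (\<Pi>\<^sub>E i\<in>I. edges (S i))" for u by (simp add: product_sgpoid_def)
  have ge: "g u \<in> edges P" "source P (g u) = f (source ?X u)" "target P (g u) = f (target ?X u)"
    if "u \<in> edges ?X" for u
    using fg(1) that by (auto simp: sgpoid_hom_def)
  have Sd: "is_semigroupoid (S i)" if "i \<in> I" for i using S[OF that] by (auto simp: dividing_sgpoids_def fin_sgpoids_def)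
  have vert: "source ?X u \<in> vertices ?X" "target ?X u \<in> vertices ?X" if "u \<in> edges ?X" for u
    using that Sd by (auto simp: product_sgpoid_def is_semigroupoid_def PiE_iff)
  have st: "source ?X u = (\<lambda>i\<in>I. source (S i) (u i))" "target ?X u = (\<lambda>i\<in>I. target (S i) (u i))" for u
    by (simp_all add: product_sgpoid_def)
  have restrict_eq: "a i = b i" if "restrict a I = restrict b I" "i \<in> I" for a b :: "nat \<Rightarrow> nat" and i
    using that by (metis restrict_apply')
  define \<sigma> where "\<sigma> = {(g u, q) | u q. u \<in> edges ?X \<and> q \<in> carrier Q \<and> (\<forall>i\<in>I. (u i, \<rho> i q) \<in> \<tau> i)}"
  have "sgpoid_rel P Q \<sigma>"
    unfolding sgpoid_rel_def
  proof (intro conjI allI impI)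
    show "\<sigma> \<subseteq> edges P \<times> carrier Q" using ge by (auto simp: \<sigma>_def)
    show "edges P \<subseteq> fst ` \<sigma>"
    proof
      fix s assume "s \<in> edges P"
      then obtain u where u: "u \<in> edges ?X" "s = g u" using gs by auto
      have "\<exists>t. (u i, t) \<in> \<tau> i" if "i \<in> I" for i
        using T[OF that] u that by (intro sgpoid_rel_total[of "S i" "T i"]) (auto simp: e PiE_iff)
      then obtain t where t: "\<And>i. i \<in> I \<Longrightarrow> (u i, t i) \<in> \<tau> i" by metis
      then have "\<forall>i\<in>I. t i \<in> carrier (T i)" using sgpoid_relD(2)[OF Tr] by blast
      then obtain q where "q \<in> carrier Q" "\<forall>i\<in>I. \<rho> i q = t i"
        using Q(2)[unfolded projections_def, THEN conjunct2, THEN conjunct2, THEN spec, THEN mp, of t] by blast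
      then have "(s, q) \<in> \<sigma>" using u t by (auto simp: \<sigma>_def)
      then show "s \<in> fst ` \<sigma>" by force
    qed
    fix s t s' t' assume a: "(s, t) \<in> \<sigma>" "(s', t') \<in> \<sigma>" "target P s = source P s'"
    obtain u where u: "u \<in> edges ?X" "t \<in> carrier Q" "\<And>i. i \<in> I \<Longrightarrow> (u i, \<rho> i t) \<in> \<tau> i" "s = g u"
      using a(1) by (auto simp: \<sigma>_def)
    obtain v where v: "v \<in> edges ?X" "t' \<in> carrier Q" "\<And>i. i \<in> I \<Longrightarrow> (v i, \<rho> i t') \<in> \<tau> i" "s' = g v"
      using a(2) by (auto simp: \<sigma>_def)
    have uv: "target ?X u = source ?X v"
      using a(3)[unfolded u(4) v(4) ge(3)[OF u(1)] ge(2)[OF v(1)]]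
      by (rule finj[OF _ vert(2)[OF u(1)] vert(1)[OF v(1)]])
    then have "g (ecomp ?X u v) = ecomp P s s'"
      using fg(1) u v by (auto simp: sgpoid_hom_def)
    moreover have "\<rho> i (t \<cdot>\<^bsub>Q\<^esub> t') = \<rho> i t \<cdot>\<^bsub>T i\<^esub> \<rho> i t'" if "i \<in> I" for i
      using u v that Q(2) by (auto simp: projections_def sgp_hom_def)
    moreover have "(ecomp (S i) (u i) (v i), \<rho> i t \<cdot>\<^bsub>T i\<^esub> \<rho> i t') \<in> \<tau> i" if i: "i \<in> I" for i
      using sgpoid_rel_comp[OF _ u(3)[OF i] v(3)[OF i]] T[OF i] restrict_eq[OF uv[unfolded st] i] by blast
    moreover have "t \<cdot>\<^bsub>Q\<^esub> t' \<in> carrier Q" using u v Qs by (auto simp: is_semigroup_def)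
    moreover have "ecomp ?X u v \<in> edges ?X"
    proof -
      have "ecomp (S i) (u i) (v i) \<in> edges (S i)" if i: "i \<in> I" for i
        using Sd[OF i] u(1) v(1) restrict_eq[OF uv[unfolded st] i] i
        unfolding is_semigroupoid_def e PiE_iff by blast
      then show ?thesis by (simp add: product_sgpoid_def)
    qed
    moreover have "ecomp ?X u v i = ecomp (S i) (u i) (v i)" if "i \<in> I" for i
      using that by (simp add: product_sgpoid_def)
    ultimately show "(ecomp P s s', t \<cdot>\<^bsub>Q\<^esub> t') \<in> \<sigma>" unfolding \<sigma>_def by (auto intro!: exI[of _ "ecomp ?X u v"])
  qed
  moreover have "faithful_rel P \<sigma>"
    unfolding faithful_rel_def
  proof (intro allI impI)
    fix s s' t assume a: "(s, t) \<in> \<sigma>" "(s', t) \<in> \<sigma>" "coterminal P s s'"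
    obtain u where u: "u \<in> edges ?X" "\<And>i. i \<in> I \<Longrightarrow> (u i, \<rho> i t) \<in> \<tau> i" "s = g u"
      using a(1) by (auto simp: \<sigma>_def)
    obtain v where v: "v \<in> edges ?X" "\<And>i. i \<in> I \<Longrightarrow> (v i, \<rho> i t) \<in> \<tau> i" "s' = g v"
      using a(2) by (auto simp: \<sigma>_def)
    have uv: "source ?X u = source ?X v" "target ?X u = target ?X v"
      using a(3)[unfolded coterminal_def u(3) v(3) ge(2,3)[OF u(1)] ge(2,3)[OF v(1)]]
        finj[OF _ vert(1)[OF u(1)] vert(1)[OF v(1)]] finj[OF _ vert(2)[OF u(1)] vert(2)[OF v(1)]]
      by blast+
    have "u i = v i" if i: "i \<in> I" for i
    proof -
      have "coterminal (S i) (u i) (v i)"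
        using restrict_eq[OF uv(1)[unfolded st] i] restrict_eq[OF uv(2)[unfolded st] i]
        by (simp add: coterminal_def)
      then show ?thesis using T[OF i] u(2)[OF i] v(2)[OF i] unfolding faithful_rel_def by blast
    qed
    then have "u = v" using u(1) v(1) unfolding e by (blast intro: PiE_ext)
    then show "s = s'" using u v by simp
  qed
  ultimately show ?thesis using Q(1) P unfolding dividing_sgpoids_def by blast
qed

lemma fin_sgpoid_of_sgp: "S \<in> fin_sgps \<Longrightarrow> sgpoid_of_sgp S \<in> fin_sgpoids"
  by (auto simp: fin_sgps_def is_semigroup_def fin_sgpoids_def is_semigroupoid_def sgpoid_of_sgp_def)

lemma dividing_sgpoids_pseudovariety:
  assumes V: "sgp_pseudovariety V"
  shows "sgpoid_pseudovariety (dividing_sgpoids V)"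
  unfolding sgpoid_pseudovariety_def
proof (intro conjI ballI allI impI)
  show "dividing_sgpoids V \<subseteq> fin_sgpoids" by (auto simp: dividing_sgpoids_def)
qed (blast intro: dividing_divisor dividing_product[OF V])+

lemma sgp_dividing:
  assumes V: "sgp_pseudovariety V" and S: "S \<in> V"
  shows "sgpoid_of_sgp S \<in> dividing_sgpoids V"
proof -
  have "S \<in> fin_sgps" using V S by (auto simp: sgp_pseudovariety_def)
  moreover have "sgpoid_rel (sgpoid_of_sgp S) S (Id_on (carrier S))"
    using \<open>S \<in> fin_sgps\<close> unfolding sgpoid_rel_def
    by (force simp: sgpoid_of_sgp_def fin_sgps_def is_semigroup_def)
  moreover have "faithful_rel (sgpoid_of_sgp S) (Id_on (carrier S))"
    by (auto simp: faithful_rel_def)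
  ultimately show ?thesis using S fin_sgpoid_of_sgp unfolding dividing_sgpoids_def by blast
qed

text \<open>The relation itself is the intermediate semigroupoid: its edges are the pairs in
  \<open>\<tau>\<close>, coded as numbers, and the two coordinate projections are the homomorphisms
  of the division.\<close>

lemma dividing_divides:
  assumes S: "is_semigroupoid S" and T: "is_semigroup T" and \<tau>: "sgpoid_rel S T \<tau>" "faithful_rel S \<tau>"
  shows "sgpoid_divides S (sgpoid_of_sgp T)"
proof -
  interpret semigroupoid S by unfold_locales (rule S)
  define e where "e = (prod_encode :: nat \<times> nat \<Rightarrow> nat)"
  define d where "d = prod_decode"
  have de: "d (e x) = x" for x by (simp add: d_def e_def)
  define U :: "(nat, nat) sgpoid" where
    "U = \<lparr>vertices = vertices S, edges = e ` \<tau>, source = (\<lambda>x. src (fst (d x))),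
       target = (\<lambda>x. tgt (fst (d x))),
       ecomp = (\<lambda>x y. e (ecomp S (fst (d x)) (fst (d y)), snd (d x) \<cdot>\<^bsub>T\<^esub> snd (d y)))\<rparr>"
  have ed: "s \<in> E" "t \<in> carrier T" if "(s, t) \<in> \<tau>" for s t using sgpoid_relD[OF \<tau>(1) that] .
  have "is_semigroupoid U"
    unfolding is_semigroupoid_def
  proof (intro conjI ballI impI)
    fix x assume "x \<in> edges U"
    then obtain s t where "(s, t) \<in> \<tau>" "x = e (s, t)" by (auto simp: U_def)
    then show "source U x \<in> vertices U" "target U x \<in> vertices U"
      by (auto simp: U_def de src_vertex tgt_vertex ed)
  next
    fix x y assume xy: "x \<in> edges U" "y \<in> edges U" "target U x = source U y"
    obtain s t where x: "(s, t) \<in> \<tau>" "x = e (s, t)" using xy by (auto simp: U_def)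
    obtain s' t' where y: "(s', t') \<in> \<tau>" "y = e (s', t')" using xy by (auto simp: U_def)
    have c: "tgt s = src s'" using xy(3) x y by (simp add: U_def de)
    have "(ecomp S s s', t \<cdot>\<^bsub>T\<^esub> t') \<in> \<tau>" by (rule sgpoid_rel_comp[OF \<tau>(1) x(1) y(1) c])
    then show "ecomp U x y \<in> edges U" by (simp add: U_def x y de)
    show "source U (ecomp U x y) = source U x" "target U (ecomp U x y) = target U y"
      using x y c by (simp_all add: U_def de comp_src comp_tgt ed)
  next
    fix x y z assume xyz: "x \<in> edges U" "y \<in> edges U" "z \<in> edges U"
      "target U x = source U y" "target U y = source U z"
    obtain s t where x: "(s, t) \<in> \<tau>" "x = e (s, t)" using xyz by (auto simp: U_def)
    obtain s' t' where y: "(s', t') \<in> \<tau>" "y = e (s', t')" using xyz by (auto simp: U_def)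
    obtain s'' t'' where z: "(s'', t'') \<in> \<tau>" "z = e (s'', t'')" using xyz by (auto simp: U_def)
    have c: "tgt s = src s'" "tgt s' = src s''" using xyz x y z by (simp_all add: U_def de)
    show "ecomp U (ecomp U x y) z = ecomp U x (ecomp U y z)"
      using c T ed[OF x(1)] ed[OF y(1)] ed[OF z(1)] by (simp add: U_def x y z de comp_assoc is_semigroup_def)
  qed
  moreover have "(\<lambda>_. 0, snd \<circ> d) \<in> sgpoid_hom U (sgpoid_of_sgp T)"
    using ed by (auto simp: sgpoid_hom_def U_def sgpoid_of_sgp_def de)
  moreover have "faithful U (\<lambda>_. 0 :: nat, snd \<circ> d)"
    using \<tau>(2) by (fastforce simp: faithful_def U_def inj_on_def de faithful_rel_def coterminal_def)
  moreover have "(\<lambda>x. x, fst \<circ> d) \<in> sgpoid_hom U S"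
    using ed src_vertex tgt_vertex by (auto simp: sgpoid_hom_def U_def de)
  moreover have "bij_betw (\<lambda>x. x) (vertices U) (vertices S)" by (simp add: U_def bij_betw_def)
  moreover have "(fst \<circ> d) ` edges U = E"
    using \<tau>(1) by (auto simp: U_def image_image de sgpoid_rel_def)
  ultimately show ?thesis unfolding sgpoid_divides_def by blast
qed

lemma global_sgpoids_eq:
  assumes V: "sgp_pseudovariety V"
  shows "global_sgpoids V = dividing_sgpoids V"
proof
  show "global_sgpoids V \<subseteq> dividing_sgpoids V"
    unfolding global_sgpoids_def
    using dividing_sgpoids_pseudovariety[OF V] sgp_dividing[OF V] by blast
  show "dividing_sgpoids V \<subseteq> global_sgpoids V"
    unfolding global_sgpoids_def
  proof (intro subsetI InterI)
    fix S W assume S: "S \<in> dividing_sgpoids V" and "W \<in> {W. sgpoid_pseudovariety W \<and> sgpoid_of_sgp ` V \<subseteq> W}"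
    then have W: "sgpoid_pseudovariety W" "sgpoid_of_sgp ` V \<subseteq> W" by auto
    obtain T \<tau> where T: "T \<in> V" "sgpoid_rel S T \<tau>" "faithful_rel S \<tau>" and Sf: "S \<in> fin_sgpoids"
      using S by (auto simp: dividing_sgpoids_def)
    have "sgpoid_divides S (sgpoid_of_sgp T)"
      using Sf pseudovariety_fin[OF V T(1)] by (intro dividing_divides[OF _ _ T(2,3)]) (auto simp: fin_sgpoids_def)
    moreover have "sgpoid_of_sgp T \<in> W" using W(2) T(1) by blast
    ultimately show "S \<in> W" using W(1) Sf unfolding sgpoid_pseudovariety_def by blast
  qed
qed

lemma local_sgp_fin:
  assumes "S \<in> fin_sgpoids" "carrier (local_sgp S v) \<noteq> {}"
  shows "local_sgp S v \<in> fin_sgps"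
  using assms by (auto simp: fin_sgps_def fin_sgpoids_def is_semigroup_def is_semigroupoid_def local_sgp_def)

text \<open>All loops at a vertex are coterminal, so a faithful relation restricts to a division of
  the local semigroup. This half of locality holds for every pseudovariety.\<close>

lemma dividing_locally:
  assumes V: "sgp_pseudovariety V"
  shows "dividing_sgpoids V \<subseteq> locally_sgpoids V"
proof
  fix S assume S: "S \<in> dividing_sgpoids V"
  then obtain T \<tau> where T: "T \<in> V" and \<tau>: "sgpoid_rel S T \<tau>" "faithful_rel S \<tau>" and Sf: "S \<in> fin_sgpoids"
    by (auto simp: dividing_sgpoids_def)
  have "local_sgp S v \<in> V" if ne: "carrier (local_sgp S v) \<noteq> {}" for v
  proof -
    let ?L = "local_sgp S v"
    define \<sigma> where "\<sigma> = {(s, t) \<in> \<tau>. s \<in> carrier ?L}"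
    have Ls: "?L \<in> fin_sgps" by (rule local_sgp_fin[OF Sf ne])
    have "rel_morphism ?L T \<sigma>"
      unfolding rel_morphism_def
    proof (intro conjI allI impI)
      show "\<sigma> \<subseteq> carrier ?L \<times> carrier T" using sgpoid_relD[OF \<tau>(1)] by (auto simp: \<sigma>_def)
      show "carrier ?L \<subseteq> fst ` \<sigma>"
      proof
        fix s assume s: "s \<in> carrier ?L"
        then obtain t where "(s, t) \<in> \<tau>" using sgpoid_rel_total[OF \<tau>(1), of s] by (auto simp: local_sgp_def)
        then have "(s, t) \<in> \<sigma>" using s by (simp add: \<sigma>_def)
        then show "s \<in> fst ` \<sigma>" by force
      qed
      fix s t s' t' assume a: "(s, t) \<in> \<sigma>" "(s', t') \<in> \<sigma>"
      then have "(ecomp S s s', t \<cdot>\<^bsub>T\<^esub> t') \<in> \<tau>"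
        using sgpoid_rel_comp[OF \<tau>(1), of s t s' t'] by (auto simp: \<sigma>_def local_sgp_def)
      moreover have "s \<cdot>\<^bsub>?L\<^esub> s' \<in> carrier ?L" using a Ls by (auto simp: \<sigma>_def fin_sgps_def is_semigroup_def)
      ultimately show "(s \<cdot>\<^bsub>?L\<^esub> s', t \<cdot>\<^bsub>T\<^esub> t') \<in> \<sigma>" by (simp add: \<sigma>_def local_sgp_def)
    qed
    then show ?thesis
    proof (rule pseudovariety_division[OF V T Ls])
      fix s s' t assume "(s, t) \<in> \<sigma>" "(s', t) \<in> \<sigma>"
      moreover from this have "coterminal S s s'" by (auto simp: \<sigma>_def local_sgp_def coterminal_def)
      ultimately show "s = s'" using \<tau>(2) unfolding \<sigma>_def faithful_rel_def by blast
    qed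
  qed
  then show "S \<in> locally_sgpoids V" using Sf by (simp add: locally_sgpoids_def)
qed

section \<open>Regular edges\<close>

context sgp
begin

text \<open>By the \<open>DS\<close> identity \<open>e\<close> is a power of
  \<open>e \<bullet> f \<bullet> e\<close> with f = (dc)^N, and \<open>f\<close> begins with
  \<open>d\<close> and ends with \<open>c\<close>. So \<open>e\<close> can be recovered after
  multiplication by \<open>d\<close> on the right or by \<open>c\<close> on the left.\<close>

lemma ds_identity_factors:
  assumes N: "idem_exponent S N" and D: "ds_rs_identities S N"
    and cd: "c \<in> carrier S" "d \<in> carrier S" and e: "e = c \<bullet> d" "e \<bullet> e = e"
  shows "\<exists>z\<in>carrier S. e = e \<bullet> (d \<bullet> z)" "\<exists>z\<in>carrier S. e = z \<bullet> (c \<bullet> e)"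
proof -
  have N0: "N > 0" using N by (simp add: idem_exponent_def)
  obtain M where M: "N * 2 = Suc M" "M > 0" using N0 by (intro that[of "2 * N - 1"]) auto
  have two: "spow S x N = x \<bullet> spow S x M" "spow S x N = spow S x M \<bullet> x" if "x \<in> carrier S" for x
    using exponent_multiple(1)[OF N _ that, of 2] spow_Suc[OF that M(2)] spow_Suc2[OF that M(2)]
    unfolding M(1) by simp_all
  define f where "f = spow S (d \<bullet> c) N"
  define g where "g = spow S (d \<bullet> c) M"
  define k where "k = e \<bullet> f \<bullet> e"
  define m where "m = spow S k M"
  have dc: "d \<bullet> c \<in> carrier S" "e \<in> carrier S" using cd e by (simp_all add: mult_closed)
  have cl: "f \<in> carrier S" "g \<in> carrier S" using dc N0 M(2) by (simp_all add: f_def g_def spow_closed)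
  have kc: "k \<in> carrier S" using dc cl by (simp add: k_def mult_closed)
  have mc: "m \<in> carrier S" using kc M(2) by (simp add: m_def spow_closed)
  have f1: "f = d \<bullet> c \<bullet> g" and f2: "f = g \<bullet> (d \<bullet> c)" unfolding f_def g_def by (rule two[OF dc(1)])+
  have "spow S e N = e" using spow_idem[OF dc(2) e(2) N0] .
  then have "spow S k N = e"
    using D[unfolded ds_rs_identities_def, rule_format, OF cd] by (simp add: k_def f_def flip: e(1))
  then have e1: "e = k \<bullet> m" and e2: "e = m \<bullet> k" using two[OF kc] by (simp_all add: m_def)
  have "e = e \<bullet> (d \<bullet> (c \<bullet> g \<bullet> e \<bullet> m))"
    using e1 unfolding k_def f1 using cd dc cl mc by (simp add: mult_assoc mult_closed)
  moreover have "c \<bullet> g \<bullet> e \<bullet> m \<in> carrier S" using cd dc cl mc by (simp add: mult_closed)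
  ultimately show "\<exists>z\<in>carrier S. e = e \<bullet> (d \<bullet> z)" by blast
  have "e = m \<bullet> e \<bullet> g \<bullet> d \<bullet> (c \<bullet> e)"
    using e2 unfolding k_def f2 using cd dc cl mc by (simp add: mult_assoc mult_closed)
  moreover have "m \<bullet> e \<bullet> g \<bullet> d \<in> carrier S" using cd dc cl mc by (simp add: mult_closed)
  ultimately show "\<exists>z\<in>carrier S. e = z \<bullet> (c \<bullet> e)" by blast
qed

text \<open>By the \<open>RS\<close> identity the product x of the two idempotents equals x^(N+1),
  which can also be written as x x^M x.\<close>

lemma rs_identity_regular:
  assumes N: "idem_exponent S N" and D: "ds_rs_identities S N"
    and ef: "e \<in> carrier S" "f \<in> carrier S" "e \<bullet> e = e" "f \<bullet> f = f"
  shows "\<exists>k\<in>carrier S. e \<bullet> f = e \<bullet> f \<bullet> (k \<bullet> (e \<bullet> f))"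
proof -
  have N0: "N > 0" using N by (simp add: idem_exponent_def)
  obtain M where M: "N * 2 = Suc M" "M > 0" using N0 by (intro that[of "2 * N - 1"]) auto
  define x where "x = e \<bullet> f"
  have x: "x \<in> carrier S" using ef by (simp add: x_def mult_closed)
  have "spow S x (Suc N) = x"
    using D[unfolded ds_rs_identities_def, rule_format, OF ef(1,2)] spow_idem[OF ef(1,3) N0] spow_idem[OF ef(2,4) N0]
    by (simp add: x_def)
  then have "x = spow S x (Suc (Suc M))"
    using exponent_multiple(2)[OF N _ x, of 2] unfolding M(1) by simp
  also have "\<dots> = x \<bullet> (spow S x M \<bullet> x)"
    using spow_Suc[OF x, of "Suc M"] spow_Suc2[OF x M(2)] by simp
  finally show ?thesis using spow_closed[OF x M(2)] unfolding x_def by blast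
qed

text \<open>Since g = g^N = x^(N(N+1)) = x^N, multiplying by x gives x^(N+1), which is g
  again.\<close>

lemma idem_power_absorb:
  assumes N: "idem_exponent S N" and x: "x \<in> carrier S" "g \<in> carrier S" "spow S x (Suc N) = g" "g \<bullet> g = g"
  shows "x \<bullet> g = g"
proof -
  have N0: "N > 0" using N by (simp add: idem_exponent_def)
  have "g = spow S (spow S x (Suc N)) N" unfolding x(3) by (rule spow_idem[OF x(2,4) N0, symmetric])
  also have "\<dots> = spow S x (N * Suc N)" using x(1) N0 by (subst spow_mult) (auto simp: mult.commute)
  also have "\<dots> = spow S x N" by (rule exponent_multiple(1)[OF N zero_less_Suc x(1)])
  finally show ?thesis using spow_Suc[OF x(1) N0] x(3) by simp
qed

end

context semigroupoid
begin

definition regular_edge :: "'e \<Rightarrow> bool" where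
  "regular_edge s \<longleftrightarrow> s \<in> E \<and> (\<exists>y\<in>E. tgt s = src y \<and> tgt y = src s \<and> s \<odot> y \<odot> s = s)"

text \<open>The edges \<open>J\<close>-above \<open>s\<close>. Paths with possibly empty
  \<open>u\<close> and \<open>v\<close> replace the adjoining of identities.\<close>

definition factors :: "'e \<Rightarrow> 'e set" where
  "factors s = {a. \<exists>u v. composable S (u @ [a] @ v) \<and> ev (u @ [a] @ v) = s}"

lemma factors_edges: "factors s \<subseteq> E"
  by (auto simp: factors_def composable_simps)

lemma factorsE:
  assumes "a \<in> factors s"
  obtains u v where "composable S (u @ [a] @ v)" "ev (u @ [a] @ v) = s"
  using assms by (auto simp: factors_def)

lemma factors_refl: "s \<in> E \<Longrightarrow> s \<in> factors s"
  by (auto simp: factors_def intro!: exI[of _ "[]"])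

lemma factors_trans:
  assumes "a \<in> factors s" "s \<in> factors t"
  shows "a \<in> factors t"
proof -
  obtain u v where uv: "composable S (u @ [a] @ v)" "ev (u @ [a] @ v) = s" using assms(1) by (rule factorsE)
  obtain x y where xy: "composable S (x @ [s] @ y)" "ev (x @ [s] @ y) = t" using assms(2) by (rule factorsE)
  have "composable S (x @ (u @ [a] @ v) @ y)" "ev (x @ (u @ [a] @ v) @ y) = t"
    using ev_append3[OF xy(1) _ uv(1)] uv(2) xy(2) by auto
  then have "composable S ((x @ u) @ [a] @ (v @ y)) \<and> ev ((x @ u) @ [a] @ (v @ y)) = t" by simp
  then show ?thesis unfolding factors_def by blast
qed

lemma factors_subword:
  assumes c: "composable S (x @ u @ y)" and u: "u \<noteq> []"
  shows "ev u \<in> factors (ev (x @ u @ y))"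
proof -
  have cu: "composable S u" using c by (simp add: composable_append_iff)
  have "composable S (x @ [ev u] @ y)" "ev (x @ [ev u] @ y) = ev (x @ u @ y)"
    using ev_append3[OF c u, of "[ev u]"] ev_edge[OF cu u] by auto
  then show ?thesis unfolding factors_def by blast
qed

lemma factors_letter:
  assumes "composable S w" "a \<in> set w"
  shows "a \<in> factors (ev w)"
proof -
  obtain x y where "w = x @ [a] @ y" using split_list[OF assms(2)] by auto
  then show ?thesis using factors_subword[of x "[a]" y] assms(1) by simp
qed

abbreviation loops where "loops v \<equiv> {s \<in> E. src s = v \<and> tgt s = v}"

lemma regular_comp_idem:
  assumes "s \<in> E" "y \<in> E" "tgt s = src y" "tgt y = src s" "s \<odot> y \<odot> s = s"
  shows "(s \<odot> y) \<odot> (s \<odot> y) = s \<odot> y" "(y \<odot> s) \<odot> (y \<odot> s) = y \<odot> s"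
proof -
  have "(s \<odot> y) \<odot> (s \<odot> y) = (s \<odot> y \<odot> s) \<odot> y"
    using assms(1-4) by (simp add: comp_simps)
  then show "(s \<odot> y) \<odot> (s \<odot> y) = s \<odot> y" using assms(5) by simp
  have "(y \<odot> s) \<odot> (y \<odot> s) = y \<odot> (s \<odot> y \<odot> s)"
    using assms(1-4) by (simp add: comp_simps)
  then show "(y \<odot> s) \<odot> (y \<odot> s) = y \<odot> s" using assms(5) by simp
qed

end

locale local_ds_rs = semigroupoid S for S :: "(nat, nat) sgpoid" +
  fixes N :: nat
  assumes fin: "S \<in> fin_sgpoids"
    and local_exponent: "\<And>v. carrier (local_sgp S v) \<noteq> {} \<Longrightarrow> idem_exponent (local_sgp S v) N"
    and local_identities: "\<And>v. carrier (local_sgp S v) \<noteq> {} \<Longrightarrow> ds_rs_identities (local_sgp S v) N"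
begin

lemma finite_E: "finite E"
  using fin by (simp add: fin_sgpoids_def)

lemma local_simps [simp]: "carrier (local_sgp S v) = loops v" "sop (local_sgp S v) = comp"
  by (simp_all add: local_sgp_def)

lemma local_sgpI: "x \<in> loops v \<Longrightarrow> sgp (local_sgp S v)"
  using local_sgp_fin[OF fin, of v] by (intro sgp.intro) (auto simp: fin_sgps_def)

lemma local_ids:
  assumes "x \<in> loops v"
  shows "idem_exponent (local_sgp S v) N" "ds_rs_identities (local_sgp S v) N"
  using local_exponent[of v] local_identities[of v] assms unfolding local_simps by blast+

text \<open>Let r = u a v have inverse y. The idempotent yr splits into the loops yu and av, and
  \<open>ds_identity_factors\<close> recovers it from its product with av. Hence r = (ra)k for some
  k, and ky is an inverse of ra.\<close>

lemma regular_comp_right: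
  assumes r: "regular_edge r" and a: "a \<in> factors r" "tgt r = src a"
  shows "regular_edge (r \<odot> a)"
proof -
  obtain y where y: "r \<in> E" "y \<in> E" "tgt r = src y" "tgt y = src r" "r \<odot> y \<odot> r = r"
    using r by (auto simp: regular_edge_def)
  obtain u v where uv: "composable S (u @ [a] @ v)" "ev (u @ [a] @ v) = r" using a(1) by (rule factorsE)
  have aE: "a \<in> E" using a(1) factors_edges by blast
  have uv_ends: "src (hd (u @ [a])) = src r" "tgt (last ([a] @ v)) = tgt r"
    using ev_path[OF uv(1)] uv(2) by (auto simp: hd_append)
  have c: "composable S ([y] @ u @ [a] @ v)"
    using uv(1) y uv_ends by (auto simp: composable_simps hd_append split: if_splits)
  define p where "p = ev ([y] @ u)"
  define d where "d = ev ([a] @ v)"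
  have cp: "composable S ([y] @ u)" and cd: "composable S ([a] @ v)"
    using c by (auto simp: composable_simps hd_append)
  have pl: "p \<in> loops (tgt r)"
    using ev_path[OF cp] uv y uv_ends a(2) by (auto simp: p_def composable_simps)
  have dl: "d \<in> loops (tgt r)"
    using ev_path[OF cd] a(2) uv_ends by (simp add: d_def)
  define e where "e = y \<odot> r"
  have el: "e \<in> loops (tgt r)" using y by (simp add: e_def comp_ends)
  have "ev (([y] @ u) @ ([a] @ v)) = p \<odot> d" unfolding p_def d_def by (rule ev_append) (use c in auto)
  moreover have "ev ([y] @ (u @ [a] @ v)) = y \<odot> r" using ev_append[of "[y]" "u @ [a] @ v"] c uv(2) by simp
  ultimately have e_pd: "e = p \<odot> d" by (simp add: e_def)
  interpret L: sgp "local_sgp S (tgt r)" by (rule local_sgpI[OF pl])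
  obtain z where z: "z \<in> loops (tgt r)" "e = e \<odot> (d \<odot> z)"
    using L.ds_identity_factors(1)[OF local_ids[OF pl], of p d e] pl dl e_pd regular_comp_idem(2)[OF y] 
    by (auto simp: e_def)
  have re: "r \<odot> e = r" unfolding e_def using y by (simp add: comp_assoc)
  have cz: "composable S (v @ [z])" "composable S ([a] @ v @ [z])"
    using cd z uv_ends by (auto simp: composable_simps split: if_splits)
  define k where "k = ev (v @ [z])"
  have k: "k \<in> E" "tgt k = tgt r"
    using ev_path[OF cz(1)] z by (auto simp: k_def)
  have ck: "src k = tgt a" using ev_path[OF cz(1)] cz(2) by (auto simp: k_def composable_simps hd_append split: if_splits)
  have "d \<odot> z = a \<odot> k"
    using ev_append[of "[a]" "v @ [z]"] ev_append[of "[a] @ v" "[z]"] cz(2) by (simp add: d_def k_def)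
  then have rk: "r = r \<odot> a \<odot> k"
    using z re el dl y aE k ck a(2) comp_assoc[of r e "d \<odot> z"] comp_assoc[of r a k]
    by (simp add: comp_ends)
  have "r \<odot> a \<odot> (k \<odot> y) \<odot> (r \<odot> a) = (r \<odot> a \<odot> k) \<odot> y \<odot> r \<odot> a"
    using y aE k ck a(2) by (simp add: comp_simps)
  also have "\<dots> = r \<odot> a" unfolding rk[symmetric] y(5) ..
  finally show ?thesis
    using y aE k ck a(2) unfolding regular_edge_def
    by (auto simp: comp_ends intro!: bexI[of _ "k \<odot> y"])
qed

text \<open>The dual argument, with the idempotent ry split into the loops ua and vy at the source
  of r.\<close>

lemma regular_comp_left:
  assumes r: "regular_edge r" and a: "a \<in> factors r" "tgt a = src r"
  shows "regular_edge (a \<odot> r)"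
proof -
  obtain y where y: "r \<in> E" "y \<in> E" "tgt r = src y" "tgt y = src r" "r \<odot> y \<odot> r = r"
    using r by (auto simp: regular_edge_def)
  obtain u v where uv: "composable S (u @ [a] @ v)" "ev (u @ [a] @ v) = r" using a(1) by (rule factorsE)
  have aE: "a \<in> E" using a(1) factors_edges by blast
  have uv_ends: "src (hd (u @ [a])) = src r" "tgt (last ([a] @ v)) = tgt r"
    using ev_path[OF uv(1)] uv(2) by (auto simp: hd_append)
  have c: "composable S ((u @ [a]) @ (v @ [y]))"
    using uv(1) y uv_ends by (auto simp: composable_simps split: if_splits)
  define p where "p = ev (u @ [a])"
  define d where "d = ev (v @ [y])"
  have cp: "composable S (u @ [a])" and cd: "composable S (v @ [y])"
    using c by (auto simp: composable_simps)
  have pl: "p \<in> loops (src r)"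
    using ev_path[OF cp] uv_ends a(2) by (simp add: p_def)
  have dl: "d \<in> loops (src r)"
    using ev_path[OF cd] c y uv_ends a(2) by (auto simp: d_def composable_simps hd_append)
  define e where "e = r \<odot> y"
  have el: "e \<in> loops (src r)" using y by (simp add: e_def comp_ends)
  have "ev ((u @ [a]) @ (v @ [y])) = p \<odot> d" unfolding p_def d_def by (rule ev_append) (use c in auto)
  moreover have "ev ((u @ [a] @ v) @ [y]) = r \<odot> y" using ev_append[of "u @ [a] @ v" "[y]"] c uv(2) by simp
  ultimately have e_pd: "e = p \<odot> d" by (simp add: e_def)
  interpret L: sgp "local_sgp S (src r)" by (rule local_sgpI[OF pl])
  obtain z where z: "z \<in> loops (src r)" "e = z \<odot> (p \<odot> e)"
    using L.ds_identity_factors(2)[OF local_ids[OF pl], of p d e] pl dl e_pd regular_comp_idem(1)[OF y] 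
    by (auto simp: e_def)
  have er: "e \<odot> r = r" unfolding e_def using y by (simp add: comp_assoc)
  have cz: "composable S ([z] @ u)" "composable S (([z] @ u) @ [a])"
    using cp z uv_ends by (auto simp: composable_simps hd_append split: if_splits)
  define k where "k = ev ([z] @ u)"
  have k: "k \<in> E" "src k = src r"
    using ev_path[OF cz(1)] z by (auto simp: k_def)
  have ck: "tgt k = src a" using ev_path[OF cz(1)] cz(2) by (auto simp: k_def composable_simps)
  have "z \<odot> p = k \<odot> a"
    using ev_append[of "[z]" "u @ [a]"] ev_append[of "[z] @ u" "[a]"] cz(2) by (simp add: p_def k_def)
  moreover have "e \<odot> r = z \<odot> p \<odot> (e \<odot> r)"
    using z(1) pl el y by (subst z(2)) (simp add: comp_simps)
  ultimately have rk: "r = k \<odot> (a \<odot> r)"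
    using er comp_assoc[of k a r] y aE k ck a(2) by simp
  have "a \<odot> r \<odot> (y \<odot> k) \<odot> (a \<odot> r) = a \<odot> (r \<odot> y \<odot> (k \<odot> (a \<odot> r)))"
    using y aE k ck a(2) by (simp add: comp_simps)
  also have "\<dots> = a \<odot> r" unfolding rk[symmetric] y(5) ..
  finally show ?thesis
    using y aE k ck a(2) unfolding regular_edge_def
    by (auto simp: comp_ends intro!: bexI[of _ "y \<odot> k"])
qed

text \<open>As r = re and s = fs for idempotents e and f at the common vertex, rs = r(ef)s; an
  inverse of ef comes from the \<open>RS\<close> identity and is conjugated to one of rs.\<close>

lemma regular_comp:
  assumes r: "regular_edge r" and s: "regular_edge s" and c: "tgt r = src s"
  shows "regular_edge (r \<odot> s)"
proof -
  obtain y where y: "r \<in> E" "y \<in> E" "tgt r = src y" "tgt y = src r" "r \<odot> y \<odot> r = r"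
    using r by (auto simp: regular_edge_def)
  obtain z where z: "s \<in> E" "z \<in> E" "tgt s = src z" "tgt z = src s" "s \<odot> z \<odot> s = s"
    using s by (auto simp: regular_edge_def)
  define e where "e = y \<odot> r"
  define f where "f = s \<odot> z"
  have el: "e \<in> loops (tgt r)" using y by (simp add: e_def comp_ends)
  have fl: "f \<in> loops (tgt r)" using z c by (simp add: f_def comp_ends)
  interpret L: sgp "local_sgp S (tgt r)" by (rule local_sgpI[OF el])
  obtain k where k: "k \<in> loops (tgt r)" "e \<odot> f = e \<odot> f \<odot> (k \<odot> (e \<odot> f))"
    using L.rs_identity_regular[OF local_ids[OF el], of e f] el fl
      regular_comp_idem(2)[OF y] regular_comp_idem(1)[OF z] by (auto simp: e_def f_def)
  have re: "r \<odot> e = r" unfolding e_def using y by (simp add: comp_assoc)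
  have fs: "f \<odot> s = s" unfolding f_def using z by (simp add: comp_assoc)
  have "r \<odot> s = (r \<odot> e) \<odot> (f \<odot> s)" unfolding re fs ..
  also have "\<dots> = r \<odot> (e \<odot> f) \<odot> s"
    using y z el fl c by (simp add: comp_simps)
  also have "\<dots> = (r \<odot> e) \<odot> (f \<odot> (k \<odot> (e \<odot> (f \<odot> s))))"
    using y z el fl c k(1) by (subst k(2)) (simp add: comp_simps)
  also have "\<dots> = r \<odot> s \<odot> (z \<odot> k \<odot> y) \<odot> (r \<odot> s)"
    unfolding re fs unfolding e_def f_def
    using y z c k(1) by (simp add: comp_simps)
  finally have "r \<odot> s \<odot> (z \<odot> k \<odot> y) \<odot> (r \<odot> s) = r \<odot> s" ..
  then show ?thesis
    using y z c k(1) unfolding regular_edge_def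
    by (auto simp: comp_ends intro!: bexI[of _ "z \<odot> k \<odot> y"])
qed

text \<open>A path with value \<open>t\<close> is built around \<open>r\<close> letter by letter.
  Each letter is a factor of \<open>t\<close>, hence of \<open>r\<close>, hence of the product
  reached so far, which therefore stays regular.\<close>

lemma regular_J:
  assumes r: "regular_edge r" and rt: "r \<in> factors t" and tr: "t \<in> factors r"
  shows "regular_edge t"
proof -
  obtain u v where uv: "composable S (u @ [r] @ v)" "ev (u @ [r] @ v) = t" using rt by (rule factorsE)
  have letters: "a \<in> factors r" if "a \<in> set u \<union> set v" for a
    using factors_letter[OF uv(1), of a] that factors_trans[OF _ tr] uv(2) by auto
  have cv: "composable S ([r] @ v)" using uv(1) by (simp add: composable_simps)
  have right: "regular_edge (ev ([r] @ v))"
    using cv letters[OF UnI2]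
  proof (induction v rule: rev_induct)
    case (snoc a v)
    have c: "composable S (([r] @ v) @ [a])" using snoc.prems(1) by simp
    then have c: "composable S ([r] @ v)" "composable S (([r] @ v) @ [a])"
      unfolding composable_append_iff[of S "[r] @ v"] by blast+
    have "r \<in> factors (ev ([r] @ v))" using factors_letter[OF c(1)] by simp
    then have "a \<in> factors (ev ([r] @ v))" using factors_trans snoc.prems(2) by auto
    moreover have "tgt (ev ([r] @ v)) = src a" using ev_path[OF c(1)] c(2) by (auto simp: composable_simps)
    ultimately have "regular_edge (ev ([r] @ v) \<odot> a)"
      using snoc c by (intro regular_comp_right) auto
    then show ?case using ev_append[OF c(2)] by simp
  qed (use r in simp)
  have "regular_edge (ev (u @ [r] @ v))"
    using uv(1) letters[OF UnI1]
  proof (induction u)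
    case (Cons a u)
    have c: "composable S (u @ [r] @ v)" "composable S ([a] @ (u @ [r] @ v))"
      using Cons.prems(1) by (auto simp: composable_Cons_iff)
    have "r \<in> factors (ev (u @ [r] @ v))" using factors_letter[OF c(1)] by simp
    then have "a \<in> factors (ev (u @ [r] @ v))" using factors_trans Cons.prems(2) by auto
    moreover have "tgt a = src (ev (u @ [r] @ v))" using ev_path[OF c(1)] c(2) by (auto simp: composable_Cons_iff)
    ultimately have "regular_edge (a \<odot> ev (u @ [r] @ v))"
      using Cons c by (intro regular_comp_left) auto
    then show ?case using ev_append[OF c(2)] by simp
  qed (use right in simp)
  then show ?thesis unfolding uv(2) .
qed

abbreviation lpow where "lpow x n \<equiv> ev (replicate n x)"

lemma spow_local [simp]: "spow (local_sgp S v) x n = lpow x n"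
  by (simp add: spow_def)

text \<open>With inverses y of s and z of t, equality of the powers gives (ty)(sy) = sy and t(ys) =
  t. Hence ty = t(ys)y = sy and t = tys = sys = s.\<close>

lemma regular_eqI:
  assumes s: "regular_edge s" and t: "regular_edge t" and st: "src s = src t" "tgt s = tgt t"
    and eq: "\<And>y. \<lbrakk>y \<in> E; src y = tgt s; tgt y = src s\<rbrakk> \<Longrightarrow>
      lpow (s \<odot> y) (Suc N) = lpow (t \<odot> y) (Suc N) \<and> lpow (y \<odot> s) (Suc N) = lpow (y \<odot> t) (Suc N)"
  shows "s = t"
proof -
  obtain y where y: "s \<in> E" "y \<in> E" "tgt s = src y" "tgt y = src s" "s \<odot> y \<odot> s = s"
    using s by (auto simp: regular_edge_def)
  obtain z where z: "t \<in> E" "z \<in> E" "tgt t = src z" "tgt z = src t" "t \<odot> z \<odot> t = t"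
    using t by (auto simp: regular_edge_def)
  have l: "s \<odot> y \<in> loops (src s)" "t \<odot> y \<in> loops (src s)" "z \<odot> t \<in> loops (tgt s)" "z \<odot> s \<in> loops (tgt s)"
    using y z st by (auto simp: comp_ends)
  interpret L: sgp "local_sgp S (src s)" by (rule local_sgpI[OF l(1)])
  interpret R: sgp "local_sgp S (tgt s)" by (rule local_sgpI[OF l(3)])
  have N0: "N > 0" using local_ids(1)[OF l(1)] by (simp add: idem_exponent_def)
  have "s \<odot> y = lpow (s \<odot> y) (Suc N)"
    using L.spow_idem[of "s \<odot> y" "Suc N"] l(1) regular_comp_idem(1)[OF y] by simp
  then have sy: "lpow (t \<odot> y) (Suc N) = s \<odot> y" using eq[of y] y by simp
  have a: "(t \<odot> y) \<odot> (s \<odot> y) = s \<odot> y"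
    using L.idem_power_absorb[OF local_ids(1)[OF l(1)], of "t \<odot> y" "s \<odot> y"] l sy regular_comp_idem(1)[OF y] by simp
  have "z \<odot> t = lpow (z \<odot> t) (Suc N)"
    using R.spow_idem[of "z \<odot> t" "Suc N"] l(3) regular_comp_idem(2)[OF z] by simp
  then have zt: "z \<odot> t = lpow (z \<odot> s) N \<odot> (z \<odot> s)"
    using eq[of z] z st R.spow_Suc2[of "z \<odot> s" N] l(4) N0 by simp
  define p where "p = lpow (z \<odot> s) N"
  have p: "p \<in> loops (tgt s)" using R.spow_closed[of "z \<odot> s" N] l(4) N0 by (simp add: p_def)
  have t1: "t = t \<odot> (p \<odot> z) \<odot> s"
  proof -
    have "t = t \<odot> (z \<odot> t)" using z by (simp add: comp_assoc)
    also have "\<dots> = t \<odot> (p \<odot> (z \<odot> s))" unfolding zt p_def ..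
    also have "\<dots> = t \<odot> (p \<odot> z) \<odot> s"
      using z y p st by (simp add: comp_simps)
    finally show ?thesis .
  qed
  have t2: "t \<odot> (y \<odot> s) = t"
  proof -
    have "t \<odot> (p \<odot> z) \<odot> s \<odot> (y \<odot> s) = t \<odot> (p \<odot> z) \<odot> (s \<odot> y \<odot> s)"
      using z y p st by (simp add: comp_simps)
    then show ?thesis using t1 y(5) by simp
  qed
  have "(t \<odot> y) \<odot> (s \<odot> y) = (t \<odot> (y \<odot> s)) \<odot> y"
    using z y st by (simp add: comp_simps)
  then have ty: "t \<odot> y = s \<odot> y" using a t2 by simp
  have "t = t \<odot> y \<odot> s" using t2 z y st by (simp add: comp_assoc)
  then show ?thesis using ty y(5) by simp
qed

end

section \<open>Products of languages along a factorization\<close>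

text \<open>A monochromatic triangle for the colouring \<open>f\<close> of pairs. When
  \<open>f\<close> gives the values of segments of a path, the common value is idempotent.\<close>

lemma ramsey_triple:
  assumes "finite X"
  shows "\<exists>B::nat. \<forall>f. (\<forall>i j. i < j \<longrightarrow> j < B \<longrightarrow> f i j \<in> X) \<longrightarrow>
    (\<exists>i j k. i < j \<and> j < k \<and> k < B \<and> f i j = f j k \<and> f i k = f j k)"
proof -
  obtain c where c: "bij_betw c X {0..<card X}" using ex_bij_betw_finite_nat[OF assms] by blast
  obtain B :: nat where B: "partn_lst {..<B} (replicate (card X) 3) 2"
    using ramsey_full[of "replicate (card X) 3" 2] by blast
  show ?thesis
  proof (rule exI[of _ B], intro allI impI)
    fix f :: "nat \<Rightarrow> nat \<Rightarrow> 'a" assume f: "\<forall>i j. i < j \<longrightarrow> j < B \<longrightarrow> f i j \<in> X"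
    define g where "g A = c (f (Min A) (Max A))" for A
    have g: "g {i, j} = c (f i j)" if "i < j" for i j using that by (simp add: g_def)
    have "g \<in> nsets {..<B} 2 \<rightarrow> {..<card X}"
    proof
      fix A assume "A \<in> nsets {..<B} 2"
      then obtain x y where "A = {x, y}" "x < B" "y < B" "x \<noteq> y" by (auto elim!: nsets2_E)
      then obtain i j where "A = {i, j}" "i < j" "j < B" by (metis insert_commute linorder_neqE_nat)
      then show "g A \<in> {..<card X}" using f g c by (auto simp: bij_betw_def)
    qed
    then obtain i H where H: "i < card X" "H \<in> nsets {..<B} 3" "g ` nsets H 2 \<subseteq> {i}"
      by (rule partn_lstE[OF B, of _ "card X"]) auto
    obtain x y z where xyz: "x < y" "y < z" "z < B" "H = {x, y, z}"
      using H(2) unfolding ordered_nsets_3_eq by auto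
    have "g {x, y} = i" "g {y, z} = i" "g {x, z} = i"
      using H(3) xyz by (auto simp: xyz(4) nsets_2_eq)
    then have "c (f x y) = c (f y z)" "c (f x z) = c (f y z)" using xyz g by simp_all
    then have "f x y = f y z" "f x z = f y z"
      using c xyz f by (auto simp: bij_betw_def dest: inj_onD)
    then show "\<exists>i j k. i < j \<and> j < k \<and> k < B \<and> f i j = f j k \<and> f i k = f j k" using xyz by blast
  qed
qed

lemma recognizable_words: "recognizable V A L \<Longrightarrow> L \<subseteq> lists A - {[]}"
  by (simp add: recognizable_def)

text \<open>Each marker is paired with the block after it, so the length of the list counts the
  markers and blocks may be empty.\<close>

fun marked_word :: "'a list \<Rightarrow> ('a \<times> 'a list) list \<Rightarrow> 'a list" where
  "marked_word u [] = u"
| "marked_word u ((a, v) # bs) = u @ [a] @ marked_word v bs"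

lemma marked_word_prepend: "marked_word (u @ v) bs = u @ marked_word v bs"
  by (cases bs) auto

lemma marked_word_append:
  "marked_word u (ms @ bs) = marked_word (u @ concat (map (\<lambda>(a, v). a # v) ms)) bs"
proof (induction ms arbitrary: u)
  case (Cons m ms)
  obtain a v where m: "m = (a, v)" by (cases m)
  have "marked_word u ((m # ms) @ bs) = u @ [a] @ marked_word (v @ concat (map (\<lambda>(a, v). a # v) ms)) bs"
    using Cons by (simp add: m)
  also have "\<dots> = marked_word (u @ concat (map (\<lambda>(a, v). a # v) (m # ms))) bs"
    by (simp add: m flip: marked_word_prepend)
  finally show ?case .
qed simp

lemma last_marker_unique:
  assumes "a \<notin> set k" "a \<notin> set k'" "y @ [a] @ k = x @ [a] @ k'"
  shows "k = k' \<and> y = x"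
proof -
  from assms(3) have "rev k @ [a] @ rev y = rev k' @ [a] @ rev x"
    by (metis append.assoc rev_append rev_singleton_conv)
  moreover have "takeWhile (\<lambda>b. b \<noteq> a) (rev z @ [a] @ q) = rev z" if "a \<notin> set z" for z q
    using that by (subst takeWhile_append2) auto
  ultimately have "rev k = rev k'" using assms(1,2) by metis
  then show ?thesis using assms(3) by simp
qed

text \<open>\<open>None\<close> is the type of an empty block, since no edge is the value of the
  empty word; any other block is described by its value.\<close>

definition opt_lang :: "('a \<Rightarrow> 'a list set) \<Rightarrow> 'a option \<Rightarrow> 'a list set" where
  "opt_lang L r = (case r of None \<Rightarrow> {[]} | Some s \<Rightarrow> L s)"

definition opt_word :: "'a option \<Rightarrow> 'a list" where
  "opt_word r = (case r of None \<Rightarrow> [] | Some s \<Rightarrow> [s])"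

definition opt_content :: "('a \<Rightarrow> 'a set) \<Rightarrow> 'a option \<Rightarrow> 'a set" where
  "opt_content C r = (case r of None \<Rightarrow> {} | Some s \<Rightarrow> C s)"

fun marked_lang :: "('a \<Rightarrow> 'a list set) \<Rightarrow> 'a option \<Rightarrow> ('a \<times> 'a option) list \<Rightarrow> 'a list set" where
  "marked_lang L r [] = opt_lang L r"
| "marked_lang L r ((a, r') # \<tau>) = {u @ [a] @ v | u v. u \<in> opt_lang L r \<and> v \<in> marked_lang L r' \<tau>}"

text \<open>A representative word of the type: each nonempty block is a single edge. It serves as
  reference for the value that a type determines.\<close>

fun marked_type :: "'a option \<Rightarrow> ('a \<times> 'a option) list \<Rightarrow> 'a list" where
  "marked_type r [] = opt_word r"
| "marked_type r ((a, r') # \<tau>) = opt_word r @ [a] @ marked_type r' \<tau>"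

text \<open>A marker outside the contents of both neighbouring blocks makes the product bideterministic.\<close>

fun valid_type :: "'a set \<Rightarrow> ('a \<Rightarrow> 'a set) \<Rightarrow> 'a set \<Rightarrow> 'a option \<Rightarrow> ('a \<times> 'a option) list \<Rightarrow> bool" where
  "valid_type A C R r [] \<longleftrightarrow> set_option r \<subseteq> R"
| "valid_type A C R r ((a, r') # \<tau>) \<longleftrightarrow> set_option r \<subseteq> R \<and> a \<in> A \<and>
     a \<notin> opt_content C r \<and> a \<notin> opt_content C r' \<and> valid_type A C R r' \<tau>"

lemma opt_lang_content:
  assumes "\<And>r w. r \<in> R \<Longrightarrow> w \<in> L r \<Longrightarrow> set w \<subseteq> C r" "set_option r \<subseteq> R" "w \<in> opt_lang L r"
  shows "set w \<subseteq> opt_content C r"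
  using assms by (cases r) (auto simp: opt_lang_def opt_content_def)

text \<open>Markers are located from the right: once the later ones are known, a marker is the last
  occurrence of its letter in the remaining prefix. The contexts \<open>x\<close> and
  \<open>y\<close> are arbitrary because the induction counts everything before the next marker as
  context.\<close>

lemma marked_lang_suffix:
  assumes L: "\<And>r w. r \<in> R \<Longrightarrow> w \<in> L r \<Longrightarrow> set w \<subseteq> C r"
    and v: "valid_type A C R r \<tau>" "a \<notin> opt_content C r"
    and k: "k \<in> marked_lang L r \<tau>" "k' \<in> marked_lang L r \<tau>" "y @ [a] @ k = x @ [a] @ k'"
  shows "k = k' \<and> y = x"
  using v k
proof (induction \<tau> arbitrary: r a k k' x y)
  case Nil
  have "set k \<subseteq> opt_content C r" "set k' \<subseteq> opt_content C r"
    using opt_lang_content[of R L C r, OF L] Nil by auto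
  then have "a \<notin> set k" "a \<notin> set k'" using Nil(2) by blast+
  then show ?case using last_marker_unique[OF _ _ Nil(5)] by blast
next
  case (Cons b \<tau>)
  obtain c r' where b: "b = (c, r')" by (cases b)
  obtain u m where um: "k = u @ [c] @ m" "u \<in> opt_lang L r" "m \<in> marked_lang L r' \<tau>"
    using Cons.prems by (auto simp: b)
  obtain u' m' where um': "k' = u' @ [c] @ m'" "u' \<in> opt_lang L r" "m' \<in> marked_lang L r' \<tau>"
    using Cons.prems by (auto simp: b)
  have "(y @ [a] @ u) @ [c] @ m = (x @ [a] @ u') @ [c] @ m'" using Cons.prems um um' by simp
  then have 1: "m = m'" "y @ [a] @ u = x @ [a] @ u'"
    using Cons.IH[of r' c m m' "y @ [a] @ u" "x @ [a] @ u'"] um(3) um'(3) Cons.prems(1) by (simp_all add: b)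
  have "a \<notin> set u" "a \<notin> set u'"
    using opt_lang_content[of R L C r, OF L] um(2) um'(2) Cons.prems by (auto simp: b)
  then show ?case using last_marker_unique[OF _ _ 1(2)] um um' 1 by simp
qed

text \<open>Products are nested to the right, so the left factor is a single block and the prefix
  condition only needs the marker outside its content; the suffix condition is
  \<open>marked_lang_suffix\<close>. The exceptional \<open>{[]}\<close> comes with the empty type,
  which a caller can exclude.\<close>

lemma marked_lang_recognizable:
  assumes V: "closed_under_bideterministic_product V" and A: "finite (A :: nat set)"
    and rec: "\<And>r. r \<in> R \<Longrightarrow> recognizable V A (L r)"
    and L: "\<And>r w. r \<in> R \<Longrightarrow> w \<in> L r \<Longrightarrow> set w \<subseteq> C r"
    and v: "valid_type A C R r \<tau>"
  shows "recognizable V A (marked_lang L r \<tau>) \<or> marked_lang L r \<tau> = {[]} \<and> r = None \<and> \<tau> = []"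
  using v
proof (induction \<tau> arbitrary: r)
  case Nil
  then show ?case using rec by (cases r) (auto simp: opt_lang_def)
next
  case (Cons b \<tau>)
  obtain a r' where b: "b = (a, r')" by (cases b)
  let ?L = "opt_lang L r" and ?K = "marked_lang L r' \<tau>"
  have v: "set_option r \<subseteq> R" "a \<in> A" "a \<notin> opt_content C r" "a \<notin> opt_content C r'" "valid_type A C R r' \<tau>"
    using Cons.prems by (auto simp: b)
  have 1: "recognizable V A ?L \<or> ?L = {[]}" using v(1) rec by (cases r) (auto simp: opt_lang_def)
  have 2: "recognizable V A ?K \<or> ?K = {[]}" using Cons.IH[OF v(5)] by blast
  have LA: "?L \<subseteq> lists A" "?K \<subseteq> lists A" using 1 2 recognizable_words by fastforce+
  have pre: "prefix_code A {u @ [a] | u. u \<in> ?L}"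
    unfolding prefix_code_def
  proof (intro conjI ballI equals0I)
    have "u @ [a] \<in> lists A" if "u \<in> ?L" for u using subsetD[OF LA(1) that] v(2) by simp
    then show "{u @ [a] | u. u \<in> ?L} \<subseteq> lists A" by blast
    fix u x assume u: "u \<in> {u @ [a] | u. u \<in> ?L}"
      and x: "x \<in> {u @ w |w. w \<in> lists A - {[]}} \<inter> {u @ [a] | u. u \<in> ?L}"
    obtain u1 where u1: "u = u1 @ [a]" "u1 \<in> ?L" using u by blast
    obtain w where w: "x = u @ w" "w \<noteq> []" using x by blast
    obtain u2 where u2: "x = u2 @ [a]" "u2 \<in> ?L" using x by blast
    have "a \<in> set u2" using u1(1) w u2(1) by (cases w rule: rev_cases) auto
    then show False using opt_lang_content[of R L C r, OF L v(1) u2(2)] v(3) by blast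
  qed
  have suf: "suffix_code A {[a] @ v | v. v \<in> ?K}"
    unfolding suffix_code_def
  proof (intro conjI ballI equals0I)
    have "[a] @ u \<in> lists A" if "u \<in> ?K" for u using subsetD[OF LA(2) that] v(2) by simp
    then show "{[a] @ v | v. v \<in> ?K} \<subseteq> lists A" by blast
    fix u x assume u: "u \<in> {[a] @ v | v. v \<in> ?K}"
      and x: "x \<in> {w @ u |w. w \<in> lists A - {[]}} \<inter> {[a] @ v | v. v \<in> ?K}"
    obtain k where k: "u = [a] @ k" "k \<in> ?K" using u by blast
    obtain w where w: "x = w @ u" "w \<noteq> []" using x by blast
    obtain k' where k': "x = [a] @ k'" "k' \<in> ?K" using x by blast
    have "w @ [a] @ k = [] @ [a] @ k'" using k(1) w k'(1) by simp
    then show False using marked_lang_suffix[of R L C, OF L v(5,4) k(2) k'(2)] w(2) by blast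
  qed
  have "recognizable V A {u @ [a] @ v | u v. u \<in> ?L \<and> v \<in> ?K}"
    by (rule V[unfolded closed_under_bideterministic_product_def, rule_format, OF A v(2) 1 2 pre suf])
  then show ?case by (simp add: b)
qed

section \<open>Boolean operations\<close>

lemma saturates_sym:
  assumes "saturates A \<phi> L" "x \<in> lists A" "y \<in> lists A" "u \<in> lists A - {[]}" "v \<in> lists A - {[]}" "\<phi> u = \<phi> v"
  shows "x @ u @ y \<in> L \<longleftrightarrow> x @ v @ y \<in> L"
  using assms(1)[unfolded saturates_def, rule_format, OF assms(2-6)]
    assms(1)[unfolded saturates_def, rule_format, OF assms(2,3,5,4) assms(6)[symmetric]] by blast

text \<open>Handles all finite Boolean combinations at once: membership in \<open>M\<close> is
  determined by membership in the languages of \<open>\<L>\<close>, and one homomorphism saturates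
  all of these.\<close>

lemma recognizable_combination:
  assumes V: "sgp_pseudovariety V" and fin: "finite \<L>" and rec: "\<And>L. L \<in> \<L> \<Longrightarrow> recognizable V A L"
    and M: "M \<subseteq> lists A - {[]}"
    and comb: "\<And>u v. \<lbrakk>u \<in> lists A - {[]}; v \<in> lists A - {[]}; \<forall>L\<in>\<L>. u \<in> L \<longleftrightarrow> v \<in> L; u \<in> M\<rbrakk> \<Longrightarrow> v \<in> M"
  shows "recognizable V A M"
proof -
  obtain S \<phi> where S: "S \<in> V" "\<phi> \<in> sgp_hom (free_sgp A) S" "\<forall>L\<in>\<L>. saturates A \<phi> L"
    using saturates_common[OF V, of \<L> A] rec fin by blast
  have "v \<in> M" if uv: "u \<in> lists A - {[]}" "v \<in> lists A - {[]}" "\<phi> u = \<phi> v" "u \<in> M" for u v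
  proof (rule comb[OF uv(1,2) _ uv(4)])
    show "\<forall>L\<in>\<L>. u \<in> L \<longleftrightarrow> v \<in> L"
      using S(3) saturates_sym[OF _ lists.Nil lists.Nil uv(1,2,3)] by simp
  qed
  then show ?thesis unfolding recognizable_iff using S(1,2) M by blast
qed

text \<open>The two-element semilattice recognizes whether a word stays inside \<open>C\<close>;
  this is where \<open>Sl\<close> enters.\<close>

lemma content_recognizable:
  assumes "Sl \<subseteq> V"
  shows "recognizable V A {w \<in> lists A - {[]}. set w \<subseteq> C}"
proof -
  define S :: "nat sgp" where "S = \<lparr>carrier = {0, 1}, sop = (*)\<rparr>"
  define \<phi> where "\<phi> w = (if set w \<subseteq> C then 1 else 0 :: nat)" for w
  have "S \<in> Sl" by (auto simp: Sl_def fin_sgps_def is_semigroup_def S_def)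
  moreover have "\<phi> \<in> sgp_hom (free_sgp A) S" by (auto simp: sgp_hom_def free_sgp_def S_def \<phi>_def)
  moreover have "v \<in> {w \<in> lists A - {[]}. set w \<subseteq> C}" if "v \<in> lists A - {[]}" "\<phi> u = \<phi> v"
    "u \<in> {w \<in> lists A - {[]}. set w \<subseteq> C}" for u v
    using that by (auto simp: \<phi>_def split: if_splits)
  ultimately show ?thesis unfolding recognizable_iff using assms by blast
qed

section \<open>Lifting a cover to the bideterministic closure\<close>

text \<open>Here \<open>V\<close> is the class that recognizes languages; it will be instantiated by
  the bideterministic closure, while \<open>T\<close> will come from the smaller original
  pseudovariety.\<close>

locale bidet_cover = local_ds_rs S N for S N +
  fixes V :: "nat sgp set" and T :: "nat sgp" and \<tau> :: "(nat \<times> nat) set"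
  assumes V: "sgp_pseudovariety V" and closed: "closed_under_bideterministic_product V" and Sl: "Sl \<subseteq> V"
    and T: "T \<in> V" and \<tau>: "sgpoid_rel S T \<tau>"
    and power_inj: "\<And>v s s' t. \<lbrakk>s \<in> loops v; s' \<in> loops v; (s, t) \<in> \<tau>; (s', t) \<in> \<tau>\<rbrakk> \<Longrightarrow>
      lpow s (Suc N) = lpow s' (Suc N)"
begin

text \<open>Words that are not paths, or have other ends than \<open>s\<close>, are constrained in
  content only. The content condition is what lets a letter outside \<open>factors s\<close> act as
  a marker next to such a block.\<close>

definition captures :: "nat \<Rightarrow> nat list set \<Rightarrow> bool" where
  "captures s L \<longleftrightarrow> recognizable V E L \<and> (\<forall>w\<in>L. set w \<subseteq> factors s) \<and>
     (\<forall>w. composable S w \<longrightarrow> w \<noteq> [] \<longrightarrow> ev w = s \<longrightarrow> w \<in> L) \<and>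
     (\<forall>w\<in>L. composable S w \<longrightarrow> src (hd w) = src s \<longrightarrow> tgt (last w) = tgt s \<longrightarrow> ev w = s)"

lemma captures_rec: "captures s L \<Longrightarrow> recognizable V E L"
  and captures_content: "captures s L \<Longrightarrow> w \<in> L \<Longrightarrow> set w \<subseteq> factors s"
  by (auto simp: captures_def)

lemma captures_complete: "\<lbrakk>captures (ev w) L; composable S w; w \<noteq> []\<rbrakk> \<Longrightarrow> w \<in> L"
  unfolding captures_def by blast

lemma captures_sound:
  "\<lbrakk>captures s L; w \<in> L; composable S w; src (hd w) = src s; tgt (last w) = tgt s\<rbrakk> \<Longrightarrow> ev w = s"
  unfolding captures_def by blast

section \<open>Blocks and the values of factorized paths\<close>

definition block :: "nat list \<Rightarrow> bool" where
  "block u \<longleftrightarrow> u = [] \<or> composable S u \<and> regular_edge (ev u)"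

definition evo :: "nat list \<Rightarrow> nat option" where
  "evo w = (if w = [] then None else Some (ev w))"

definition path_between :: "nat \<Rightarrow> nat list \<Rightarrow> nat \<Rightarrow> bool" where
  "path_between v w z \<longleftrightarrow> composable S w \<and>
     (if w = [] then v = z else src (hd w) = v \<and> tgt (last w) = z)"

lemma path_between_marked:
  "path_between v (u @ [a] @ w) z \<longleftrightarrow> path_between v u (src a) \<and> a \<in> E \<and> path_between (tgt a) w z"
  by (cases "u = []"; cases "w = []")
     (auto simp: path_between_def composable_simps hd_append)

lemma evo_marked_cong:
  assumes p: "path_between v (u @ [a] @ w) z" "path_between v (u' @ [a] @ w') z"
    and eq: "evo u = evo u'" "evo w = evo w'"
  shows "evo (u @ [a] @ w) = evo (u' @ [a] @ w')"
proof -
  have c: "composable S (u @ [a] @ w)" "composable S (u' @ [a] @ w')" using p by (auto simp: path_between_def)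
  then have c2: "composable S ([a] @ w)" "composable S ([a] @ w')" by (simp_all add: composable_simps)
  have 1: "ev ([a] @ w) = ev ([a] @ w')"
    using eq(2) c2 by (cases "w = []"; cases "w' = []") (auto simp: evo_def wprod_Cons)
  have "ev (u @ ([a] @ w)) = ev (u' @ ([a] @ w'))"
  proof (cases "u = []")
    case True
    then have "u' = []" using eq(1) by (auto simp: evo_def split: if_splits)
    then show ?thesis using True 1 by simp
  next
    case False
    then have "u' \<noteq> []" "ev u = ev u'" using eq(1) by (auto simp: evo_def split: if_splits)
    then show ?thesis using False 1 ev_append[OF c(1)] ev_append[OF c(2)] by simp
  qed
  then show ?thesis by (simp add: evo_def)
qed

lemma opt_lang_value:
  assumes L: "\<And>r. r \<in> R \<Longrightarrow> captures r (L r)" and r: "set_option r \<subseteq> R" and u: "u \<in> opt_lang L r"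
    and p: "path_between v u z" "path_between v (opt_word r) z"
  shows "evo u = evo (opt_word r)"
proof (cases r)
  case None
  then show ?thesis using u by (simp add: opt_lang_def opt_word_def)
next
  case (Some s)
  have c: "captures s (L s)" using L r Some by simp
  have uL: "u \<in> L s" using u Some by (simp add: opt_lang_def)
  then have "u \<noteq> []" using recognizable_words[OF captures_rec[OF c]] by blast
  then have "ev u = s"
    using captures_sound[OF c uL] p Some by (simp add: path_between_def opt_word_def)
  then show ?thesis using \<open>u \<noteq> []\<close> Some by (simp add: evo_def opt_word_def)
qed

text \<open>The markers fix the ends of the blocks between them, so soundness of the captured
  languages applies to every block, and blocks can be replaced by their values one by one.\<close>

lemma marked_lang_value:
  assumes L: "\<And>r. r \<in> R \<Longrightarrow> captures r (L r)" and v: "valid_type E C R r ts"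
    and w: "w \<in> marked_lang L r ts" and p: "path_between v w z" "path_between v (marked_type r ts) z"
  shows "evo w = evo (marked_type r ts)"
  using v w p
proof (induction ts arbitrary: r v w)
  case Nil
  then show ?case using opt_lang_value[OF L, of R] by simp
next
  case (Cons b ts)
  obtain a r' where b: "b = (a, r')" by (cases b)
  obtain u m where um: "w = u @ [a] @ m" "u \<in> opt_lang L r" "m \<in> marked_lang L r' ts"
    using Cons.prems(2) by (auto simp: b)
  have p1: "path_between v (u @ [a] @ m) z" "path_between v (opt_word r @ [a] @ marked_type r' ts) z"
    using Cons.prems(3,4) um(1) by (simp_all add: b)
  then have p2: "path_between v u (src a)" "path_between (tgt a) m z"
    "path_between v (opt_word r) (src a)" "path_between (tgt a) (marked_type r' ts) z"
    unfolding path_between_marked by blast+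
  have "evo m = evo (marked_type r' ts)" using Cons.IH[OF _ um(3) p2(2,4)] Cons.prems(1) by (simp add: b)
  moreover have "evo u = evo (opt_word r)"
    by (rule opt_lang_value[OF L _ um(2) p2(1,3)]) (use Cons.prems(1) in \<open>auto simp: b\<close>)
  ultimately show ?case using evo_marked_cong[OF p1] um(1) by (simp add: b)
qed

section \<open>Factorizations with the fewest markers\<close>

definition minimal_fact :: "nat list \<Rightarrow> (nat \<times> nat list) list \<Rightarrow> bool" where
  "minimal_fact u bs \<longleftrightarrow> block u \<and> (\<forall>v\<in>snd ` set bs. block v) \<and>
     (\<forall>u' bs'. block u' \<longrightarrow> (\<forall>v\<in>snd ` set bs'. block v) \<longrightarrow> marked_word u' bs' = marked_word u bs \<longrightarrow>
        length bs \<le> length bs')"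

lemma minimal_fact_tl:
  assumes "minimal_fact u ((a, v) # bs)"
  shows "minimal_fact v bs"
  unfolding minimal_fact_def
proof (intro conjI allI impI)
  show "block v" "\<forall>v\<in>snd ` set bs. block v" using assms by (auto simp: minimal_fact_def)
  fix u' bs' assume h: "block u'" "\<forall>v\<in>snd ` set bs'. block v" "marked_word u' bs' = marked_word v bs"
  have "block u" using assms by (simp add: minimal_fact_def)
  then have "length ((a, v) # bs) \<le> length ((a, u') # bs')"
    using assms[unfolded minimal_fact_def, THEN conjunct2, THEN conjunct2, rule_format, of u "(a, u') # bs'"] h
    by auto
  then show "length bs \<le> length bs'" by simp
qed

text \<open>Otherwise the markers of \<open>ms\<close> could be absorbed into the initial block,
  giving a factorization of the same word with fewer markers.\<close>

lemma minimal_fact_merge: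
  assumes "minimal_fact u (ms @ bs)" "ms \<noteq> []"
  shows "\<not> block (u @ concat (map (\<lambda>(a, v). a # v) ms))"
proof
  assume "block (u @ concat (map (\<lambda>(a, v). a # v) ms))"
  moreover have "\<forall>v\<in>snd ` set bs. block v" using assms by (auto simp: minimal_fact_def)
  ultimately have "length (ms @ bs) \<le> length bs"
    using assms(1) marked_word_append[of u ms bs] unfolding minimal_fact_def by metis
  then show False using assms(2) by simp
qed

lemma minimal_fact_drop:
  assumes "minimal_fact u bs" "composable S (marked_word u bs)" "i \<le> length bs"
  shows "\<exists>v. minimal_fact v (drop i bs) \<and> composable S (marked_word v (drop i bs))"
  using assms
proof (induction i arbitrary: u bs)
  case (Suc i)
  then obtain a v bs' where b: "bs = (a, v) # bs'" by (cases bs) auto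
  have "composable S (marked_word v bs')"
    using Suc.prems(2) by (auto simp: b composable_simps)
  then show ?case using Suc.IH[OF minimal_fact_tl[OF Suc.prems(1)[unfolded b]]] Suc.prems(3) by (simp add: b)
qed auto

lemma block_append:
  assumes "block u" "composable S (u @ v)" "v \<noteq> []" "regular_edge (ev v)"
  shows "block (u @ v)"
proof (cases "u = []")
  case True
  then show ?thesis using assms by (simp add: block_def)
next
  case False
  have c: "composable S u" "composable S v" "tgt (last u) = src (hd v)"
    using assms(2,3) False by (auto simp: composable_append_iff)
  have "regular_edge (ev u \<odot> ev v)"
    using assms(1,4) False ev_path[OF c(1) False] ev_path[OF c(2) assms(3)] c(3)
    by (intro regular_comp) (auto simp: block_def)
  then show ?thesis using ev_append[OF assms(2) False assms(3)] assms(2) by (simp add: block_def)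
qed

definition type_of :: "(nat \<times> nat list) list \<Rightarrow> (nat \<times> nat option) list" where
  "type_of bs = map (\<lambda>(a, v). (a, evo v)) bs"

text \<open>A marker that is a factor of the value of a neighbouring block could be absorbed into it
  without losing regularity; then the two blocks would merge, as products of regular edges are
  regular.\<close>

lemma minimal_fact_markers:
  assumes m: "minimal_fact u ((a, v) # bs)" and c: "composable S (marked_word u ((a, v) # bs))"
  shows "a \<notin> opt_content factors (evo u)" "a \<notin> opt_content factors (evo v)"
proof -
  have bl: "block u" "block v" using m by (auto simp: minimal_fact_def)
  have nb: "\<not> block (u @ a # v)" using minimal_fact_merge[of u "[(a, v)]" bs] m by simp
  have c1: "composable S (u @ [a] @ v)"
  proof -
    have eq: "marked_word u ((a, v) # bs) = (u @ [a] @ v) @ marked_word [] bs"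
      using marked_word_prepend[of v "[]" bs] by simp
    show ?thesis using c unfolding eq composable_append_iff[of S "u @ [a] @ v"] by blast
  qed
  show "a \<notin> opt_content factors (evo u)"
  proof
    assume "a \<in> opt_content factors (evo u)"
    then have u: "u \<noteq> []" "a \<in> factors (ev u)" by (auto simp: evo_def opt_content_def split: if_splits)
    have cu: "composable S u" "composable S (u @ [a])" "tgt (last u) = src a"
      using c1 u(1) by (auto simp: composable_simps)
    have "regular_edge (ev u \<odot> a)"
      using bl(1) u ev_path[OF cu(1) u(1)] cu(3) by (intro regular_comp_right) (auto simp: block_def)
    then have b: "block (u @ [a])" using ev_append[OF cu(2) u(1)] cu(2) by (simp add: block_def)
    have "block ((u @ [a]) @ v)"
    proof (cases "v = []")
      case False
      then show ?thesis using block_append[OF b] c1 bl(2) by (simp add: block_def)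
    qed (use b in simp)
    then show False using nb by simp
  qed
  show "a \<notin> opt_content factors (evo v)"
  proof
    assume "a \<in> opt_content factors (evo v)"
    then have v: "v \<noteq> []" "a \<in> factors (ev v)" by (auto simp: evo_def opt_content_def split: if_splits)
    have cv: "composable S v" "composable S ([a] @ v)" "tgt a = src (hd v)"
      using c1 v(1) by (auto simp: composable_simps)
    have "regular_edge (a \<odot> ev v)"
      using bl(2) v ev_path[OF cv(1) v(1)] cv(3) by (intro regular_comp_left) (auto simp: block_def)
    then have "regular_edge (ev ([a] @ v))" using ev_append[OF cv(2)] v(1) by simp
    then have "block (u @ ([a] @ v))" using block_append[OF bl(1)] c1 by simp
    then show False using nb by simp
  qed
qed

lemma minimal_fact_type:
  assumes m: "minimal_fact u bs" and c: "composable S (marked_word u bs)"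
    and R: "\<And>x v y. \<lbrakk>marked_word u bs = x @ v @ y; v \<noteq> []; regular_edge (ev v)\<rbrakk> \<Longrightarrow> ev v \<in> R"
    and L: "\<And>r. r \<in> R \<Longrightarrow> captures r (L r)"
  shows "valid_type E factors R (evo u) (type_of bs) \<and>
    marked_word u bs \<in> marked_lang L (evo u) (type_of bs)"
  using m c R
proof (induction bs arbitrary: u)
  case Nil
  have bu: "block u" "composable S u" using Nil.prems by (auto simp: minimal_fact_def)
  have R: "u \<noteq> [] \<Longrightarrow> ev u \<in> R" using Nil.prems(3)[of "[]" u "[]"] bu by (auto simp: block_def)
  have "u \<in> opt_lang L (evo u)"
    using captures_complete[OF L bu(2)] R by (auto simp: evo_def opt_lang_def)
  then show ?case using R by (simp add: type_of_def evo_def)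
next
  case (Cons b bs)
  obtain a v where b: "b = (a, v)" by (cases b)
  have c: "composable S (u @ [a] @ marked_word v bs)" using Cons.prems(2) by (simp add: b)
  then have cv: "composable S u" "composable S (marked_word v bs)" "a \<in> E"
    by (auto simp: composable_simps)
  have bu: "block u" using Cons.prems(1) by (auto simp: minimal_fact_def)
  have R: "u \<noteq> [] \<Longrightarrow> ev u \<in> R"
    using Cons.prems(3)[of "[]" u "[a] @ marked_word v bs"] bu by (auto simp: block_def b)
  have Rv: "ev v' \<in> R" if "marked_word v bs = x @ v' @ y" "v' \<noteq> []" "regular_edge (ev v')" for x v' y
    using Cons.prems(3)[of "u @ [a] @ x" v' y] that by (simp add: b)
  have IH: "valid_type E factors R (evo v) (type_of bs) \<and> marked_word v bs \<in> marked_lang L (evo v) (type_of bs)"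
    by (rule Cons.IH[OF minimal_fact_tl[OF Cons.prems(1)[unfolded b]] cv(2)]) (rule Rv)
  note mk = minimal_fact_markers[OF Cons.prems(1,2)[unfolded b]]
  have "u \<in> opt_lang L (evo u)"
    using captures_complete[OF L cv(1)] R by (auto simp: evo_def opt_lang_def)
  then have "marked_word u (b # bs) \<in> marked_lang L (evo u) (type_of (b # bs))"
    using IH by (auto simp: b type_of_def)
  moreover have "set_option (evo u) \<subseteq> R" using R by (simp add: evo_def)
  ultimately show ?case using IH mk cv(3) by (simp add: b type_of_def)
qed

lemma path_between_type:
  assumes "path_between v (marked_word u bs) z"
  shows "path_between v (marked_type (evo u) (type_of bs)) z"
proof -
  have base: "path_between v (opt_word (evo u)) z" if "path_between v u z" for v u z
    using that ev_path[of u] by (auto simp: path_between_def evo_def opt_word_def)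
  show ?thesis using assms
  proof (induction bs arbitrary: u v)
    case Nil
    then show ?case using base by (simp add: type_of_def)
  next
    case (Cons b bs)
    obtain a x where b: "b = (a, x)" by (cases b)
    have "path_between v u (src a)" "a \<in> E" "path_between (tgt a) (marked_word x bs) z"
      using Cons.prems unfolding b marked_word.simps path_between_marked by blast+
    then show ?case
      using base Cons.IH unfolding b type_of_def by (simp add: path_between_marked del: append_Cons append.simps)
  qed
qed

lemma exists_minimal_fact:
  assumes "composable S w"
  shows "\<exists>u bs. minimal_fact u bs \<and> marked_word u bs = w"
proof -
  define P where "P n \<longleftrightarrow> (\<exists>u bs. block u \<and> (\<forall>v\<in>snd ` set bs. block v) \<and> marked_word u bs = w \<and> length bs = n)" for n
  \<comment> \<open>Making every letter a marker with empty blocks shows that some factorization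
    exists.\<close>
  have "marked_word [] (map (\<lambda>a. (a, [])) w) = w" by (induction w) auto
  moreover have "\<forall>v\<in>snd ` set (map (\<lambda>a. (a, [])) w). block v" "block []" by (auto simp: block_def)
  ultimately have "P (length w)" unfolding P_def by (metis length_map)
  then have L: "P (LEAST n. P n)" by (rule LeastI)
  then obtain u bs where ub: "block u" "\<forall>v\<in>snd ` set bs. block v" "marked_word u bs = w" "length bs = (LEAST n. P n)"
    unfolding P_def by blast
  have "minimal_fact u bs"
    unfolding minimal_fact_def
  proof (intro conjI allI impI ub(1,2))
    fix u' bs' assume "block u'" "\<forall>v\<in>snd ` set bs'. block v" "marked_word u' bs' = marked_word u bs"
    then have "P (length bs')" using ub(3) unfolding P_def by metis
    then show "length bs \<le> length bs'" unfolding ub(4) by (rule Least_le)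
  qed
  then show ?thesis using ub(3) by blast
qed

text \<open>In a long factorization two adjacent segments and their product share a value e, so e =
  ee is regular; the segments then merge with the block before them, against minimality.\<close>

lemma minimal_fact_bound:
  "\<exists>B. \<forall>u bs. minimal_fact u bs \<longrightarrow> composable S (marked_word u bs) \<longrightarrow> length bs < B"
proof -
  obtain B :: nat where B: "\<forall>f. (\<forall>i j. i < j \<longrightarrow> j < B \<longrightarrow> f i j \<in> E) \<longrightarrow>
    (\<exists>i j k. i < j \<and> j < k \<and> k < B \<and> f i j = f j k \<and> f i k = f j k)"
    using ramsey_triple[OF finite_E] by blast
  have "length bs < B" if m: "minimal_fact u bs" and c: "composable S (marked_word u bs)" for u bs
  proof (rule ccontr)
    assume "\<not> length bs < B"
    then have len: "B \<le> length bs" by simp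
    \<comment> \<open>The path from the marker with index \<open>i\<close> up to just before the
      marker with index \<open>j\<close>.\<close>
    define seg where "seg i j = concat (map (\<lambda>(a, v). a # v) (take (j - i) (drop i bs)))" for i j
    have seg: "seg i j @ seg j k = seg i k" if "i \<le> j" "j \<le> k" for i j k
    proof -
      have "take (k - i) (drop i bs) = take (j - i) (drop i bs) @ take (k - j) (drop j bs)"
        using that take_add[of "j - i" "k - j" "drop i bs"] by simp
      then show ?thesis by (simp add: seg_def)
    qed
    have ne: "seg i j \<noteq> []" if ij: "i < j" "j < B" for i j
    proof -
      have "take (j - i) (drop i bs) \<noteq> []" using ij len by simp
      then show ?thesis unfolding seg_def by (cases "take (j - i) (drop i bs)") auto
    qed
    have pre: "\<exists>v. minimal_fact v (drop i bs) \<and> composable S (v @ seg i j)" if ij: "i < j" "j < B" for i j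
    proof -
      obtain v where v: "minimal_fact v (drop i bs)" "composable S (marked_word v (drop i bs))"
        using minimal_fact_drop[OF m c, of i] ij len by auto
      have eq: "marked_word v (drop i bs) = marked_word v (take (j - i) (drop i bs) @ drop j bs)"
        using ij append_take_drop_id[of "j - i" "drop i bs"] by simp
      have eq': "\<dots> = (v @ seg i j) @ marked_word [] (drop j bs)"
        unfolding marked_word_append seg_def by (subst marked_word_prepend[symmetric]) simp
      have "composable S (v @ seg i j)"
        using v(2) unfolding eq eq' composable_append_iff[of S "v @ seg i j"] by blast
      then show ?thesis using v(1) by blast
    qed
    have cs: "composable S (seg i j)" if ij: "i < j" "j < B" for i j
      using pre[OF ij] by (auto simp: composable_append_iff)
    have "\<forall>i j. i < j \<longrightarrow> j < B \<longrightarrow> ev (seg i j) \<in> E"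
      by (intro allI impI ev_edge[OF cs ne])
    from B[rule_format, of "\<lambda>i j. ev (seg i j)", OF this[rule_format]]
    obtain i j k where ijk: "i < j" "j < k" "k < B" "ev (seg i j) = ev (seg j k)" "ev (seg i k) = ev (seg j k)"
      by blast
    define e where "e = ev (seg j k)"
    have c2: "composable S (seg i j @ seg j k)" using cs[of i k] ijk seg[of i j k] by simp
    have lt: "j < B" "i < k" using ijk by simp_all
    have "e = e \<odot> e"
      using ev_append[OF c2 ne[OF ijk(1) lt(1)] ne[OF ijk(2,3)]] ijk seg[of i j k] by (simp add: e_def)
    moreover have "tgt e = src e"
      using ev_path[OF cs[OF ijk(1) lt(1)] ne[OF ijk(1) lt(1)]] ev_path[OF cs[OF ijk(2,3)] ne[OF ijk(2,3)]]
        c2 ne[OF ijk(1) lt(1)] ne[OF ijk(2,3)] ijk by (simp add: e_def composable_append_iff)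
    moreover have "e \<in> E" using ev_edge[OF cs[OF ijk(2,3)] ne[OF ijk(2,3)]] by (simp add: e_def)
    ultimately have "regular_edge e" unfolding regular_edge_def by auto
    then have reg: "regular_edge (ev (seg i k))" using ijk by (simp add: e_def)
    obtain v where v: "minimal_fact v (drop i bs)" "composable S (v @ seg i k)" using pre[OF lt(2) ijk(3)] by blast
    have "block v" using v(1) by (simp add: minimal_fact_def)
    then have "block (v @ seg i k)" by (rule block_append[OF _ v(2) ne[OF lt(2) ijk(3)] reg])
    moreover have "drop i bs = take (k - i) (drop i bs) @ drop k bs"
      using lt append_take_drop_id[of "k - i" "drop i bs"] by simp
    moreover have "take (k - i) (drop i bs) \<noteq> []" using lt ijk len by simp
    ultimately show False using minimal_fact_merge[of v "take (k - i) (drop i bs)" "drop k bs"] v(1)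
      unfolding seg_def by metis
  qed
  then show ?thesis by blast
qed

text \<open>Restricting to words over \<open>factors s\<close> loses no path of value
  \<open>s\<close>, because every letter of such a path is a factor of \<open>s\<close>.\<close>

lemma restrict_content:
  assumes L: "recognizable V E L"
    and complete: "\<And>w. \<lbrakk>composable S w; w \<noteq> []; ev w = s\<rbrakk> \<Longrightarrow> w \<in> L"
    and sound: "\<And>w. \<lbrakk>w \<in> L; set w \<subseteq> factors s; composable S w; src (hd w) = src s; tgt (last w) = tgt s\<rbrakk> \<Longrightarrow> ev w = s"
  shows "captures s {w \<in> L. set w \<subseteq> factors s}"
proof -
  let ?C = "{w \<in> lists E - {[]}. set w \<subseteq> factors s}"
  have LE: "L \<subseteq> lists E - {[]}" using L by (simp add: recognizable_def)
  have "recognizable V E {w \<in> L. set w \<subseteq> factors s}"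
    by (rule recognizable_combination[OF V, of "{L, ?C}"])
       (use L content_recognizable[OF Sl] LE in auto)
  moreover have "set w \<subseteq> factors s" if "composable S w" "ev w = s" for w
    using factors_letter[OF that(1)] that(2) by blast
  ultimately show ?thesis unfolding captures_def using complete sound by blast
qed

text \<open>Words with the same image in \<open>T\<close> as some path of value s form a
  recognizable language. A path in it with the ends of s has a value t related to the same element
  as s. If t is regular, it equals s by \<open>regular_eqI\<close>; otherwise t is strictly
  \<open>J\<close>-above s, and the languages of such t are removed.\<close>

lemma capture_regular:
  assumes s: "regular_edge s"
    and IH: "\<And>t. \<lbrakk>t \<in> E; factors t \<subset> factors s\<rbrakk> \<Longrightarrow> \<exists>L. captures t L"
  shows "\<exists>L. captures s L"
proof -
  have sE: "s \<in> E" using s by (simp add: regular_edge_def)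
  define Z where "Z = {t \<in> E. coterminal S t s \<and> factors t \<subset> factors s}"
  obtain F where F: "\<And>t. t \<in> Z \<Longrightarrow> captures t (F t)" using IH unfolding Z_def mem_Collect_eq by metis
  have "\<exists>t. (a, t) \<in> \<tau>" if "a \<in> E" for a using sgpoid_rel_total[OF \<tau> that] .
  then obtain q where q: "\<And>a. a \<in> E \<Longrightarrow> (a, q a) \<in> \<tau>" by metis
  define \<psi> where "\<psi> w = wprod (sop T) (map q w)" for w
  have \<psi>: "\<psi> \<in> sgp_hom (free_sgp E) T"
    unfolding \<psi>_def using pseudovariety_fin[OF V T] q sgpoid_relD(2)[OF \<tau>] by (intro free_hom_extend) blast+
  have ev\<psi>: "(ev w, \<psi> w) \<in> \<tau>" if "composable S w" "w \<noteq> []" for w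
    using that
  proof (induction w)
    case (Cons a w)
    show ?case
    proof (cases "w = []")
      case False
      have c: "a \<in> E" "composable S w" "tgt a = src (hd w)" using Cons.prems False by (auto simp: composable_Cons_iff)
      have "tgt a = src (ev w)" using ev_path[OF c(2) False] c(3) by simp
      then show ?thesis
        using sgpoid_rel_comp[OF \<tau> q[OF c(1)] Cons.IH[OF c(2) False]] False by (simp add: \<psi>_def wprod_Cons)
    qed (use Cons q in \<open>simp add: \<psi>_def\<close>)
  qed simp
  define B where "B = {w \<in> lists E - {[]}. \<exists>w'. composable S w' \<and> w' \<noteq> [] \<and> ev w' = s \<and> \<psi> w' = \<psi> w}"
  have recB: "recognizable V E B"
    unfolding recognizable_iff
  proof (intro conjI bexI[OF _ T] bexI[OF _ \<psi>])
    show "\<forall>u\<in>lists E - {[]}. \<forall>v\<in>lists E - {[]}. \<psi> u = \<psi> v \<longrightarrow> u \<in> B \<longrightarrow> v \<in> B"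
      unfolding B_def by auto
  qed (auto simp: B_def)
  have fZ: "finite Z" using finite_E by (simp add: Z_def)
  have rec: "recognizable V E (B - (\<Union>t\<in>Z. F t))"
  proof (rule recognizable_combination[OF V, of "insert B (F ` Z)"])
    show "finite (insert B (F ` Z))" using fZ by simp
    show "recognizable V E L" if "L \<in> insert B (F ` Z)" for L
      using that recB captures_rec[OF F] by blast
  qed (auto simp: B_def)
  have "captures s {w \<in> B - (\<Union>t\<in>Z. F t). set w \<subseteq> factors s}"
  proof (rule restrict_content[OF rec])
    fix w assume w: "composable S w" "w \<noteq> []" "ev w = s"
    have "w \<in> lists E - {[]}" using w by (auto simp: composable_def)
    then have "w \<in> B" using w unfolding B_def by blast
    moreover have "w \<notin> F t" if t: "t \<in> Z" for t
    proof
      assume "w \<in> F t"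
      then have "ev w = t"
        using captures_sound[OF F[OF t] _ w(1)] ev_path[OF w(1,2)] w(3) t by (simp add: Z_def coterminal_def)
      then show False using w(3) t by (auto simp: Z_def)
    qed
    ultimately show "w \<in> B - (\<Union>t\<in>Z. F t)" by blast
  next
    fix w assume w: "w \<in> B - (\<Union>t\<in>Z. F t)" "set w \<subseteq> factors s" "composable S w"
      "src (hd w) = src s" "tgt (last w) = tgt s"
    obtain w' where w': "composable S w'" "w' \<noteq> []" "ev w' = s" "\<psi> w' = \<psi> w" and ne: "w \<noteq> []"
      using w(1) by (auto simp: B_def)
    define t where "t = ev w"
    have t: "t \<in> E" "src s = src t" "tgt s = tgt t" using ev_path[OF w(3) ne] w(4,5) by (auto simp: t_def)
    have \<tau>st: "(s, \<psi> w) \<in> \<tau>" "(t, \<psi> w) \<in> \<tau>" using ev\<psi>[OF w'(1,2)] ev\<psi>[OF w(3) ne] w'(3,4) by (simp_all add: t_def)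
    have eq: "lpow (s \<odot> y) (Suc N) = lpow (t \<odot> y) (Suc N) \<and> lpow (y \<odot> s) (Suc N) = lpow (y \<odot> t) (Suc N)"
      if y: "y \<in> E" "src y = tgt s" "tgt y = src s" for y
    proof
      have yq: "(y, q y) \<in> \<tau>" by (rule q[OF y(1)])
      show "lpow (s \<odot> y) (Suc N) = lpow (t \<odot> y) (Suc N)"
        by (rule power_inj[of _ "src s" _ "\<psi> w \<cdot>\<^bsub>T\<^esub> q y"])
           (use y t sE \<tau>st yq sgpoid_rel_comp[OF \<tau>] in \<open>auto simp: comp_ends\<close>)
      show "lpow (y \<odot> s) (Suc N) = lpow (y \<odot> t) (Suc N)"
        by (rule power_inj[of _ "tgt s" _ "q y \<cdot>\<^bsub>T\<^esub> \<psi> w"])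
           (use y t sE \<tau>st yq sgpoid_rel_comp[OF \<tau>] in \<open>auto simp: comp_ends\<close>)
    qed
    obtain y where y: "y \<in> E" "tgt s = src y" "tgt y = src s" "s \<odot> y \<odot> s = s"
      using s by (auto simp: regular_edge_def)
    have rt: "regular_edge t"
    proof (rule ccontr)
      assume nt: "\<not> regular_edge t"
      \<comment> \<open>\<open>J\<close>-equivalent edges are both regular or both not, so it
        remains to show that \<open>t\<close> is a factor of \<open>s\<close>.\<close>
      have ts: "s \<in> factors t \<Longrightarrow> t \<notin> factors s" using regular_J[OF s] nt by blast
      have "t \<in> factors s"
      proof -
        have l: "s \<odot> y \<in> loops (src s)" "t \<odot> y \<in> loops (src s)"
          using y t sE by (auto simp: comp_ends)
        interpret L: sgp "local_sgp S (src s)" by (rule local_sgpI[OF l(1)])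
        have N0: "N > 0" using local_ids(1)[OF l(1)] by (simp add: idem_exponent_def)
        \<comment> \<open>sy is idempotent and equals the (\<omega>+1)-power of ty, so t is the
          first letter of a path with value (sy)s = s.\<close>
        have "s \<odot> y = lpow (s \<odot> y) (Suc N)"
          using L.spow_idem[of "s \<odot> y" "Suc N"] l(1) regular_comp_idem(1)[OF sE y] by simp
        also have "\<dots> = lpow (t \<odot> y) (Suc N)" using eq y by simp
        also have "\<dots> = (t \<odot> y) \<odot> lpow (t \<odot> y) N"
          using L.spow_Suc[of "t \<odot> y" N] l(2) N0 by simp
        finally have sy: "s \<odot> y = (t \<odot> y) \<odot> lpow (t \<odot> y) N" .
        have p: "lpow (t \<odot> y) N \<in> loops (src s)" using L.spow_closed[of "t \<odot> y" N] l(2) N0 by simp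
        have "s = (s \<odot> y) \<odot> s" using y(4) by simp
        also have "\<dots> = ev ([] @ [t] @ [y, lpow (t \<odot> y) N, s])"
          unfolding sy using t y sE p by (simp add: comp_simps)
        finally have "ev ([] @ [t] @ [y, lpow (t \<odot> y) N, s]) = s" ..
        moreover have "composable S ([] @ [t] @ [y, lpow (t \<odot> y) N, s])"
          using t y sE p by (simp add: composable_Cons_iff)
        ultimately show ?thesis unfolding factors_def by blast
      qed
      then have "factors t \<subset> factors s"
        using ts factors_trans[of _ t s] factors_refl[OF sE] by blast
      then have tZ: "t \<in> Z" using t by (simp add: Z_def coterminal_def)
      then have "w \<in> F t" using captures_complete[OF F[OF tZ, unfolded t_def] w(3) ne] by (simp add: t_def)
      then show False using w(1) tZ by blast
    qed
    have "s = t" by (rule regular_eqI[OF s rt t(2,3)]) (rule eq)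
    then show "ev w = s" by (simp add: t_def)
  qed
  then show ?thesis by blast
qed

text \<open>The language is a finite union of marked products, one for each bounded type whose
  representative word has value s. Completeness comes from factorizing with fewest markers,
  soundness from the value being determined by type and ends.\<close>

lemma capture_nonregular:
  assumes sE: "s \<in> E" and s: "\<not> regular_edge s"
    and IH: "\<And>t. \<lbrakk>t \<in> E; factors t \<subset> factors s\<rbrakk> \<Longrightarrow> \<exists>L. captures t L"
  shows "\<exists>L. captures s L"
proof -
  obtain B where B: "\<And>u bs. \<lbrakk>minimal_fact u bs; composable S (marked_word u bs)\<rbrakk> \<Longrightarrow> length bs < B"
    using minimal_fact_bound by blast
  define R where "R = {t \<in> E. factors t \<subset> factors s}"
  obtain F where F: "\<And>t. t \<in> R \<Longrightarrow> captures t (F t)" using IH unfolding R_def mem_Collect_eq by metis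
  define Ty where "Ty = {(r, ts). valid_type E factors R r ts \<and> length ts \<le> B \<and>
    path_between (src s) (marked_type r ts) (tgt s) \<and> evo (marked_type r ts) = Some s}"
  let ?X = "insert None (Some ` E)"
  have Fc: "recognizable V E (F r)" "w \<in> F r \<Longrightarrow> set w \<subseteq> factors r" if "r \<in> R" for r w
    using captures_rec[OF F[OF that]] captures_content[OF F[OF that]] by blast+
  have vs: "r \<in> ?X \<and> set ts \<subseteq> E \<times> ?X" if "valid_type E factors R r ts" for r ts
    using that
  proof (induction ts arbitrary: r)
    case Nil
    then show ?case by (cases r) (auto simp: R_def)
  next
    case (Cons b ts)
    obtain a r' where b: "b = (a, r')" by (cases b)
    then show ?case using Cons.prems Cons.IH[of r'] by (cases r) (auto simp: R_def)
  qed
  have "Ty \<subseteq> ?X \<times> {ts. set ts \<subseteq> E \<times> ?X \<and> length ts \<le> B}" using vs by (auto simp: Ty_def)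
  moreover have "finite (?X \<times> {ts. set ts \<subseteq> E \<times> ?X \<and> length ts \<le> B})"
    using finite_E by (intro finite_cartesian_product finite_lists_length_le) auto
  ultimately have fin: "finite Ty" by (rule finite_subset)
  define G where "G = (\<Union>(r, ts)\<in>Ty. marked_lang F r ts)"
  have Ty_rec: "recognizable V E (marked_lang F r ts)" if "(r, ts) \<in> Ty" for r ts
  proof -
    have "marked_type r ts \<noteq> []" using that by (auto simp: Ty_def evo_def)
    then have "\<not> (r = None \<and> ts = [])" by (auto simp: opt_word_def)
    then show ?thesis
      using marked_lang_recognizable[where r = r and \<tau> = ts, OF closed finite_E Fc] that by (auto simp: Ty_def)
  qed
  have recG: "recognizable V E G"
  proof (rule recognizable_combination[OF V, of "(\<lambda>(r, ts). marked_lang F r ts) ` Ty"])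
    show "finite ((\<lambda>(r, ts). marked_lang F r ts) ` Ty)" using fin by simp
    show "recognizable V E L" if "L \<in> (\<lambda>(r, ts). marked_lang F r ts) ` Ty" for L using that Ty_rec by auto
    show "G \<subseteq> lists E - {[]}" using recognizable_words[OF Ty_rec] unfolding G_def by auto
    show "v \<in> G" if "\<forall>L\<in>(\<lambda>(r, ts). marked_lang F r ts) ` Ty. (u \<in> L) = (v \<in> L)" "u \<in> G" for u v
      using that unfolding G_def by auto
  qed
  have "captures s {w \<in> G. set w \<subseteq> factors s}"
  proof (rule restrict_content[OF recG])
    fix w assume w: "composable S w" "w \<noteq> []" "ev w = s"
    obtain u bs where ub: "minimal_fact u bs" "marked_word u bs = w" using exists_minimal_fact[OF w(1)] by blast
    \<comment> \<open>A regular factor cannot be \<open>J\<close>-equivalent to the non-regular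
      \<open>s\<close>; it lies strictly above, where the induction hypothesis provides a
      language.\<close>
    have R: "ev v \<in> R" if v: "w = x @ v @ y" "v \<noteq> []" "regular_edge (ev v)" for x v y
    proof -
      have f: "ev v \<in> factors s" using factors_subword[of x v y] w v by simp
      have "s \<notin> factors (ev v)" using regular_J[OF v(3) f] s by blast
      then have "factors (ev v) \<subset> factors s"
        using factors_trans[OF _ f] factors_refl[OF sE] by blast
      then show ?thesis using v(3) by (simp add: R_def regular_edge_def)
    qed
    have ty: "valid_type E factors R (evo u) (type_of bs)" "w \<in> marked_lang F (evo u) (type_of bs)"
      using minimal_fact_type[OF ub(1), of R F] w(1) R F unfolding ub(2) by blast+
    have "path_between (src s) w (tgt s)" using w ev_path[OF w(1,2)] by (simp add: path_between_def)
    then have p: "path_between (src s) (marked_type (evo u) (type_of bs)) (tgt s)" "path_between (src s) w (tgt s)"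
      using path_between_type[of "src s" u bs "tgt s"] ub(2) by simp_all
    \<comment> \<open>\<open>w\<close> lies in the language of its own type, so the representative
      word has the value of \<open>w\<close>, namely \<open>s\<close>, and the type belongs to
      \<open>Ty\<close>.\<close>
    have "evo (marked_type (evo u) (type_of bs)) = evo w"
      using marked_lang_value[OF F ty p(2,1)] by simp
    then have "evo (marked_type (evo u) (type_of bs)) = Some s" using w by (simp add: evo_def)
    moreover have "length (type_of bs) \<le> B" using B[OF ub(1)] ub(2) w(1) by (simp add: type_of_def)
    ultimately have "(evo u, type_of bs) \<in> Ty" using ty(1) p(1) by (simp add: Ty_def)
    then show "w \<in> G" using ty(2) unfolding G_def by blast
  next
    fix w assume w: "w \<in> G" "composable S w" "src (hd w) = src s" "tgt (last w) = tgt s"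
    obtain r ts where r: "(r, ts) \<in> Ty" "w \<in> marked_lang F r ts" using w(1) by (auto simp: G_def)
    have ne: "w \<noteq> []" using recognizable_words[OF Ty_rec[OF r(1)]] r(2) by blast
    have "path_between (src s) w (tgt s)" using w ne by (simp add: path_between_def)
    then have "evo w = evo (marked_type r ts)"
      using marked_lang_value[OF F _ r(2)] r(1) by (auto simp: Ty_def)
    then show "ev w = s" using r(1) ne by (simp add: Ty_def evo_def)
  qed
  then show ?thesis by blast
qed

lemma capture: "s \<in> E \<Longrightarrow> \<exists>L. captures s L"
proof (induction "card (factors s)" arbitrary: s rule: less_induct)
  case less
  have "finite (factors s)" using finite_subset[OF factors_edges finite_E] .
  then have IH: "\<exists>L. captures t L" if "t \<in> E" "factors t \<subset> factors s" for t
    using less(1)[of t] psubset_card_mono that by blast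
  show ?case using capture_regular[OF _ IH] capture_nonregular[OF less(2) _ IH] by blast
qed

text \<open>One homomorphism \<open>\<phi>\<close> saturates all captured languages. Coterminal
  paths with equal \<open>\<phi>\<close>-values lie in the same captured languages, so their values
  agree; hence the relation between values and \<open>\<phi>\<close>-values is faithful.\<close>

lemma dividing: "S \<in> dividing_sgpoids V"
proof -
  obtain L where L: "\<And>s. s \<in> E \<Longrightarrow> captures s (L s)" using capture by metis
  obtain Q \<phi> where Q: "Q \<in> V" "\<phi> \<in> sgp_hom (free_sgp E) Q" "\<forall>X\<in>L ` E. saturates E \<phi> X"
    using saturates_common[OF V, of "L ` E" E] captures_rec[OF L] finite_E by blast
  define \<sigma> where "\<sigma> = (\<lambda>w. (ev w, \<phi> w)) ` {w. composable S w \<and> w \<noteq> []}"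
  have cE: "w \<in> lists E - {[]}" if "composable S w" "w \<noteq> []" for w
    using that by (auto simp: composable_def)
  have "sgpoid_rel S Q \<sigma>"
    unfolding sgpoid_rel_def
  proof (intro conjI allI impI)
    show "\<sigma> \<subseteq> E \<times> carrier Q"
      using ev_edge free_hom_closed[OF Q(2)] cE by (auto simp: \<sigma>_def)
    show "E \<subseteq> fst ` \<sigma>"
    proof
      fix s assume s: "s \<in> E"
      then have "(ev [s], \<phi> [s]) \<in> \<sigma>" unfolding \<sigma>_def by (intro imageI) simp
      then show "s \<in> fst ` \<sigma>" by force
    qed
    fix s t s' t' assume a: "(s, t) \<in> \<sigma>" "(s', t') \<in> \<sigma>" "tgt s = src s'"
    obtain u where u: "composable S u" "u \<noteq> []" "s = ev u" "t = \<phi> u" using a(1) by (auto simp: \<sigma>_def)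
    obtain v where v: "composable S v" "v \<noteq> []" "s' = ev v" "t' = \<phi> v" using a(2) by (auto simp: \<sigma>_def)
    have c: "composable S (u @ v)"
      using u v a(3) ev_path[OF u(1,2)] ev_path[OF v(1,2)] by (simp add: composable_append_iff)
    have "ev (u @ v) = s \<odot> s'" using ev_append[OF c u(2) v(2)] u v by simp
    moreover have "\<phi> (u @ v) = t \<cdot>\<^bsub>Q\<^esub> t'"
      using free_hom_append[OF Q(2), of u v] cE[OF u(1,2)] cE[OF v(1,2)] u(4) v(4) by simp
    ultimately have "(s \<odot> s', t \<cdot>\<^bsub>Q\<^esub> t') = (\<lambda>w. (ev w, \<phi> w)) (u @ v)" by simp
    then show "(s \<odot> s', t \<cdot>\<^bsub>Q\<^esub> t') \<in> \<sigma>" unfolding \<sigma>_def by (rule image_eqI) (use c u in simp)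
  qed
  moreover have "faithful_rel S \<sigma>"
    unfolding faithful_rel_def
  proof (intro allI impI)
    fix s s' t assume a: "(s, t) \<in> \<sigma>" "(s', t) \<in> \<sigma>" "coterminal S s s'"
    obtain u where u: "composable S u" "u \<noteq> []" "s = ev u" "t = \<phi> u" using a(1) by (auto simp: \<sigma>_def)
    obtain v where v: "composable S v" "v \<noteq> []" "s' = ev v" "t = \<phi> v" using a(2) by (auto simp: \<sigma>_def)
    have sE: "s \<in> E" using ev_edge[OF u(1,2)] u(3) by simp
    have "u \<in> L s" using captures_complete[OF L[OF sE, unfolded u(3)] u(1,2)] u(3) by simp
    moreover have "saturates E \<phi> (L s)" using Q(3) sE by blast
    from saturates_sym[OF this lists.Nil lists.Nil cE[OF u(1,2)] cE[OF v(1,2)]]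
    have "u \<in> L s \<longleftrightarrow> v \<in> L s" using u(4) v(4) by simp
    ultimately have "v \<in> L s" by simp
    then show "s = s'"
      using captures_sound[OF L[OF sE] _ v(1)] v(3) a(3) ev_path[OF v(1,2)] by (simp add: coterminal_def)
  qed
  ultimately show ?thesis using Q(1) fin unfolding dividing_sgpoids_def by blast
qed

end

section \<open>The quotient by equality of powers\<close>

context local_ds_rs
begin

text \<open>One-sided completions suffice for a congruence, by \<open>power_rotate\<close>. The
  power of a loop itself is a separate condition because a completion \<open>y\<close> cannot be
  empty.\<close>

definition power_eq :: "nat \<Rightarrow> nat \<Rightarrow> bool" where
  "power_eq s t \<longleftrightarrow> coterminal S s t \<and>
     (src s = tgt s \<longrightarrow> lpow s (Suc N) = lpow t (Suc N)) \<and>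
     (\<forall>y\<in>E. src y = tgt s \<longrightarrow> tgt y = src s \<longrightarrow>
        lpow (s \<odot> y) (Suc N) = lpow (t \<odot> y) (Suc N) \<and> lpow (y \<odot> s) (Suc N) = lpow (y \<odot> t) (Suc N))"

lemma power_eq_refl: "power_eq s s"
  by (simp add: power_eq_def coterminal_def)

lemma power_eq_sym: "power_eq s t \<Longrightarrow> power_eq t s"
  by (simp add: power_eq_def coterminal_def)

lemma power_eq_trans: "power_eq s t \<Longrightarrow> power_eq t u \<Longrightarrow> power_eq s u"
  by (simp add: power_eq_def coterminal_def)

lemma power_eqD:
  assumes "power_eq s t" "y \<in> E" "src y = tgt s" "tgt y = src s"
  shows "lpow (s \<odot> y) (Suc N) = lpow (t \<odot> y) (Suc N)" "lpow (y \<odot> s) (Suc N) = lpow (y \<odot> t) (Suc N)"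
  using assms by (auto simp: power_eq_def)

lemma power_eq_ends: "power_eq s t \<Longrightarrow> src s = src t" "power_eq s t \<Longrightarrow> tgt s = tgt t"
  by (auto simp: power_eq_def coterminal_def)

lemma power_eq_loop: "power_eq s t \<Longrightarrow> src s = tgt s \<Longrightarrow> lpow s (Suc N) = lpow t (Suc N)"
  by (simp add: power_eq_def)

lemma lpow_shift:
  assumes x: "x \<in> E" and b: "b \<in> E" "tgt x = src b" "tgt b = src x" and n: "n > 0"
  shows "lpow (x \<odot> b) n \<odot> x = x \<odot> lpow (b \<odot> x) n"
proof -
  have l: "x \<odot> b \<in> loops (src x)" "b \<odot> x \<in> loops (tgt x)"
    using x b by (auto simp: comp_ends)
  interpret L: sgp "local_sgp S (src x)" by (rule local_sgpI[OF l(1)])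
  interpret R: sgp "local_sgp S (tgt x)" by (rule local_sgpI[OF l(2)])
  show ?thesis using n
  proof (induction n)
    case (Suc n)
    show ?case
    proof (cases "n = 0")
      case True
      then show ?thesis using x b by (simp add: comp_assoc)
    next
      case False
      have cl: "lpow (x \<odot> b) n \<in> loops (src x)" "lpow (b \<odot> x) n \<in> loops (tgt x)"
        using L.spow_closed[of "x \<odot> b" n] R.spow_closed[of "b \<odot> x" n] l False by simp_all
      have "lpow (x \<odot> b) (Suc n) \<odot> x = x \<odot> b \<odot> (lpow (x \<odot> b) n \<odot> x)"
        using L.spow_Suc[of "x \<odot> b" n] False l cl x b by (simp add: comp_simps)
      also have "\<dots> = x \<odot> (b \<odot> x \<odot> lpow (b \<odot> x) n)"
        using Suc False cl x b by (simp add: comp_simps)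
      also have "\<dots> = x \<odot> lpow (b \<odot> x) (Suc n)"
        using R.spow_Suc[of "b \<odot> x" n] False l by simp
      finally show ?thesis .
    qed
  qed simp
qed

text \<open>Equality of the powers of two conjugates of \<open>xsy\<close> and \<open>xs'y\<close> passes to \<open>xsy\<close> and \<open>xs'y\<close>:
  the two powers \<open>P\<close>, \<open>Q\<close> satisfy \<open>Px = Qx\<close> and \<open>yP = yQ\<close>, hence \<open>P = QE\<close> and \<open>FP = FQ = Q\<close> for
  the idempotent powers \<open>E\<close>, \<open>F\<close> of \<open>xsy\<close>, \<open>xs'y\<close>.\<close>

lemma power_rotate:
  assumes x: "x \<in> E" and s: "s \<in> E" "s' \<in> E" and y: "y \<in> E"
    and ends: "tgt x = src s" "tgt s = src y" "tgt y = src x" "src s = src s'" "tgt s = tgt s'"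
    and eq1: "lpow (s \<odot> (y \<odot> x)) (Suc N) = lpow (s' \<odot> (y \<odot> x)) (Suc N)"
    and eq2: "lpow ((y \<odot> x) \<odot> s) (Suc N) = lpow ((y \<odot> x) \<odot> s') (Suc N)"
  shows "lpow (x \<odot> s \<odot> y) (Suc N) = lpow (x \<odot> s' \<odot> y) (Suc N)"
proof -
  define a a' where "a = x \<odot> s \<odot> y" and "a' = x \<odot> s' \<odot> y"
  have la: "a \<in> loops (src x)" "a' \<in> loops (src x)"
    using x s y ends by (auto simp: a_def a'_def comp_ends)
  interpret L: sgp "local_sgp S (src x)" by (rule local_sgpI[OF la(1)])
  note N = local_ids(1)[OF la(1)]
  have N0: "N > 0" using N by (simp add: idem_exponent_def)
  obtain M where M: "N * 2 = Suc M" "M > 0" using N0 by (intro that[of "2 * N - 1"]) auto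
  have two: "lpow c N = c \<odot> lpow c M" "lpow c N = lpow c M \<odot> c" if "c \<in> loops (src x)" for c
    using L.exponent_multiple(1)[OF N, of 2 c] L.spow_Suc[of c M] L.spow_Suc2[of c M] M(2) that
    unfolding M(1) by simp_all
  have cl: "lpow c n \<in> loops (src x)" if "c \<in> loops (src x)" "n > 0" for c n
    using L.spow_closed[of c n] that by simp
  define P Q F G where "P = lpow a (Suc N)" and "Q = lpow a' (Suc N)" and "F = lpow a N" and "G = lpow a' N"
  have PQ: "P \<in> loops (src x)" "Q \<in> loops (src x)" "F \<in> loops (src x)" "G \<in> loops (src x)"
    unfolding P_def Q_def F_def G_def by (intro cl la zero_less_Suc N0)+
  have PF: "P \<odot> F = P"
    using L.spow_add[of a "Suc N" N] L.exponent_multiple(2)[OF N, of 2 a] la N0 by (simp add: P_def F_def mult_2_right)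
  have GQ: "G \<odot> Q = Q"
    using L.spow_add[of a' N "Suc N"] L.exponent_multiple(2)[OF N, of 2 a'] la N0 by (simp add: Q_def G_def mult_2_right)
  have Px: "P \<odot> x = Q \<odot> x"
  proof -
    have e: "x \<odot> (s \<odot> y) = a" "x \<odot> (s' \<odot> y) = a'" "s \<odot> y \<odot> x = s \<odot> (y \<odot> x)" "s' \<odot> y \<odot> x = s' \<odot> (y \<odot> x)"
      using x s y ends by (simp_all add: a_def a'_def comp_assoc)
    have "P \<odot> x = x \<odot> lpow (s \<odot> y \<odot> x) (Suc N)"
      using lpow_shift[OF x, of "s \<odot> y" "Suc N"] s y ends by (simp add: e(1) P_def comp_ends del: replicate.simps)
    moreover have "Q \<odot> x = x \<odot> lpow (s' \<odot> y \<odot> x) (Suc N)"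
      using lpow_shift[OF x, of "s' \<odot> y" "Suc N"] s y ends by (simp add: e(2) Q_def comp_ends del: replicate.simps)
    ultimately show ?thesis using eq1 e by simp
  qed
  have yP: "y \<odot> P = y \<odot> Q"
  proof -
    have e: "y \<odot> (x \<odot> s) = y \<odot> x \<odot> s" "y \<odot> (x \<odot> s') = y \<odot> x \<odot> s'"
      using x s y ends by (simp_all add: comp_assoc)
    have "y \<odot> P = lpow (y \<odot> x \<odot> s) (Suc N) \<odot> y"
      using lpow_shift[OF y, of "x \<odot> s" "Suc N"] x s ends by (simp add: e P_def a_def comp_ends del: replicate.simps)
    moreover have "y \<odot> Q = lpow (y \<odot> x \<odot> s') (Suc N) \<odot> y"
      using lpow_shift[OF y, of "x \<odot> s'" "Suc N"] x s ends by (simp add: e Q_def a'_def comp_ends del: replicate.simps)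
    ultimately show ?thesis using eq2 by simp
  qed
  have aM: "lpow a M \<in> loops (src x)" "lpow a' M \<in> loops (src x)" using cl la M(2) by blast+
  have "P = P \<odot> (a \<odot> lpow a M)" using PF two(1)[OF la(1)] by (simp add: F_def)
  also have "\<dots> = (P \<odot> x) \<odot> (s \<odot> (y \<odot> lpow a M))"
    using x s y ends PQ aM by (simp add: a_def comp_simps)
  also have "\<dots> = Q \<odot> (a \<odot> lpow a M)"
    unfolding Px using x s y ends PQ aM by (simp add: a_def comp_simps)
  finally have PQF: "P = Q \<odot> F" using two(1)[OF la(1)] by (simp add: F_def)
  have "G \<odot> P = lpow a' M \<odot> x \<odot> s' \<odot> (y \<odot> P)"
    using two(2)[OF la(2)] x s y ends PQ aM by (simp add: G_def a'_def comp_simps)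
  also have "\<dots> = G \<odot> Q"
    unfolding yP using two(2)[OF la(2)] x s y ends PQ aM by (simp add: G_def a'_def comp_simps)
  finally have "G \<odot> P = Q" using GQ by simp
  moreover have "G \<odot> P = P"
  proof -
    have "G \<odot> (Q \<odot> F) = (G \<odot> Q) \<odot> F" using PQ by (simp add: comp_assoc)
    then show ?thesis unfolding PQF[symmetric] GQ .
  qed
  ultimately show ?thesis by (simp add: P_def Q_def a_def a'_def)
qed

text \<open>A completion \<open>y\<close> of \<open>a \<odot> s\<close> gives the completion
  \<open>y \<odot> a\<close> of \<open>s\<close>. For \<open>y \<odot> (a \<odot> s)\<close>
  associativity is enough; for \<open>a \<odot> s \<odot> y\<close> the equality is moved around the
  cycle by \<open>power_rotate\<close>.\<close>

lemma power_eq_comp_left: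
  assumes eq: "power_eq s t" and st: "s \<in> E" "t \<in> E" and a: "a \<in> E" "tgt a = src s"
  shows "power_eq (a \<odot> s) (a \<odot> t)"
proof -
  note en = power_eq_ends[OF eq]
  have "lpow (a \<odot> s) (Suc N) = lpow (a \<odot> t) (Suc N)" if "src a = tgt s"
    using power_eqD(2)[OF eq a(1)] that a(2) by simp
  moreover have "lpow (a \<odot> s \<odot> y) (Suc N) = lpow (a \<odot> t \<odot> y) (Suc N)"
    "lpow (y \<odot> (a \<odot> s)) (Suc N) = lpow (y \<odot> (a \<odot> t)) (Suc N)"
    if y: "y \<in> E" "src y = tgt s" "tgt y = src a" for y
  proof -
    have ya: "y \<odot> a \<in> E" "src (y \<odot> a) = tgt s" "tgt (y \<odot> a) = src s"
      using y a by (simp_all add: comp_ends)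
    note e = power_eqD[OF eq ya]
    show "lpow (a \<odot> s \<odot> y) (Suc N) = lpow (a \<odot> t \<odot> y) (Suc N)"
      by (rule power_rotate[OF a(1) st y(1) a(2) _ y(3) en e]) (use y in simp)
    have "y \<odot> (a \<odot> s) = y \<odot> a \<odot> s" "y \<odot> (a \<odot> t) = y \<odot> a \<odot> t"
      using y a st en by (simp_all add: comp_assoc)
    then show "lpow (y \<odot> (a \<odot> s)) (Suc N) = lpow (y \<odot> (a \<odot> t)) (Suc N)" using e(2) by (simp only:)
  qed
  ultimately show ?thesis
    using st a en unfolding power_eq_def coterminal_def by (simp add: comp_ends)
qed

lemma power_eq_comp_right:
  assumes eq: "power_eq s t" and st: "s \<in> E" "t \<in> E" and a: "a \<in> E" "tgt s = src a"
  shows "power_eq (s \<odot> a) (t \<odot> a)"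
proof -
  note en = power_eq_ends[OF eq]
  have "lpow (s \<odot> a) (Suc N) = lpow (t \<odot> a) (Suc N)" if "src s = tgt a"
    using power_eqD(1)[OF eq a(1)] that a(2) by simp
  moreover have "lpow (y \<odot> (s \<odot> a)) (Suc N) = lpow (y \<odot> (t \<odot> a)) (Suc N)"
    "lpow (s \<odot> a \<odot> y) (Suc N) = lpow (t \<odot> a \<odot> y) (Suc N)"
    if y: "y \<in> E" "src y = tgt a" "tgt y = src s" for y
  proof -
    have ay: "a \<odot> y \<in> E" "src (a \<odot> y) = tgt s" "tgt (a \<odot> y) = src s"
      using y a by (simp_all add: comp_ends)
    note e = power_eqD[OF eq ay]
    have "lpow (y \<odot> s \<odot> a) (Suc N) = lpow (y \<odot> t \<odot> a) (Suc N)"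
      by (rule power_rotate[OF y(1) st a(1) y(3) a(2) _ en e]) (use y in simp)
    moreover have "y \<odot> (s \<odot> a) = y \<odot> s \<odot> a" "y \<odot> (t \<odot> a) = y \<odot> t \<odot> a"
      using y a st en by (simp_all add: comp_assoc)
    ultimately show "lpow (y \<odot> (s \<odot> a)) (Suc N) = lpow (y \<odot> (t \<odot> a)) (Suc N)" by (simp only:)
    have "s \<odot> a \<odot> y = s \<odot> (a \<odot> y)" "t \<odot> a \<odot> y = t \<odot> (a \<odot> y)"
      using y a st en by (simp_all add: comp_assoc)
    then show "lpow (s \<odot> a \<odot> y) (Suc N) = lpow (t \<odot> a \<odot> y) (Suc N)" using e(1) by (simp only:)
  qed
  ultimately show ?thesis
    using st a en unfolding power_eq_def coterminal_def by (simp add: comp_ends)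
qed

text \<open>Least representatives make the edges of the quotient a subset of those of
  \<open>S\<close>, with the same ends, and keep the quotient on natural numbers.\<close>

definition rep :: "nat \<Rightarrow> nat" where
  "rep s = (LEAST t. t \<in> E \<and> power_eq s t)"

lemma rep: "s \<in> E \<Longrightarrow> rep s \<in> E \<and> power_eq s (rep s)"
  unfolding rep_def by (rule LeastI[of _ s]) (simp add: power_eq_refl)

lemma rep_eq_iff:
  assumes "s \<in> E" "t \<in> E"
  shows "rep s = rep t \<longleftrightarrow> power_eq s t"
proof
  assume "rep s = rep t"
  then show "power_eq s t" using rep[OF assms(1)] rep[OF assms(2)] power_eq_sym power_eq_trans by metis
next
  assume "power_eq s t"
  then have "power_eq s u \<longleftrightarrow> power_eq t u" for u using power_eq_sym power_eq_trans by metis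
  then show "rep s = rep t" by (simp add: rep_def)
qed

lemma rep_ends: "s \<in> E \<Longrightarrow> src (rep s) = src s" "s \<in> E \<Longrightarrow> tgt (rep s) = tgt s"
  using rep power_eq_ends by metis+

lemma rep_comp:
  assumes "s \<in> E" "t \<in> E" "tgt s = src t"
  shows "rep (rep s \<odot> rep t) = rep (s \<odot> t)"
proof -
  note r = rep[OF assms(1)] rep[OF assms(2)] and e = rep_ends[OF assms(1)] rep_ends[OF assms(2)]
  have "power_eq (s \<odot> t) (rep s \<odot> t)"
    using power_eq_comp_right[of s "rep s" t] r assms by simp
  moreover have "power_eq (rep s \<odot> t) (rep s \<odot> rep t)"
    using power_eq_comp_left[of t "rep t" "rep s"] r assms e by simp
  ultimately have "power_eq (s \<odot> t) (rep s \<odot> rep t)" by (rule power_eq_trans)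
  then show ?thesis using rep_eq_iff power_eq_sym r e assms by (simp add: comp_edge)
qed

definition quotient :: "(nat, nat) sgpoid" where
  "quotient = \<lparr>vertices = vertices S, edges = rep ` E, source = src, target = tgt,
     ecomp = (\<lambda>s t. rep (s \<odot> t))\<rparr>"

lemma quotient_fin: "quotient \<in> fin_sgpoids"
proof -
  have "is_semigroupoid quotient"
    unfolding is_semigroupoid_def
  proof (intro conjI ballI impI)
    fix x assume "x \<in> edges quotient"
    then show "source quotient x \<in> vertices quotient" "target quotient x \<in> vertices quotient"
      by (auto simp: quotient_def rep_ends src_vertex tgt_vertex)
  next
    fix x y assume "x \<in> edges quotient" "y \<in> edges quotient" "target quotient x = source quotient y"
    then have xy: "x \<in> E" "y \<in> E" "tgt x = src y" using rep by (auto simp: quotient_def)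
    then have c: "x \<odot> y \<in> E" by (simp add: comp_edge)
    show "ecomp quotient x y \<in> edges quotient" using c by (simp add: quotient_def)
    show "source quotient (ecomp quotient x y) = source quotient x"
      "target quotient (ecomp quotient x y) = target quotient y"
      using xy rep_ends[OF c] by (simp_all add: quotient_def comp_src comp_tgt)
  next
    fix x y z assume "x \<in> edges quotient" "y \<in> edges quotient" "z \<in> edges quotient"
      "target quotient x = source quotient y" "target quotient y = source quotient z"
    then have xyz: "x \<in> E" "y \<in> E" "z \<in> E" "tgt x = src y" "tgt y = src z" "rep x = x" "rep z = z"
      using rep rep_eq_iff by (auto simp: quotient_def power_eq_sym)
    have "rep (rep (x \<odot> y) \<odot> z) = rep (x \<odot> y \<odot> z)"
      using rep_comp[of "x \<odot> y" z] xyz by (simp add: comp_edge comp_tgt)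
    moreover have "rep (x \<odot> rep (y \<odot> z)) = rep (x \<odot> (y \<odot> z))"
      using rep_comp[of x "y \<odot> z"] xyz by (simp add: comp_edge comp_src)
    ultimately show "ecomp quotient (ecomp quotient x y) z = ecomp quotient x (ecomp quotient y z)"
      using xyz by (simp add: quotient_def comp_assoc)
  qed
  then show ?thesis using fin finite_E by (simp add: fin_sgpoids_def quotient_def)
qed

text \<open>Completions of loops at \<open>v\<close> are again loops at \<open>v\<close>, so two
  loops related to a common \<open>t\<close> have completions with common related elements, hence
  equal powers. Thus the relation becomes injective on the quotient and is a division.\<close>

lemma quotient_local:
  assumes V: "sgp_pseudovariety V" and cov: "covered_at V (local_sgp S v) N"
    and ne: "carrier (local_sgp quotient v) \<noteq> {}"
  shows "local_sgp quotient v \<in> V"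
proof -
  let ?L = "local_sgp quotient v"
  have Lc: "carrier ?L = rep ` loops v" using rep_ends by (auto simp: local_sgp_def quotient_def)
  obtain T \<tau> where T: "T \<in> V" "rel_morphism (local_sgp S v) T \<tau>" "power_injective (local_sgp S v) N \<tau>"
    using cov by (auto simp: covered_at_def)
  have \<tau>c: "s \<in> loops v" "t \<in> carrier T" if "(s, t) \<in> \<tau>" for s t
    using that T(2) unfolding rel_morphism_def local_simps by blast+
  have \<tau>m: "(s \<odot> s', t \<cdot>\<^bsub>T\<^esub> t') \<in> \<tau>" if "(s, t) \<in> \<tau>" "(s', t') \<in> \<tau>" for s s' t t'
    using that T(2) unfolding rel_morphism_def local_simps by blast
  have \<tau>t: "\<exists>t. (s, t) \<in> \<tau>" if "s \<in> loops v" for s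
    using rel_morphism_total[OF T(2)] that unfolding local_simps by blast
  have \<tau>p: "lpow s (Suc N) = lpow s' (Suc N)" if "(s, t) \<in> \<tau>" "(s', t) \<in> \<tau>" for s s' t
    using that T(3) unfolding power_injective_def spow_local by blast
  define \<sigma> where "\<sigma> = (\<lambda>(s, t). (rep s, t)) ` \<tau>"
  have "rel_morphism ?L T \<sigma>"
    unfolding rel_morphism_def
  proof (intro conjI allI impI)
    have "(rep s, t) \<in> rep ` loops v \<times> carrier T" if "(s, t) \<in> \<tau>" for s t
      using imageI[OF \<tau>c(1)[OF that], of rep] \<tau>c(2)[OF that] by (rule SigmaI)
    then show "\<sigma> \<subseteq> carrier ?L \<times> carrier T" unfolding Lc \<sigma>_def by (auto simp only: split_beta)
    show "carrier ?L \<subseteq> fst ` \<sigma>"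
    proof
      fix x assume "x \<in> carrier ?L"
      then obtain s where s: "s \<in> loops v" "x = rep s" unfolding Lc by blast
      then obtain t where "(s, t) \<in> \<tau>" using \<tau>t by blast
      then have "(x, t) \<in> \<sigma>" using s by (force simp: \<sigma>_def)
      then show "x \<in> fst ` \<sigma>" by force
    qed
    fix x t x' t' assume a: "(x, t) \<in> \<sigma>" "(x', t') \<in> \<sigma>"
    obtain s where s: "(s, t) \<in> \<tau>" "x = rep s" using a(1) by (auto simp: \<sigma>_def)
    obtain s' where s': "(s', t') \<in> \<tau>" "x' = rep s'" using a(2) by (auto simp: \<sigma>_def)
    have "x \<cdot>\<^bsub>?L\<^esub> x' = rep (s \<odot> s')"
      using rep_comp[of s s'] \<tau>c[OF s(1)] \<tau>c[OF s'(1)] s s' by (simp add: local_sgp_def quotient_def)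
    then show "(x \<cdot>\<^bsub>?L\<^esub> x', t \<cdot>\<^bsub>T\<^esub> t') \<in> \<sigma>" using \<tau>m[OF s(1) s'(1)] by (force simp: \<sigma>_def)
  qed
  then show ?thesis
  proof (rule pseudovariety_division[OF V T(1) local_sgp_fin[OF quotient_fin ne]])
    fix x x' t assume a: "(x, t) \<in> \<sigma>" "(x', t) \<in> \<sigma>"
    obtain s where s: "(s, t) \<in> \<tau>" "x = rep s" using a(1) by (auto simp: \<sigma>_def)
    obtain s' where s': "(s', t) \<in> \<tau>" "x' = rep s'" using a(2) by (auto simp: \<sigma>_def)
    have l: "s \<in> loops v" "s' \<in> loops v" using \<tau>c s s' by blast+
    have "power_eq s s'"
      unfolding power_eq_def coterminal_def
    proof (intro conjI ballI impI)
      fix y assume "y \<in> E" "src y = tgt s" "tgt y = src s"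
      then obtain u where u: "(y, u) \<in> \<tau>" using l \<tau>t[of y] by auto
      show "lpow (s \<odot> y) (Suc N) = lpow (s' \<odot> y) (Suc N)" "lpow (y \<odot> s) (Suc N) = lpow (y \<odot> s') (Suc N)"
        by (rule \<tau>p[OF \<tau>m[OF s(1) u] \<tau>m[OF s'(1) u]], rule \<tau>p[OF \<tau>m[OF u s(1)] \<tau>m[OF u s'(1)]])
    qed (use l \<tau>p[OF s(1) s'(1)] in auto)
    then show "x = x'" using rep_eq_iff l s s' by simp
  qed
qed

text \<open>Pulling a faithful relation back along \<open>rep\<close> loses only what
  \<open>rep\<close> identifies, namely edges with equal powers.\<close>

lemma quotient_cover:
  assumes T: "sgpoid_rel quotient T \<tau>" "faithful_rel quotient \<tau>"
  defines "\<sigma> \<equiv> {(s, t). s \<in> E \<and> (rep s, t) \<in> \<tau>}"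
  shows "sgpoid_rel S T \<sigma>"
    and "\<lbrakk>s \<in> loops v; s' \<in> loops v; (s, t) \<in> \<sigma>; (s', t) \<in> \<sigma>\<rbrakk> \<Longrightarrow> lpow s (Suc N) = lpow s' (Suc N)"
proof -
  show "sgpoid_rel S T \<sigma>"
    unfolding sgpoid_rel_def
  proof (intro conjI allI impI)
    show "\<sigma> \<subseteq> E \<times> carrier T" using sgpoid_relD[OF T(1)] by (auto simp: \<sigma>_def)
    show "E \<subseteq> fst ` \<sigma>"
    proof
      fix s assume s: "s \<in> E"
      then have "rep s \<in> edges quotient" by (simp add: quotient_def)
      then obtain t where "(rep s, t) \<in> \<tau>" using sgpoid_rel_total[OF T(1)] by blast
      then have "(s, t) \<in> \<sigma>" using s by (simp add: \<sigma>_def)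
      then show "s \<in> fst ` \<sigma>" by force
    qed
    fix s t s' t' assume a: "(s, t) \<in> \<sigma>" "(s', t') \<in> \<sigma>" "tgt s = src s'"
    then have s: "s \<in> E" "(rep s, t) \<in> \<tau>" "s' \<in> E" "(rep s', t') \<in> \<tau>" by (simp_all add: \<sigma>_def)
    have "(ecomp quotient (rep s) (rep s'), t \<cdot>\<^bsub>T\<^esub> t') \<in> \<tau>"
      by (rule sgpoid_rel_comp[OF T(1) s(2,4)]) (use a(3) rep_ends s in \<open>simp add: quotient_def\<close>)
    then show "(s \<odot> s', t \<cdot>\<^bsub>T\<^esub> t') \<in> \<sigma>"
      using rep_comp[OF s(1,3) a(3)] s a(3) by (simp add: \<sigma>_def quotient_def comp_edge)
  qed
  assume a: "s \<in> loops v" "s' \<in> loops v" "(s, t) \<in> \<sigma>" "(s', t) \<in> \<sigma>"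
  then have "(rep s, t) \<in> \<tau>" "(rep s', t) \<in> \<tau>" by (simp_all add: \<sigma>_def)
  moreover have "coterminal quotient (rep s) (rep s')"
    using a rep_ends by (simp add: coterminal_def quotient_def)
  ultimately have "rep s = rep s'" using T(2) unfolding faithful_rel_def by blast
  then have "power_eq s s'" using rep_eq_iff a by simp
  then show "lpow s (Suc N) = lpow s' (Suc N)" using power_eq_loop a by simp
qed

end

text \<open>Locality of \<open>V\<close> is applied to the quotient, whose local semigroups lie in
  \<open>V\<close>; the resulting \<open>T\<close>, pulled back to \<open>S\<close>, is the relation
  that \<open>bidet_cover\<close> asks for.\<close>

lemma locally_bidet_bound_dividing:
  assumes V: "sgp_pseudovariety V" and loc: "local_pseudovariety V" and Sl: "Sl \<subseteq> W"
    and W: "sgp_pseudovariety W" "closed_under_bideterministic_product W" and VW: "V \<subseteq> W"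
    and S: "S \<in> locally_sgpoids (bidet_bound V)"
  shows "S \<in> dividing_sgpoids W"
proof -
  have Sf: "S \<in> fin_sgpoids" using S by (simp add: locally_sgpoids_def)
  then have Sg: "is_semigroupoid S" "finite (vertices S)" by (auto simp: fin_sgpoids_def)
  define I where "I = {v \<in> vertices S. carrier (local_sgp S v) \<noteq> {}}"
  have I: "v \<in> I" if "carrier (local_sgp S v) \<noteq> {}" for v
    using that Sg(1) by (auto simp: I_def local_sgp_def is_semigroupoid_def)
  have bb: "local_sgp S v \<in> bidet_bound V" if "v \<in> I" for v
    using S that by (auto simp: locally_sgpoids_def I_def)
  \<comment> \<open>There are finitely many vertices, so one exponent serves all nonempty local
    semigroups.\<close>
  obtain N where N: "\<And>v. v \<in> I \<Longrightarrow> covered_at V (local_sgp S v) N"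
    using covered_at_common[of I "local_sgp S" V] bb Sg(2) by (auto simp: I_def bidet_bound_def fin_sgps_def)
  interpret local_ds_rs S N
    using Sg(1) Sf N[OF I] by unfold_locales (auto simp: covered_at_def)
  have "quotient \<in> locally_sgpoids V"
    unfolding locally_sgpoids_def
  proof (intro CollectI conjI quotient_fin ballI impI)
    fix v assume ne: "carrier (local_sgp quotient v) \<noteq> {}"
    then have "carrier (local_sgp S v) \<noteq> {}"
      using rep by (fastforce simp: local_sgp_def quotient_def)
    then show "local_sgp quotient v \<in> V" using quotient_local[OF V N[OF I] ne] by blast
  qed
  then have "quotient \<in> dividing_sgpoids V"
    using loc global_sgpoids_eq[OF V] by (simp add: local_pseudovariety_def)
  then obtain T \<tau> where T: "T \<in> V" "sgpoid_rel quotient T \<tau>" "faithful_rel quotient \<tau>"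
    by (auto simp: dividing_sgpoids_def)
  interpret bidet_cover S N W T "{(s, t). s \<in> edges S \<and> (rep s, t) \<in> \<tau>}"
    using W Sl T(1) VW quotient_cover[OF T(2,3)] by unfold_locales blast+
  show ?thesis by (rule dividing)
qed

theorem theorem9p4:
  fixes V :: "nat sgp set"
  assumes "sgp_pseudovariety V" and "monoidal V"
    and "Sl \<subseteq> V" and "V \<subseteq> DS \<inter> RS"
    and "local_pseudovariety V"
  shows "local_pseudovariety (bideterministic_closure V)"
proof -
  let ?W = "bideterministic_closure V"
  note W = bideterministic_closure_properties[OF assms(1,4)]
  \<comment> \<open>Together with the general inclusion of the global in the local class this closes
    a cycle of inclusions.\<close>
  have "locally_sgpoids ?W \<subseteq> locally_sgpoids (bidet_bound V)"
    using W(4) unfolding locally_sgpoids_def by blast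
  moreover have "locally_sgpoids (bidet_bound V) \<subseteq> dividing_sgpoids ?W"
    using locally_bidet_bound_dividing[OF assms(1,5) _ W(1,2,3)] assms(3) W(3) by blast
  ultimately show ?thesis
    unfolding local_pseudovariety_def global_sgpoids_eq[OF W(1)]
    using dividing_locally[OF W(1)] by blast
qed

end
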